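(* For each $n$ let $0<p_n<1$ and let $\xi^{(n)}_1,\dots,\xi^{(n)}_n$ be i.i.d. with $P(\xi^{(n)}_i=1)=p_n=1-P(\xi^{(n)}_i=0)$. Let $U^{(n,p_n)}$ and $W^{(n,p_n)}$ be the longest length of arithmetic progressions, respectively of arithmetic progressions mod $n$, relative to $\xi^{(n)}_1,\dots,\xi^{(n)}_n$ (defined in the context). Assume that $$\lim_{n\to\infty}p_n=0,\qquad \lim_{n\to\infty}np_n=\infty\qquad\text{and}\qquad \lim_{n\to\infty}\frac{2\ln n}{-\ln p_n}=b,$$ where $b$ may be $+\infty$. Let $[x]$ denote the integer part of $x$. (i) If $b=\infty$, then $$\lim_{n\to\infty}P\left(U^{(n,p_n)}\in\left\{\left[\frac{2\ln n}{-\ln p_n}+\frac{\ln\ln n}{\ln p_n}\right],\ \left[\frac{2\ln n}{-\ln p_n}+\frac{\ln\ln n}{\ln p_n}\right]+1\right\}\right)=1$$ and $$\lim_{n\to\infty}P\left(W^{(n,p_n)}\in\left\{\left[\frac{2\ln n}{-\ln p_n}\right]-1,\ \left[\frac{2\ln n}{-\ln p_n}\right],\ \left[\frac{2\ln n}{-\ln p_n}\right]+1\right\}\right)=1.$$ (ii) If $b=2$, or if $2<b<\infty$ and $b$ is not an integer, then $$\lim_{n\to\infty}P(W^{(n,p_n)}=[b])=\lim_{n\to\infty}P(U^{(n,p_n)}=[b])=1.$$ (iii) If $b\ge3$ and $b$ is an integer, then $$\lim_{n\to\infty}P(W^{(n,p_n)}\in\{b,b-1\})=\lim_{n\to\infty}P(U^{(n,p_n)}\in\{b,b-1\})=1.$$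 If in addition the limit $u=\lim_{n\to\infty}n^2p_n^b\le\infty$ exists (the value $u=\infty$ being allowed), then $$\lim_{n\to\infty}P(U^{(n,p_n)}=b-1)=e^{-\frac{u}{2(b-1)}}=1-\lim_{n\to\infty}P(U^{(n,p_n)}=b)$$ and $$\lim_{n\to\infty}P(W^{(n,p_n)}=b-1)=e^{-\frac u2}=1-\lim_{n\to\infty}P(W^{(n,p_n)}=b).$$
   Context: Given $\{0,1\}$-valued variables $\xi_1,\dots,\xi_n$ (here $\xi_i=\xi^{(n)}_i$): for integers $1\le a,s\le n$ let $$U^{(n)}_{a,s}=\max\{1\le m\le 1+[\tfrac{n-a}{s}]:\ \xi_a=1,\ \xi_{a+s}=1,\dots,\xi_{a+(m-1)s}=1\},$$ $$W^{(n)}_{a,s}=\max\Big\{1\le m\le \frac{n}{\gcd(s,n)}:\ \xi_a=1,\ \xi_{a+s\bmod n}=1,\dots,\xi_{a+(m-1)s\bmod n}=1\Big\},$$ both equal to $0$ if $\xi_a=0$; residues mod $n$ are taken in $\{1,\dots,n\}$ (so $kn\bmod n=n$). The longest length of arithmetic progressions relative to $\xi_1,\dots,\xi_n$ is $\max_{1\le a,s\le n}U^{(n)}_{a,s}$, and the longest length of arithmetic progressions mod $n$ is $\max_{1\le a,s\le n}W^{(n)}_{a,s}$. $\ln$ is the natural logarithm, and $e^{-\infty}=0$. *)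

theory Defs
  imports "HOL-Probability.Probability"
begin

definition ap_length :: "nat \<Rightarrow> (nat \<Rightarrow> nat) \<Rightarrow> nat \<Rightarrow> nat \<Rightarrow> nat" where
  "ap_length n x a s =
     (if x a = 0 then 0
      else Max {m. 1 \<le> m \<and> m \<le> 1 + (n - a) div s \<and> (\<forall>j<m. x (a + j * s) = 1)})"

(* The representative of k mod n in {1..n}, so that multiples of n give n. *)
definition residue :: "nat \<Rightarrow> nat \<Rightarrow> nat" where
  "residue n k = (if n dvd k then n else k mod n)"

definition ap_length_mod :: "nat \<Rightarrow> (nat \<Rightarrow> nat) \<Rightarrow> nat \<Rightarrow> nat \<Rightarrow> nat" where
  "ap_length_mod n x a s =
     (if x a = 0 then 0
      else Max {m. 1 \<le> m \<and> m \<le> n div gcd s n \<and> (\<forall>j<m. x (residue n (a + j * s)) = 1)})"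

definition longest_ap :: "nat \<Rightarrow> (nat \<Rightarrow> nat) \<Rightarrow> nat" where
  "longest_ap n x = Max {ap_length n x a s | a s. a \<in> {1..n} \<and> s \<in> {1..n}}"

definition longest_ap_mod :: "nat \<Rightarrow> (nat \<Rightarrow> nat) \<Rightarrow> nat" where
  "longest_ap_mod n x = Max {ap_length_mod n x a s | a s. a \<in> {1..n} \<and> s \<in> {1..n}}"

definition exp_ereal :: "ereal \<Rightarrow> ereal" where
  "exp_ereal x = (case x of ereal r \<Rightarrow> ereal (exp r) | PInfty \<Rightarrow> \<infinity> | MInfty \<Rightarrow> 0)"

end

theory Submission
  imports Defs "HOL-Real_Asymp.Real_Asymp" "HOL-Number_Theory.Cong"
begin

text \<open>Let \<open>F\<close> be a family of progressions of length \<open>k\<close> and \<open>T\<close> the random set of ones. The probability that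
  \<open>T\<close> contains no member of \<open>F\<close> is controlled by the pairs of members of \<open>F\<close> that intersect. When the mean
  \<open>card F * p ^ k\<close> diverges, the second moment method shows that it tends to 0; when the mean converges to \<open>l\<close>,
  multiplying conditional probabilities one progression at a time gives \<open>(1 - p ^ k) ^ card F\<close> up to a
  vanishing error, hence the limit \<open>exp (- l)\<close>. The pairs are counted by overlap size: two progressions
  modulo \<open>n\<close> that share more than half of their elements have, apart from at most \<open>k ^ 4\<close> differences of
  small additive order, the same difference up to sign, so that one is a translate of the other along
  itself; smaller overlaps are so rare that polynomial bounds in \<open>k\<close> suffice.
  Ordinary progressions are a subfamily of those modulo \<open>n\<close>, which treats both statistics at once: there are
  about \<open>n ^ 2 / (2 * (k - 1))\<close> of the former and \<open>n ^ 2 / 2\<close> of the latter as sets.\<close>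

section \<open>Avoidance probabilities for random subsets\<close>

text \<open>The obstacle is the case b = \<infinity>: the critical length k grows with n, so every
  bound must be uniform in k. There p decays more slowly than any negative power of n, so eventually
  k <= 2 ln n and n p >= sqrt n, and polynomial losses in k are harmless. The exact exponential
  limit is needed only for a fixed length. In the second moment, pairs with one common element
  number about k^2 n per progression; relative to the squared mean they leave a term of order k^3 /
  (n p). This is where n p -> \<infinity> enters. The bound k^2 on additive orders in
  \<open>good_aps\<close> is dictated by large overlaps: each difference is a multiple of the other
  with coefficients t, t' below k in absolute value, and t t' = 1 must follow from t t' s = s modulo
  n. All centerings come from n^2 p^r = exp (- ln p (2 ln n / (- ln p) - r)): the sign of the last
  factor decides whether the mean explodes or vanishes, since - ln p -> \<infinity>.\<close>

locale random_subset = prob_space M for M :: "'i set measure" +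
  fixes I :: "'i set" and p :: real
  assumes sets_UNIV: "sets M = UNIV"
    and finite_I: "finite I"
    and p_ge_0: "0 \<le> p" and p_le_1: "p \<le> 1"
    \<comment> \<open>A product Bernoulli law expressed without coordinates: containing
      \<open>A\<close> is independent of every event about the part of \<open>T\<close> outside
      \<open>A\<close>.\<close>
    and indep: "\<And>A G. A \<subseteq> I \<Longrightarrow>
      prob {T. A \<subseteq> T \<and> T - A \<in> G} = p ^ card A * prob {T. T - A \<in> G}"
begin

lemma in_events [simp, measurable]: "S \<in> events"
  by (simp add: sets_UNIV)

lemma space_UNIV [simp]: "space M = UNIV"
  using sets.sets_into_space[of UNIV M] by auto

lemma prob_superset: "A \<subseteq> I \<Longrightarrow> prob {T. A \<subseteq> T} = p ^ card A"
  using indep[of A UNIV] prob_space by simp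

lemma prob_superset2:
  assumes "A \<subseteq> I" "B \<subseteq> I"
  shows "prob {T. A \<subseteq> T \<and> B \<subseteq> T} = p ^ card (A \<union> B)"
  using prob_superset[of "A \<union> B"] assms by (simp add: Un_subset_iff)

lemma prob_superset_disjoint:
  assumes "A \<subseteq> I" "\<And>j. j \<in> J \<Longrightarrow> A \<inter> B j = {}"
  shows "prob {T. A \<subseteq> T \<and> (\<forall>j\<in>J. \<not> B j \<subseteq> T)} = p ^ card A * prob {T. \<forall>j\<in>J. \<not> B j \<subseteq> T}"
proof -
  have "(\<forall>j\<in>J. \<not> B j \<subseteq> T) \<longleftrightarrow> T - A \<in> {S. \<forall>j\<in>J. \<not> B j \<subseteq> S}" for T
    using assms(2) by (auto simp: subset_iff) blast+
  then show ?thesis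
    using indep[OF assms(1), of "{S. \<forall>j\<in>J. \<not> B j \<subseteq> S}"] by simp
qed

text \<open>Splitting the earlier sets into those meeting the new set \<open>A i\<close> and those disjoint from it,
  each step multiplies the avoidance probability by \<open>1 - p ^ k\<close> up to an error
  that only involves the meeting pairs.\<close>

lemma prob_avoid_all_approx:
  assumes "finite F" "\<And>i. i \<in> F \<Longrightarrow> A i \<subseteq> I" "\<And>i. i \<in> F \<Longrightarrow> card (A i) = k"
  shows "\<bar>prob {T. \<forall>i\<in>F. \<not> A i \<subseteq> T} - (1 - p ^ k) ^ card F\<bar>
    \<le> (\<Sum>i\<in>F. \<Sum>j\<in>{j\<in>F. j \<noteq> i \<and> A i \<inter> A j \<noteq> {}}. p ^ card (A i \<union> A j) + p ^ k * p ^ k)"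
  using assms
proof (induction F rule: finite_induct)
  case empty
  then show ?case using prob_space by simp
next
  case (insert i F)
  let ?q = "\<lambda>J. prob {T. \<forall>j\<in>J. \<not> A j \<subseteq> T}"
  let ?w = "\<lambda>i j. p ^ card (A i \<union> A j) + p ^ k * p ^ k"
  let ?S = "\<lambda>F i. {j\<in>F. j \<noteq> i \<and> A i \<inter> A j \<noteq> {}}"
  define D where "D = {j\<in>F. A i \<inter> A j \<noteq> {}}"
  have fin: "finite F" "finite D" using insert D_def by auto
  have w0: "0 \<le> ?w i j" for i j using p_ge_0 by simp
  have pk: "0 \<le> p ^ k" "p ^ k \<le> 1" using p_ge_0 p_le_1 by (auto simp: power_le_one)
  have DI: "A j \<subseteq> I" "card (A j) = k" if "j \<in> insert i F" for j using insert that by auto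
  let ?x = "prob {T. A i \<subseteq> T \<and> (\<forall>j\<in>F. \<not> A j \<subseteq> T)}"
  let ?y = "prob {T. A i \<subseteq> T \<and> (\<forall>j\<in>F-D. \<not> A j \<subseteq> T)}"
  have split: "?q F = ?q (insert i F) + ?x"
    by (subst finite_measure_Union[symmetric]) (auto intro!: arg_cong[where f=prob])
  have y: "?y = p ^ k * ?q (F - D)"
    using prob_superset_disjoint[of "A i" "F - D" A] DI by (auto simp: D_def)
  have xy: "?x \<le> ?y" by (rule finite_measure_mono) auto
  have "?y \<le> prob ({T. A i \<subseteq> T \<and> (\<forall>j\<in>F. \<not> A j \<subseteq> T)} \<union> (\<Union>j\<in>D. {T. A i \<subseteq> T \<and> A j \<subseteq> T}))"
    by (rule finite_measure_mono) auto
  also have "\<dots> \<le> ?x + prob (\<Union>j\<in>D. {T. A i \<subseteq> T \<and> A j \<subseteq> T})"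
    by (rule measure_Un_le) auto
  also have "prob (\<Union>j\<in>D. {T. A i \<subseteq> T \<and> A j \<subseteq> T}) \<le> (\<Sum>j\<in>D. prob {T. A i \<subseteq> T \<and> A j \<subseteq> T})"
    by (rule finite_measure_subadditive_finite) (use fin in auto)
  also have "\<dots> = (\<Sum>j\<in>D. p ^ card (A i \<union> A j))"
    by (intro sum.cong prob_superset2 refl) (use DI in \<open>auto simp: D_def\<close>)
  finally have yx: "?y \<le> ?x + (\<Sum>j\<in>D. p ^ card (A i \<union> A j))" by simp
  have qq: "?q F \<le> ?q (F - D)" by (rule finite_measure_mono) auto
  have "?q (F - D) \<le> prob ({T. \<forall>j\<in>F. \<not> A j \<subseteq> T} \<union> (\<Union>j\<in>D. {T. A j \<subseteq> T}))"
    by (rule finite_measure_mono) auto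
  also have "\<dots> \<le> ?q F + prob (\<Union>j\<in>D. {T. A j \<subseteq> T})"
    by (rule measure_Un_le) auto
  also have "prob (\<Union>j\<in>D. {T. A j \<subseteq> T}) \<le> (\<Sum>j\<in>D. prob {T. A j \<subseteq> T})"
    by (rule finite_measure_subadditive_finite) (use fin in auto)
  also have "\<dots> = (\<Sum>j\<in>D. p ^ k)"
    by (intro sum.cong refl) (use DI in \<open>auto simp: D_def prob_superset\<close>)
  finally have qq2: "?q (F - D) \<le> ?q F + (\<Sum>j\<in>D. p ^ k)" by simp
  have "p ^ k * ?q (F - D) \<le> p ^ k * (?q F + (\<Sum>j\<in>D. p ^ k))"
    using qq2 pk by (intro mult_left_mono)
  then have y_up: "?y \<le> p ^ k * ?q F + (\<Sum>j\<in>D. p ^ k * p ^ k)"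
    unfolding y by (simp add: algebra_simps sum_distrib_left)
  have y_lo: "p ^ k * ?q F \<le> ?y"
    unfolding y using qq pk by (intro mult_left_mono)
  have s0: "0 \<le> (\<Sum>j\<in>D. p ^ card (A i \<union> A j))" "0 \<le> (\<Sum>j\<in>D. p ^ k * p ^ k)"
    using p_ge_0 by (auto intro!: sum_nonneg)
  have step: "\<bar>?q (insert i F) - (1 - p ^ k) * ?q F\<bar> \<le> (\<Sum>j\<in>D. ?w i j)"
    using split xy yx y_up y_lo s0 by (simp add: sum.distrib algebra_simps abs_le_iff)
  have IH: "\<bar>?q F - (1 - p ^ k) ^ card F\<bar> \<le> (\<Sum>i\<in>F. \<Sum>j\<in>?S F i. ?w i j)"
    using insert by auto
  \<comment> \<open>Multiplication by 1 - p^k is a contraction, so the errors of the successive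
    steps merely add up.\<close>
  have "\<bar>(1 - p ^ k) * (?q F - (1 - p ^ k) ^ card F)\<bar> \<le> 1 * \<bar>?q F - (1 - p ^ k) ^ card F\<bar>"
    unfolding abs_mult using pk by (intro mult_right_mono) auto
  then have "\<bar>?q (insert i F) - (1 - p ^ k) ^ card (insert i F)\<bar>
      \<le> (\<Sum>j\<in>D. ?w i j) + (\<Sum>i\<in>F. \<Sum>j\<in>?S F i. ?w i j)"
    using step IH insert.hyps by (simp add: algebra_simps)
  also have "(\<Sum>i\<in>F. \<Sum>j\<in>?S F i. ?w i j) \<le> (\<Sum>i'\<in>F. \<Sum>j\<in>?S (insert i F) i'. ?w i' j)"
    using w0 fin by (intro sum_mono sum_mono2) auto
  also have "(\<Sum>j\<in>D. ?w i j) = (\<Sum>j\<in>?S (insert i F) i. ?w i j)"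
    using insert.hyps by (intro sum.cong) (auto simp: D_def)
  finally show ?case using insert.hyps by simp
qed

text \<open>Chebyshev's argument: the number X of contained sets vanishes on the avoidance event, so
  (X - \<mu>)^2 equals \<mu>^2 there. In E X^2 the disjoint pairs contribute at most \<mu>^2, which
  cancels; the diagonal and the meeting pairs remain. Without a division by \<mu>^2 the bound also
  covers \<mu> = 0.\<close>

lemma prob_avoid_all_second_moment:
  assumes "finite F" "\<And>i. i \<in> F \<Longrightarrow> A i \<subseteq> I" "\<And>i. i \<in> F \<Longrightarrow> card (A i) = k"
  shows "prob {T. \<forall>i\<in>F. \<not> A i \<subseteq> T} * (real (card F) * p ^ k)\<^sup>2
    \<le> real (card F) * p ^ k
       + (\<Sum>i\<in>F. \<Sum>j\<in>{j\<in>F. j \<noteq> i \<and> A i \<inter> A j \<noteq> {}}. p ^ card (A i \<union> A j))"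
proof -
  let ?ind = "\<lambda>i T. indicator {T. A i \<subseteq> T} T :: real"
  let ?\<mu> = "real (card F) * p ^ k"
  define X where "X T = (\<Sum>i\<in>F. ?ind i T)" for T
  have EX: "expectation X = ?\<mu>"
    unfolding X_def using assms
    by (subst Bochner_Integration.integral_sum) (auto simp: prob_superset less_top[symmetric])
  have X2: "(X T)\<^sup>2 = (\<Sum>i\<in>F. \<Sum>j\<in>F. indicator {T. A i \<subseteq> T \<and> A j \<subseteq> T} T)" for T
    unfolding X_def power2_eq_square sum_product
    by (intro sum.cong refl) (auto simp: indicator_def)
  have EX2: "expectation (\<lambda>T. (X T)\<^sup>2) = (\<Sum>i\<in>F. \<Sum>j\<in>F. p ^ card (A i \<union> A j))"
    unfolding X2 using assms
    by (subst Bochner_Integration.integral_sum; (subst Bochner_Integration.integral_sum)?)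
       (auto simp: prob_superset2 less_top[symmetric] intro!: sum.cong)
  have int: "integrable M X" "integrable M (\<lambda>T. (X T)\<^sup>2)"
    unfolding X2 unfolding X_def by (auto simp: less_top[symmetric])
  have "prob {T. \<forall>i\<in>F. \<not> A i \<subseteq> T} * ?\<mu>\<^sup>2
      = expectation (\<lambda>T. indicator {T. \<forall>i\<in>F. \<not> A i \<subseteq> T} T * ?\<mu>\<^sup>2)"
    by simp
  also have "\<dots> \<le> expectation (\<lambda>T. (X T)\<^sup>2 - 2 * ?\<mu> * X T + ?\<mu>\<^sup>2)"
  proof (rule integral_mono)
    show "integrable M (\<lambda>T. (X T)\<^sup>2 - 2 * ?\<mu> * X T + ?\<mu>\<^sup>2)"
      using int by auto
    fix T
    have "(X T)\<^sup>2 - 2 * ?\<mu> * X T + ?\<mu>\<^sup>2 = (X T - ?\<mu>)\<^sup>2"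
      by (simp add: power2_eq_square algebra_simps)
    moreover have "X T = 0" if "\<forall>i\<in>F. \<not> A i \<subseteq> T"
      using that by (auto simp: X_def)
    ultimately show "indicator {T. \<forall>i\<in>F. \<not> A i \<subseteq> T} T * ?\<mu>\<^sup>2 \<le> (X T)\<^sup>2 - 2 * ?\<mu> * X T + ?\<mu>\<^sup>2"
      by (auto simp: indicator_def)
  qed (auto simp: less_top[symmetric])
  also have "\<dots> = (\<Sum>i\<in>F. \<Sum>j\<in>F. p ^ card (A i \<union> A j)) - ?\<mu>\<^sup>2"
    using int EX EX2 prob_space by (simp add: power2_eq_square)
  also have "(\<Sum>i\<in>F. \<Sum>j\<in>F. p ^ card (A i \<union> A j))
      \<le> (\<Sum>i\<in>F. p ^ k + (\<Sum>j\<in>{j\<in>F. j \<noteq> i \<and> A i \<inter> A j \<noteq> {}}. p ^ card (A i \<union> A j))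
              + real (card F) * (p ^ k * p ^ k))"
  proof (rule sum_mono)
    fix i assume i: "i \<in> F"
    let ?D = "{j\<in>F. j \<noteq> i \<and> A i \<inter> A j \<noteq> {}}"
    have fA: "finite (A j)" if "j \<in> F" for j
      using assms(2)[OF that] finite_I by (rule finite_subset)
    have "(\<Sum>j\<in>F. p ^ card (A i \<union> A j)) = p ^ card (A i) + (\<Sum>j\<in>F - {i}. p ^ card (A i \<union> A j))"
      using sum.remove[OF assms(1) i, of "\<lambda>j. p ^ card (A i \<union> A j)"] by simp
    also have "(\<Sum>j\<in>F - {i}. p ^ card (A i \<union> A j))
        = (\<Sum>j\<in>?D. p ^ card (A i \<union> A j)) + (\<Sum>j\<in>F - {i} - ?D. p ^ card (A i \<union> A j))"
      by (subst sum.subset_diff[of ?D "F - {i}"]) (use assms(1) in auto)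
    also have "(\<Sum>j\<in>F - {i} - ?D. p ^ card (A i \<union> A j)) = (\<Sum>j\<in>F - {i} - ?D. p ^ k * p ^ k)"
      using i assms(3) by (intro sum.cong refl)
        (auto simp: card_Un_disjoint fA power_add)
    also have "\<dots> \<le> (\<Sum>j\<in>F. p ^ k * p ^ k)"
      using p_ge_0 assms(1) by (intro sum_mono2) auto
    finally show "(\<Sum>j\<in>F. p ^ card (A i \<union> A j)) \<le> p ^ k + (\<Sum>j\<in>?D. p ^ card (A i \<union> A j))
              + real (card F) * (p ^ k * p ^ k)"
      using assms(3)[OF i] by simp
  qed
  finally show ?thesis by (simp add: sum.distrib power2_eq_square algebra_simps)
qed

end

section \<open>Overlaps of progressions modulo n\<close>

lemma residue_in: "1 \<le> n \<Longrightarrow> residue n x \<in> {1..n}"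
  by (auto simp: residue_def Suc_le_eq dvd_eq_mod_eq_0 intro: less_imp_le)

lemma cong_residue: "[residue n x = x] (mod n)"
  by (auto simp: residue_def cong_def)

lemma residue_eq_iff: "residue n x = residue n y \<longleftrightarrow> [x = y] (mod n)"
proof
  assume eq: "residue n x = residue n y"
  show "[x = y] (mod n)"
    using cong_trans[OF cong_sym[OF cong_residue[of n x]]] cong_residue[of n y] eq by simp
next
  assume "[x = y] (mod n)"
  then show "residue n x = residue n y"
    by (simp add: residue_def cong_def dvd_eq_mod_eq_0)
qed

lemma residue_id: "x \<in> {1..n} \<Longrightarrow> residue n x = x"
  by (cases "x = n") (auto simp: residue_def dest: nat_dvd_not_less)

lemma residue_eq_iff_int:
  "residue n x = residue n y \<longleftrightarrow> [int x = int y] (mod int n)"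
  by (simp add: residue_eq_iff cong_int_iff)

text \<open>Wrapping by \<open>residue\<close> lets one function serve both statistics: if the
  progression stays inside {1..n}, no reduction takes place.\<close>

definition ap_set :: "nat \<Rightarrow> nat \<Rightarrow> nat \<times> nat \<Rightarrow> nat set" where
  "ap_set n k = (\<lambda>(a, s). (\<lambda>j. residue n (a + j * s)) ` {..<k})"

text \<open>The condition on the additive order of the difference makes progressions with different data
  overlap as little as they do in the integers; \<open>2 * s < n\<close> picks one of the two orientations.\<close>

definition good_aps :: "nat \<Rightarrow> nat \<Rightarrow> (nat \<times> nat) set" where
  "good_aps n k = {(a, s). a \<in> {1..n} \<and> 1 \<le> s \<and> 2 * s < n \<and> (\<forall>m\<in>{1..k\<^sup>2}. \<not> n dvd m * s)}"

lemma finite_good_aps: "finite (good_aps n k)"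
  by (rule finite_subset[of _ "{1..n} \<times> {1..n}"]) (auto simp: good_aps_def)

lemma good_apsD:
  assumes "(a, s) \<in> good_aps n k"
  shows "1 \<le> n" "a \<in> {1..n}" "s \<in> {1..n}" "1 \<le> s" "2 * s < n"
  using assms by (auto simp: good_aps_def)

text \<open>This is how the order condition gets used: a congruence modulo n between multiples of
  \<open>s\<close> becomes an equality of integer coefficients as soon as these differ by at most
  k^2.\<close>

lemma good_aps_dvd_imp_zero:
  assumes "(a, s) \<in> good_aps n k" "int n dvd m * int s" "\<bar>m\<bar> \<le> int k ^ 2"
  shows "m = 0"
proof (rule ccontr)
  assume "m \<noteq> 0"
  then have "nat \<bar>m\<bar> \<in> {1..k\<^sup>2}"
    using assms(3) by (simp add: nat_le_iff)
  then have "\<not> n dvd nat \<bar>m\<bar> * s"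
    using assms(1) unfolding good_aps_def by blast
  then have "\<not> int n dvd int (nat \<bar>m\<bar> * s)" by (simp only: int_dvd_int_iff not_False_eq_True)
  then show False using assms(2) by (simp add: abs_if split: if_splits)
qed

lemma ap_set_subset: "1 \<le> n \<Longrightarrow> ap_set n k P \<subseteq> {1..n}"
  using residue_in by (auto simp: ap_set_def split: prod.splits)

lemma ap_set_iff:
  assumes "1 \<le> n"
  shows "residue n x \<in> ap_set n k (a, s) \<longleftrightarrow> (\<exists>j<k. [int x = int a + int j * int s] (mod int n))"
  using assms by (auto simp: ap_set_def image_iff residue_eq_iff_int)

lemma int_le_square: "int k \<le> int k ^ 2"
  by (cases k) (simp_all add: power2_eq_square algebra_simps)

lemma inj_on_ap:
  assumes "(a, s) \<in> good_aps n k"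
  shows "inj_on (\<lambda>j. residue n (a + j * s)) {..<k}"
proof (rule inj_onI)
  fix i j assume ij: "i \<in> {..<k}" "j \<in> {..<k}" and eq: "residue n (a + i * s) = residue n (a + j * s)"
  have "int n dvd (int a + int i * int s) - (int a + int j * int s)"
    using eq good_apsD(1)[OF assms] by (simp add: residue_eq_iff_int cong_iff_dvd_diff)
  then have "int n dvd (int i - int j) * int s" by (simp add: algebra_simps)
  moreover have "\<bar>int i - int j\<bar> \<le> int k ^ 2"
    using ij int_le_square[of k] unfolding lessThan_iff by linarith
  ultimately show "i = j" using good_aps_dvd_imp_zero[OF assms, of "int i - int j"] by simp
qed

lemma card_ap_set: "P \<in> good_aps n k \<Longrightarrow> card (ap_set n k P) = k"
  using inj_on_ap by (cases P) (auto simp: ap_set_def card_image)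

section \<open>Counting the progressions that meet a given one\<close>

lemma card_linear_cong_solutions:
  assumes "1 \<le> m" "1 \<le> n"
  shows "card {s\<in>{1..n}. [int m * int s = c] (mod int n)} \<le> m"
proof -
  let ?S = "{s\<in>{1..n}. [int m * int s = c] (mod int n)}"
  let ?f = "\<lambda>s. (int m * int s - c) div int n"
  \<comment> \<open>The quotients (m s - c) / n determine s. Since 0 < m s <= m n and t is the floor
    of - c / n, they lie in the m integers after t.\<close>
  define t where "t = (- c) div int n"
  have f: "int n * ?f s = int m * int s - c" if "s \<in> ?S" for s
    using that by (auto simp: cong_iff_dvd_diff)
  have "inj_on ?f ?S"
  proof (rule inj_onI)
    fix x y assume xy: "x \<in> ?S" "y \<in> ?S" "?f x = ?f y"
    have "int n * ?f x = int n * ?f y" using xy(3) by (rule arg_cong)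
    then have "int m * int x = int m * int y" using f[OF xy(1)] f[OF xy(2)] by linarith
    then show "x = y" using assms by simp
  qed
  moreover have "?f ` ?S \<subseteq> {t<..t + int m}"
  proof
    fix q assume "q \<in> ?f ` ?S"
    then obtain s where s: "s \<in> ?S" "q = ?f s" by auto
    then have q: "int n * q = int m * int s - c" using f by simp
    have "int n * t + (- c) mod int n = - c" unfolding t_def by (rule mult_div_mod_eq)
    moreover have "0 \<le> (- c) mod int n" "(- c) mod int n < int n"
      using assms by (intro pos_mod_sign pos_mod_bound; simp)+
    ultimately have t: "int n * t \<le> - c" "- c < int n * t + int n"
      by linarith+
    have "1 \<le> int m * int s" using s assms by (auto simp: one_le_mult_iff simp flip: of_nat_mult)
    then have "int n * t < int n * q" using q t by linarith
    moreover have "int m * int s \<le> int n * int m" using s by (simp add: mult.commute mult_left_mono)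
    then have "int n * q < int n * (t + 1 + int m)" using q t by (simp add: algebra_simps)
    ultimately show "q \<in> {t<..t + int m}" using assms by simp
  qed
  ultimately have "card ?S \<le> card {t<..t + int m}"
    by (intro card_inj_on_le) auto
  then show ?thesis by simp
qed

text \<open>There are k^2 multipliers m, and each admits at most m <= k^2 solutions s.\<close>

lemma card_short_order:
  assumes "1 \<le> n"
  shows "card {s\<in>{1..n}. \<exists>m\<in>{1..k\<^sup>2}. n dvd m * s} \<le> k ^ 4"
proof -
  have "{s\<in>{1..n}. \<exists>m\<in>{1..k\<^sup>2}. n dvd m * s}
      = (\<Union>m\<in>{1..k\<^sup>2}. {s\<in>{1..n}. [int m * int s = 0] (mod int n)})"
    by (auto simp: cong_0_iff simp flip: of_nat_mult)
  also have "card \<dots> \<le> (\<Sum>m\<in>{1..k\<^sup>2}. card {s\<in>{1..n}. [int m * int s = 0] (mod int n)})"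
    by (rule card_UN_le) simp
  also have "\<dots> \<le> (\<Sum>m\<in>{1..k\<^sup>2}. k\<^sup>2)"
    by (rule sum_mono, rule order_trans[OF card_linear_cong_solutions]) (use assms in auto)
  finally show ?thesis by (simp add: power2_eq_square power4_eq_xxxx)
qed

lemma card_le_by_snd:
  assumes "inj_on snd S" "snd ` S \<subseteq> T" "finite T" "card T \<le> m"
  shows "finite S" "card S \<le> m"
  using assms card_inj_on_le[OF assms(1-3)] by (auto intro: inj_on_finite)

text \<open>Once the difference and the value at position i are known, the start is determined
  modulo n, hence in {1..n}. Counting progressions thus reduces to counting differences.\<close>

lemma inj_on_snd_aps:
  assumes "1 \<le> n"
  shows "inj_on snd {(a, s). a \<in> {1..n} \<and> [int a + int i * int s = y] (mod int n) \<and> R s}"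
proof (rule inj_onI, clarsimp)
  fix a a' s :: nat
  assume A: "Suc 0 \<le> a" "a \<le> n" "Suc 0 \<le> a'" "a' \<le> n"
    "[int a + int i * int s = y] (mod int n)" "[int a' + int i * int s = y] (mod int n)"
  have "[int a + int i * int s = int a' + int i * int s] (mod int n)"
    using A(5) cong_sym[OF A(6)] by (rule cong_trans)
  then have "[int a = int a'] (mod int n)" by (simp add: cong_add_rcancel)
  then have "residue n a = residue n a'" using assms by (simp add: residue_eq_iff_int)
  then show "a = a'" using A by (simp add: residue_id)
qed

text \<open>The positions of a common element in both progressions give k^2 choices and the second
  difference n choices; the second start is then forced.\<close>

lemma card_meeting:
  fixes n k :: nat and P :: "nat \<times> nat"
  assumes "1 \<le> n"
  defines "S \<equiv> {Q \<in> {1..n} \<times> {1..n}. ap_set n k P \<inter> ap_set n k Q \<noteq> {}}"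
  shows "card S \<le> k\<^sup>2 * n"
proof -
  obtain a s where P: "P = (a, s)" by (cases P)
  let ?T = "\<lambda>i j. {(a', s'). a' \<in> {1..n} \<and> [int a' + int i * int s' = int a + int j * int s] (mod int n)
      \<and> s' \<in> {1..n}}"
  have sub: "S \<subseteq> (\<Union>i\<in>{..<k}. \<Union>j\<in>{..<k}. ?T i j)"
  proof
    fix Q assume "Q \<in> S"
    then obtain a' s' where Q: "Q = (a', s')" "a' \<in> {1..n}" "s' \<in> {1..n}"
      "ap_set n k (a, s) \<inter> ap_set n k (a', s') \<noteq> {}" by (cases Q) (auto simp: S_def P)
    then obtain i j where "i < k" "j < k" "residue n (a + j * s) = residue n (a' + i * s')"
      by (auto simp: ap_set_def)
    moreover from this(3) have "[int a' + int i * int s' = int a + int j * int s] (mod int n)"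
      unfolding residue_eq_iff_int by (simp add: cong_sym_eq)
    ultimately show "Q \<in> (\<Union>i\<in>{..<k}. \<Union>j\<in>{..<k}. ?T i j)"
      using Q by blast
  qed
  have T: "finite (?T i j)" "card (?T i j) \<le> n" for i j
    by (rule card_le_by_snd[OF inj_on_snd_aps[OF assms(1)], of _ _ _ "{1..n}"]; auto)+
  have "card S \<le> card (\<Union>i\<in>{..<k}. \<Union>j\<in>{..<k}. ?T i j)"
    using T by (intro card_mono sub) auto
  also have "\<dots> \<le> (\<Sum>i\<in>{..<k}. card (\<Union>j\<in>{..<k}. ?T i j))" by (rule card_UN_le) simp
  also have "\<dots> \<le> (\<Sum>i\<in>{..<k}. \<Sum>j\<in>{..<k}. card (?T i j))" by (intro sum_mono card_UN_le) simp
  also have "\<dots> \<le> (\<Sum>i\<in>{..<k}. \<Sum>j\<in>{..<k}. n)" using T by (intro sum_mono)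
  finally show ?thesis by (simp add: power2_eq_square)
qed

text \<open>Two common elements, at positions i < i' of the second progression and j, j' of the
  first, give (i' - i) s' = (j' - j) s modulo n, which has at most i' - i < k solutions s'. With at
  most k^4 position patterns the bound k^5 is free of n.\<close>

lemma card_meeting_twice:
  fixes n k :: nat and P :: "nat \<times> nat"
  assumes "1 \<le> n"
  defines "S \<equiv> {Q \<in> {1..n} \<times> {1..n}. 2 \<le> card (ap_set n k P \<inter> ap_set n k Q)}"
  shows "card S \<le> k ^ 5"
proof -
  obtain a s where P: "P = (a, s)" by (cases P)
  let ?T = "\<lambda>(i, i', j, j'). {(a', s'). a' \<in> {1..n} \<and>
      [int a' + int i * int s' = int a + int j * int s] (mod int n) \<and>
      s' \<in> {s'\<in>{1..n}. [int (i' - i) * int s' = (int j' - int j) * int s] (mod int n)}}"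
  let ?K = "{(i, i', j, j'). i < i' \<and> i' < k \<and> j < k \<and> j' < k}"
  have K: "?K \<subseteq> {..<k} \<times> {..<k} \<times> {..<k} \<times> {..<k}" by auto
  then have finK: "finite ?K" by (rule finite_subset) auto
  have "card ?K \<le> card ({..<k} \<times> {..<k} \<times> {..<k} \<times> {..<k})" by (rule card_mono[OF _ K]) auto
  then have cardK: "card ?K \<le> k ^ 4" by (simp add: card_cartesian_product power4_eq_xxxx mult.assoc)
  have sub: "S \<subseteq> (\<Union>t\<in>?K. ?T t)"
  proof
    fix Q assume "Q \<in> S"
    then obtain a' s' where Q: "Q = (a', s')" "a' \<in> {1..n}" "s' \<in> {1..n}"
      "2 \<le> card (ap_set n k (a, s) \<inter> ap_set n k (a', s'))" by (cases Q) (auto simp: S_def P)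
    obtain U where "U \<subseteq> ap_set n k (a, s) \<inter> ap_set n k (a', s')" "card U = 2"
      using obtain_subset_with_card_n[OF Q(4)] by blast
    then obtain x y where xy: "x \<noteq> y" "x \<in> ap_set n k (a, s)" "x \<in> ap_set n k (a', s')"
      "y \<in> ap_set n k (a, s)" "y \<in> ap_set n k (a', s')"
      by (auto simp: card_2_iff)
    \<comment> \<open>The two common elements are interchangeable, so they may be ordered by their
      position in the second progression; this makes i' - i a positive multiplier.\<close>
    have "\<exists>i i' j j' x y. i < i' \<and> i' < k \<and> j < k \<and> j' < k
        \<and> residue n (a' + i * s') = x \<and> residue n (a + j * s) = x
        \<and> residue n (a' + i' * s') = y \<and> residue n (a + j' * s) = y"
    proof -
      obtain i i' j j' where ij: "i < k" "i' < k" "j < k" "j' < k"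
        "residue n (a' + i * s') = x" "residue n (a + j * s) = x"
        "residue n (a' + i' * s') = y" "residue n (a + j' * s) = y"
        using xy by (auto simp: ap_set_def)
      then have "i \<noteq> i'" using xy(1) by auto
      then consider "i < i'" | "i' < i" by linarith
      then show ?thesis
      proof cases
        case 1 then show ?thesis using ij by blast
      next
        case 2 then show ?thesis using ij by blast
      qed
    qed
    then obtain i i' j j' where ij: "i < i'" "i' < k" "j < k" "j' < k"
      and eq: "residue n (a' + i * s') = residue n (a + j * s)"
        "residue n (a' + i' * s') = residue n (a + j' * s)" by metis
    have c: "[int a' + int i * int s' = int a + int j * int s] (mod int n)"
        "[int a' + int i' * int s' = int a + int j' * int s] (mod int n)"
      using eq assms(1) by (simp_all add: residue_eq_iff_int)
    have "[int (i' - i) * int s' = (int j' - int j) * int s] (mod int n)"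
      using cong_diff[OF c(2) c(1)] ij(1) by (simp add: of_nat_diff algebra_simps)
    then show "Q \<in> (\<Union>t\<in>?K. ?T t)"
      using Q ij c by (intro UN_I[of "(i, i', j, j')"]) auto
  qed
  have T: "finite (?T t)" "card (?T t) \<le> k" if "t \<in> ?K" for t
  proof -
    obtain i i' j j' where t: "t = (i, i', j, j')" by (metis prod_cases4)
    let ?R = "{s'\<in>{1..n}. [int (i' - i) * int s' = (int j' - int j) * int s] (mod int n)}"
    have "card ?R \<le> i' - i" using that t assms(1) by (intro card_linear_cong_solutions) auto
    then have R: "card ?R \<le> k" using that t by auto
    have inj: "inj_on snd (?T t)" using inj_on_snd_aps[OF assms(1), of i _ "\<lambda>s'. s' \<in> ?R"] unfolding t by simp
    show "finite (?T t)" "card (?T t) \<le> k"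
      by (rule card_le_by_snd[OF inj, of ?R]; use R t in auto)+
  qed
  have "card S \<le> card (\<Union>t\<in>?K. ?T t)"
    using T finK by (intro card_mono sub finite_UN_I) blast+
  also have "\<dots> \<le> (\<Sum>t\<in>?K. card (?T t))" by (rule card_UN_le[OF finK])
  also have "\<dots> \<le> (\<Sum>t\<in>?K. k)" using T by (intro sum_mono) blast
  also have "\<dots> \<le> k ^ 5" using cardK by (simp add: eval_nat_numeral)
  finally show ?thesis .
qed

section \<open>Pairs of progressions with a large overlap\<close>

lemma consecutive_elements:
  assumes "J \<subseteq> {..<k}" "k + 2 \<le> 2 * card J"
  shows "\<exists>j. j \<in> J \<and> Suc j \<in> J"
proof (rule ccontr)
  assume "\<not> ?thesis"
  then have disj: "J \<inter> Suc ` J = {}" by auto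
  have fin: "finite J" using assms(1) by (rule finite_subset) simp
  have "card J + card (Suc ` J) = card (J \<union> Suc ` J)"
    using card_Un_disjoint[OF fin _ disj] fin by simp
  \<comment> \<open>J and its shift would be disjoint subsets of k + 1 positions, forcing 2 |J| <= k
    + 1. Hence the threshold k + 2.\<close>
  also have "\<dots> \<le> card {..k}" using assms(1) by (intro card_mono) auto
  finally show False using assms(2) by (simp add: card_image)
qed

text \<open>If two good progressions share more than half of their elements, then consecutive elements of one
  occur in the other, so each difference is a small multiple of the other.\<close>

lemma difference_multiple:
  assumes P: "(a, s) \<in> good_aps n k" and Q: "(a', s') \<in> good_aps n k"
    and large: "k + 2 \<le> 2 * card (ap_set n k (a, s) \<inter> ap_set n k (a', s'))"
  obtains j u t where "j < k" "u < k" "\<bar>t\<bar> < int k"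
    "[int a + int j * int s = int a' + int u * int s'] (mod int n)"
    "[int s = t * int s'] (mod int n)"
proof -
  have n: "1 \<le> n" using good_apsD(1)[OF P] .
  let ?f = "\<lambda>j. residue n (a + j * s)"
  define J where "J = {j\<in>{..<k}. ?f j \<in> ap_set n k (a', s')}"
  have "ap_set n k (a, s) \<inter> ap_set n k (a', s') = ?f ` J"
    by (auto simp: ap_set_def J_def)
  moreover have "inj_on ?f J" using inj_on_ap[OF P] by (rule inj_on_subset) (auto simp: J_def)
  ultimately have "k + 2 \<le> 2 * card J" using large by (simp add: card_image)
  then obtain j where "j \<in> J" "Suc j \<in> J"
    using consecutive_elements[of J k] by (auto simp: J_def)
  then obtain u v where uv: "j < k" "u < k" "v < k"
    "[int a + int j * int s = int a' + int u * int s'] (mod int n)"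
    "[int a + int (Suc j) * int s = int a' + int v * int s'] (mod int n)"
    using n by (auto simp: J_def ap_set_iff)
  have "[int s = (int v - int u) * int s'] (mod int n)"
    using cong_diff[OF uv(5) uv(4)] by (simp add: algebra_simps)
  moreover have "\<bar>int v - int u\<bar> < int k" using uv by auto
  ultimately show ?thesis using that uv by blast
qed

text \<open>From s = t s' and s' = t' s modulo n the order condition yields t t' = 1. The value t =
  -1 would make n divide s + s', impossible as both differences are below n / 2. So the differences
  agree, the second progression is the first one moved by i steps, and a move by i steps destroys at
  least |i| common elements.\<close>

lemma large_overlap:
  assumes P: "(a, s) \<in> good_aps n k" and Q: "(a', s') \<in> good_aps n k"
    and neq: "(a', s') \<noteq> (a, s)"
    and large: "k + 2 \<le> 2 * card (ap_set n k (a, s) \<inter> ap_set n k (a', s'))"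
  shows "s' = s \<and> (\<exists>i::int. i \<noteq> 0 \<and> \<bar>i\<bar> < int k \<and> [int a' = int a + i * int s] (mod int n)
      \<and> card (ap_set n k (a, s) \<inter> ap_set n k (a', s')) + nat \<bar>i\<bar> \<le> k)"
proof -
  have n: "1 \<le> n" using good_apsD(1)[OF P] .
  obtain j u t where j: "j < k" "u < k" "\<bar>t\<bar> < int k"
    and c1: "[int a + int j * int s = int a' + int u * int s'] (mod int n)"
    and c2: "[int s = t * int s'] (mod int n)"
    using difference_multiple[OF P Q large] by blast
  have k: "1 \<le> k" using j by simp
  obtain j' u' t' where t': "\<bar>t'\<bar> < int k" and c3: "[int s' = t' * int s] (mod int n)"
    using difference_multiple[OF Q P] large by (metis Int_commute)
  have "[int s = t * (t' * int s)] (mod int n)"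
    using cong_trans[OF c2 cong_scalar_left[OF c3]] .
  then have "[t * (t' * int s) = int s] (mod int n)" by (rule cong_sym)
  then have dvd: "int n dvd (t * t' - 1) * int s" by (simp add: cong_iff_dvd_diff algebra_simps)
  \<comment> \<open>Since |t| and |t'| are at most k - 1, |t t' - 1| is at most (k - 1)^2 + 1 <=
    k^2. This is the reason for k^2 in \<open>good_aps\<close>.\<close>
  have "\<bar>t * t'\<bar> \<le> (int k - 1) * (int k - 1)"
    unfolding abs_mult using j t' by (intro mult_mono) auto
  then have "\<bar>t * t' - 1\<bar> \<le> int k ^ 2"
    using k by (simp add: power2_eq_square algebra_simps)
  then have "t * t' = 1" using good_aps_dvd_imp_zero[OF P dvd] by simp
  then consider "t = 1" | "t = - 1" using zmult_eq_1_iff by blast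
  then have ss: "s' = s"
  proof cases
    case 1
    then have "[s = s'] (mod n)" using c2 by (simp add: cong_int_iff)
    then have "residue n s = residue n s'" using n by (simp add: residue_eq_iff)
    then show ?thesis using good_apsD(3)[OF P] good_apsD(3)[OF Q] by (simp add: residue_id)
  next
    case 2
    then have "int n dvd int (s + s')" using c2 by (simp add: cong_iff_dvd_diff)
    then have "n dvd s + s'" by (simp only: int_dvd_int_iff)
    then have "n \<le> s + s'" using good_apsD(4)[OF P] by (auto dest: dvd_imp_le)
    then show ?thesis using good_apsD(5)[OF P] good_apsD(5)[OF Q] by simp
  qed
  define i where "i = int j - int u"
  have i: "[int a' = int a + i * int s] (mod int n)"
  proof -
    have "[int a + int j * int s - int u * int s = int a' + int u * int s - int u * int s] (mod int n)"
      using cong_diff[OF c1 cong_refl[of "int u * int s"]] ss by simp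
    then show ?thesis by (simp add: i_def algebra_simps cong_sym)
  qed
  have i0: "i \<noteq> 0"
  proof
    assume "i = 0"
    then have "residue n a' = residue n a" using i n by (simp add: residue_eq_iff_int)
    then show False using neq ss good_apsD(2)[OF P] good_apsD(2)[OF Q] by (simp add: residue_id)
  qed
  have ik: "\<bar>i\<bar> < int k" using j by (auto simp: i_def)
  let ?f = "\<lambda>j. residue n (a + nat j * s)"
  \<comment> \<open>A common element at positions v and w satisfies v = i + w, so v runs through a
    window of k - |i| positions.\<close>
  have "ap_set n k (a, s) \<inter> ap_set n k (a', s') \<subseteq> ?f ` {max 0 i..<min (int k) (int k + i)}"
  proof
    fix x assume "x \<in> ap_set n k (a, s) \<inter> ap_set n k (a', s')"
    then obtain v w where v: "v < k" "x = residue n (a + v * s)" and w: "w < k"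
      "x = residue n (a' + w * s')"
      by (auto simp: ap_set_def)
    have "residue n (a + v * s) = residue n (a' + w * s')" using v(2) w(2) by metis
    then have "[int a + int v * int s = int a' + int w * int s'] (mod int n)"
      by (simp add: residue_eq_iff_int)
    then have "[int a + int v * int s = int a + i * int s + int w * int s] (mod int n)"
      using cong_trans cong_add[OF i cong_refl[of "int w * int s"]] ss by simp
    then have d: "int n dvd (int v - i - int w) * int s"
      by (simp add: cong_iff_dvd_diff algebra_simps)
    have "\<bar>int v - i - int w\<bar> \<le> 3 * (int k - 1)" using v w ik by auto
    also have "\<dots> \<le> int k ^ 2"
    proof -
      \<comment> \<open>The right-hand side is 4 (k^2 - 3 k + 3).\<close>
      have "0 \<le> (2 * int k - 3)\<^sup>2 + 3" by simp
      then show ?thesis by (simp add: power2_eq_square algebra_simps)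
    qed
    finally have "int v = i + int w" using good_aps_dvd_imp_zero[OF P d] by simp
    then have "int v \<in> {max 0 i..<min (int k) (int k + i)}" using v w by auto
    moreover have "x = ?f (int v)" using v by simp
    ultimately show "x \<in> ?f ` {max 0 i..<min (int k) (int k + i)}" by blast
  qed
  then have "card (ap_set n k (a, s) \<inter> ap_set n k (a', s')) \<le> card {max 0 i..<min (int k) (int k + i)}"
    by (rule surj_card_le[rotated]) simp
  also have "\<dots> = k - nat \<bar>i\<bar>" using ik by auto
  finally have "card (ap_set n k (a, s) \<inter> ap_set n k (a', s')) + nat \<bar>i\<bar> \<le> k"
    using ik by linarith
  then show ?thesis using ss i i0 ik by blast
qed

text \<open>Positive and negative indices give two geometric series starting at p, each at most 2 p
  because p <= 1/2.\<close>

lemma sum_signed_powers_le: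
  fixes p :: real
  assumes "0 \<le> p" "p \<le> 1 / 2" "finite N" "0 \<notin> N"
  shows "(\<Sum>i\<in>N. p ^ nat \<bar>i :: int\<bar>) \<le> 4 * p"
proof -
  have *: "(\<Sum>i\<in>N. p ^ i) \<le> 2 * p" if "finite N" "0 \<notin> N" for N :: "nat set"
  proof -
    have "(\<Sum>i\<in>N. p ^ i) = (\<Sum>i\<in>N. p * p ^ (i - 1))"
      using that by (intro sum.cong refl) (metis power_eq_if)
    also have "\<dots> = p * (\<Sum>i\<in>N. p ^ (i - 1))" by (simp add: sum_distrib_left)
    finally have *: "(\<Sum>i\<in>N. p ^ i) = p * (\<Sum>i\<in>N. p ^ (i - 1))" .
    have "(\<Sum>i\<in>N. p ^ (i - 1)) = (\<Sum>i\<in>(\<lambda>i. i - 1) ` N. p ^ i)"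
      using that by (subst sum.reindex) (auto intro!: inj_onI, metis Suc_pred neq0_conv)
    also have "\<dots> \<le> (\<Sum>i. p ^ i)"
      using assms that by (intro sum_le_suminf summable_geometric) auto
    also have "\<dots> \<le> 2" using assms by (subst suminf_geometric) (auto simp: field_simps)
    finally have "p * (\<Sum>i\<in>N. p ^ (i - 1)) \<le> p * 2" using assms(1) by (rule mult_left_mono)
    then show ?thesis using * by simp
  qed
  have "(\<Sum>i\<in>N. p ^ nat \<bar>i\<bar>) = (\<Sum>i\<in>N \<inter> {0<..}. p ^ nat \<bar>i\<bar>) + (\<Sum>i\<in>N - {0<..}. p ^ nat \<bar>i\<bar>)"
    using assms(3) by (subst sum.Int_Diff[of _ _ "{0<..}"]) auto
  also have "(\<Sum>i\<in>N \<inter> {0<..}. p ^ nat \<bar>i\<bar>) = (\<Sum>i\<in>nat ` (N \<inter> {0<..}). p ^ i)"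
    by (subst sum.reindex) (auto simp: inj_on_def)
  also have "\<dots> \<le> 2 * p" using assms by (intro *) auto
  also have "(\<Sum>i\<in>N - {0<..}. p ^ nat \<bar>i\<bar>) = (\<Sum>i\<in>(\<lambda>i. nat (- i)) ` (N - {0<..}). p ^ i)"
    by (subst sum.reindex) (auto simp: inj_on_def)
  also have "\<dots> \<le> 2 * p"
  proof (rule *)
    show "0 \<notin> (\<lambda>i. nat (- i)) ` (N - {0<..})"
    proof
      assume "0 \<in> (\<lambda>i. nat (- i)) ` (N - {0<..})"
      then obtain x where "0 = nat (- x)" "x \<in> N - {0<..}" by (rule imageE)
      moreover from this have "x = 0" by auto
      ultimately show False using assms(4) by simp
    qed
  qed (use assms in auto)
  finally show ?thesis by simp
qed

text \<open>A union with overlap c has 2 k - c elements. The three summands belong to c = 1 (at most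
  k^2 n progressions), to 2 <= c <= (k + 1) / 2 (at most k^5, with at least k + k div 2 elements in
  the union), and to larger c, where the progressions are translates along P by nonzero i and the
  union has at least k + |i| elements.\<close>

lemma sum_overlaps_le:
  fixes p :: real
  assumes P: "P \<in> good_aps n k" and F: "F \<subseteq> good_aps n k" and p: "0 \<le> p" "p \<le> 1 / 2" and k: "2 \<le> k"
  shows "(\<Sum>Q\<in>{Q\<in>F. Q \<noteq> P \<and> ap_set n k P \<inter> ap_set n k Q \<noteq> {}}. p ^ card (ap_set n k P \<union> ap_set n k Q))
    \<le> p ^ k * (real (k\<^sup>2 * n) * p ^ (k - 1) + real (k ^ 5) * p ^ (k div 2) + 4 * p)"
proof -
  obtain a s where Pas: "P = (a, s)" by (cases P)
  have n: "1 \<le> n" using P good_apsD(1) Pas by blast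
  let ?A = "ap_set n k"
  let ?c = "\<lambda>Q. card (?A P \<inter> ?A Q)"
  let ?w = "\<lambda>Q. p ^ card (?A P \<union> ?A Q)"
  define D where "D = {Q\<in>F. Q \<noteq> P \<and> ?A P \<inter> ?A Q \<noteq> {}}"
  define D1 where "D1 = {Q\<in>D. ?c Q = 1}"
  define D2 where "D2 = {Q\<in>D. 2 \<le> ?c Q \<and> 2 * ?c Q \<le> k + 1}"
  define D3 where "D3 = {Q\<in>D. 2 \<le> ?c Q \<and> k + 2 \<le> 2 * ?c Q}"
  have finA: "finite (?A Q)" for Q using ap_set_subset[OF n] by (rule finite_subset) simp
  have sq: "good_aps n k \<subseteq> {1..n} \<times> {1..n}" by (auto simp: good_aps_def)
  have finD: "finite D" using F finite_good_aps by (auto simp: D_def intro: finite_subset)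
  have c1: "1 \<le> ?c Q" if "Q \<in> D" for Q
    using that finA by (auto simp: D_def Suc_le_eq card_gt_0_iff)
  have un: "card (?A P \<union> ?A Q) + ?c Q = 2 * k" if "Q \<in> D" for Q
    using card_Un_Int[OF finA finA, of P Q] that F P by (auto simp: D_def card_ap_set)
  have split: "D = D1 \<union> D2 \<union> D3"
    using c1 by (force simp: D1_def D2_def D3_def)
  have w1: "?w Q = p ^ k * p ^ (k - 1)" if "Q \<in> D1" for Q
  proof -
    have "card (?A P \<union> ?A Q) = k + (k - 1)" using un[of Q] that k by (auto simp: D1_def)
    then show ?thesis by (simp add: power_add)
  qed
  have w2: "?w Q \<le> p ^ k * p ^ (k div 2)" if "Q \<in> D2" for Q
  proof -
    have "k + k div 2 \<le> card (?A P \<union> ?A Q)" using un[of Q] that by (auto simp: D2_def)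
    then have "?w Q \<le> p ^ (k + k div 2)" using p by (intro power_decreasing) auto
    then show ?thesis by (simp add: power_add)
  qed
  have "\<exists>i::int. i \<noteq> 0 \<and> snd Q = s \<and> [int (fst Q) = int a + i * int s] (mod int n) \<and> ?c Q + nat \<bar>i\<bar> \<le> k"
    if "Q \<in> D3" for Q
    using large_overlap[of a s n k "fst Q" "snd Q"] that P F unfolding Pas D3_def D_def by auto
  then obtain i where i: "\<And>Q. Q \<in> D3 \<Longrightarrow> i Q \<noteq> 0 \<and> snd Q = s
      \<and> [int (fst Q) = int a + i Q * int s] (mod int n) \<and> ?c Q + nat \<bar>i Q\<bar> \<le> k"
    by metis
  \<comment> \<open>The number of steps fixes the translate, so the sum over \<open>D3\<close>
    becomes a sum over distinct nonzero integers.\<close>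
  have inj: "inj_on i D3"
  proof (rule inj_onI)
    fix Q R assume QR: "Q \<in> D3" "R \<in> D3" "i Q = i R"
    have "[int (fst Q) = int (fst R)] (mod int n)"
      using i[OF QR(1)] i[OF QR(2)] QR(3) by (metis cong_sym cong_trans)
    then have "residue n (fst Q) = residue n (fst R)" using n by (simp add: residue_eq_iff_int)
    moreover have "fst Q \<in> {1..n}" "fst R \<in> {1..n}" using QR F sq by (auto simp: D3_def D_def)
    ultimately show "Q = R" using i QR by (simp add: residue_id prod_eq_iff)
  qed
  have w3: "?w Q \<le> p ^ k * p ^ nat \<bar>i Q\<bar>" if "Q \<in> D3" for Q
  proof -
    have "k + nat \<bar>i Q\<bar> \<le> card (?A P \<union> ?A Q)" using un[of Q] i[OF that] that by (auto simp: D3_def)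
    then have "?w Q \<le> p ^ (k + nat \<bar>i Q\<bar>)" using p by (intro power_decreasing) auto
    then show ?thesis by (simp add: power_add)
  qed
  have fin: "finite D1" "finite D2" "finite D3" using finD by (auto simp: D1_def D2_def D3_def)
  have "D1 \<subseteq> {Q \<in> {1..n} \<times> {1..n}. ?A P \<inter> ?A Q \<noteq> {}}" using F sq by (auto simp: D1_def D_def)
  then have "card D1 \<le> card {Q \<in> {1..n} \<times> {1..n}. ?A P \<inter> ?A Q \<noteq> {}}" by (rule card_mono[rotated]) auto
  also have "\<dots> \<le> k\<^sup>2 * n" by (rule card_meeting[OF n])
  finally have C1: "card D1 \<le> k\<^sup>2 * n" .
  have "D2 \<subseteq> {Q \<in> {1..n} \<times> {1..n}. 2 \<le> ?c Q}" using F sq by (auto simp: D2_def D_def)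
  then have "card D2 \<le> card {Q \<in> {1..n} \<times> {1..n}. 2 \<le> ?c Q}" by (rule card_mono[rotated]) auto
  also have "\<dots> \<le> k ^ 5" by (rule card_meeting_twice[OF n])
  finally have C2: "card D2 \<le> k ^ 5" .
  have S1: "sum ?w D1 \<le> p ^ k * (real (k\<^sup>2 * n) * p ^ (k - 1))"
  proof -
    have "sum ?w D1 = real (card D1) * (p ^ k * p ^ (k - 1))" using w1 by simp
    also have "\<dots> \<le> real (k\<^sup>2 * n) * (p ^ k * p ^ (k - 1))"
      using C1 p by (intro mult_right_mono) (simp_all only: of_nat_le_iff, auto)
    finally show ?thesis by (simp add: mult_ac)
  qed
  have S2: "sum ?w D2 \<le> p ^ k * (real (k ^ 5) * p ^ (k div 2))"
  proof -
    have "sum ?w D2 \<le> real (card D2) * (p ^ k * p ^ (k div 2))" using w2 by (intro sum_bounded_above)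
    also have "\<dots> \<le> real (k ^ 5) * (p ^ k * p ^ (k div 2))"
      using C2 p by (intro mult_right_mono) (simp_all only: of_nat_le_iff, auto)
    finally show ?thesis by (simp add: mult_ac)
  qed
  have S3: "sum ?w D3 \<le> p ^ k * (4 * p)"
  proof -
    have "sum ?w D3 \<le> (\<Sum>Q\<in>D3. p ^ k * p ^ nat \<bar>i Q\<bar>)" using w3 by (rule sum_mono)
    also have "\<dots> = p ^ k * (\<Sum>l\<in>i ` D3. p ^ nat \<bar>l\<bar>)"
      by (simp add: sum_distrib_left sum.reindex[OF inj])
    also have "\<dots> \<le> p ^ k * (4 * p)"
      using p fin i by (intro mult_left_mono sum_signed_powers_le) auto
    finally show ?thesis .
  qed
  have "sum ?w D \<le> sum ?w D1 + sum ?w D2 + sum ?w D3"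
    unfolding split using fin p
    by (subst sum.union_disjoint; (subst sum.union_disjoint)?) (auto simp: D1_def D2_def D3_def)
  also have "\<dots> \<le> p ^ k * (real (k\<^sup>2 * n) * p ^ (k - 1)) + p ^ k * (real (k ^ 5) * p ^ (k div 2)) + p ^ k * (4 * p)"
    using S1 S2 S3 by linarith
  finally show ?thesis unfolding D_def by (simp only: distrib_left)
qed

section \<open>Longest progressions and families of progressions\<close>

text \<open>The bracket of \<open>sum_overlaps_le\<close>: given that one good progression is
  contained in the random set, it bounds the expected number of other contained members of the
  family that meet it.\<close>

definition overlap_bound :: "nat \<Rightarrow> nat \<Rightarrow> real \<Rightarrow> real" where
  "overlap_bound n k p = real (k\<^sup>2 * n) * p ^ (k - 1) + real (k ^ 5) * p ^ (k div 2) + 4 * p"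

context random_subset
begin

lemma prob_exists_superset_le:
  assumes "finite E" "\<And>i. i \<in> E \<Longrightarrow> A i \<subseteq> I" "\<And>i. i \<in> E \<Longrightarrow> card (A i) = k"
  shows "prob {T. \<exists>i\<in>E. A i \<subseteq> T} \<le> real (card E) * p ^ k"
proof -
  have "prob {T. \<exists>i\<in>E. A i \<subseteq> T} = prob (\<Union>i\<in>E. {T. A i \<subseteq> T})"
    by (rule arg_cong[where f = prob]) auto
  also have "\<dots> \<le> (\<Sum>i\<in>E. prob {T. A i \<subseteq> T})"
    by (rule finite_measure_subadditive_finite) (use assms in auto)
  also have "\<dots> = (\<Sum>i\<in>E. p ^ k)"
    by (intro sum.cong refl) (simp add: prob_superset assms)
  finally show ?thesis by simp
qed

lemma prob_not: "prob {T. \<not> R T} = 1 - prob {T. R T}"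
  using prob_compl[of "{T. R T}"] by (simp add: Collect_neg_eq Compl_eq_Diff_UNIV)

end

text \<open>The factor 2 in the approximation pays for the terms p^k * p^k: at most k^2 n members
  meet a given one, and k^2 n p^k is already below the first summand of
  \<open>overlap_bound\<close>.\<close>

lemma prob_avoid_aps:
  assumes R: "random_subset M {1..n} p" and n: "1 \<le> n" and p: "p \<le> 1 / 2" and k: "2 \<le> k" and F: "F \<subseteq> good_aps n k"
  shows prob_avoid_aps_le:
      "measure M {T. \<forall>Q\<in>F. \<not> ap_set n k Q \<subseteq> T} * (real (card F) * p ^ k)\<^sup>2
        \<le> real (card F) * p ^ k * (1 + overlap_bound n k p)"
    and prob_avoid_aps_approx:
      "\<bar>measure M {T. \<forall>Q\<in>F. \<not> ap_set n k Q \<subseteq> T} - (1 - p ^ k) ^ card F\<bar>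
        \<le> 2 * (real (card F) * p ^ k * overlap_bound n k p)"
proof -
  interpret random_subset M "{1..n}" p by (rule R)
  let ?A = "ap_set n k"
  let ?D = "\<lambda>P. {Q\<in>F. Q \<noteq> P \<and> ?A P \<inter> ?A Q \<noteq> {}}"
  have fin: "finite F" using F finite_good_aps by (rule finite_subset)
  have sub: "?A Q \<subseteq> {1..n}" for Q using ap_set_subset[OF n] .
  have card: "card (?A Q) = k" if "Q \<in> F" for Q using that F by (auto intro: card_ap_set)
  have S: "(\<Sum>P\<in>F. \<Sum>Q\<in>?D P. p ^ card (?A P \<union> ?A Q)) \<le> (\<Sum>P\<in>F. p ^ k * overlap_bound n k p)"
    unfolding overlap_bound_def using F p_ge_0 p k by (intro sum_mono sum_overlaps_le) auto
  show "prob {T. \<forall>Q\<in>F. \<not> ?A Q \<subseteq> T} * (real (card F) * p ^ k)\<^sup>2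
        \<le> real (card F) * p ^ k * (1 + overlap_bound n k p)"
    using prob_avoid_all_second_moment[of F ?A k, OF fin sub card] S by (simp add: algebra_simps)
  have D: "real (card (?D P)) * p ^ k \<le> overlap_bound n k p" for P
  proof -
    have "?D P \<subseteq> {Q \<in> {1..n} \<times> {1..n}. ?A P \<inter> ?A Q \<noteq> {}}"
      using F by (auto simp: good_aps_def)
    then have "card (?D P) \<le> card {Q \<in> {1..n} \<times> {1..n}. ?A P \<inter> ?A Q \<noteq> {}}"
      by (rule card_mono[rotated]) auto
    also have "\<dots> \<le> k\<^sup>2 * n" by (rule card_meeting[OF n])
    finally have "real (card (?D P)) * p ^ k \<le> real (k\<^sup>2 * n) * p ^ (k - 1)"
      using p_ge_0 p_le_1 by (intro mult_mono power_decreasing) (simp_all only: of_nat_le_iff, auto)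
    moreover have "0 \<le> real (k ^ 5) * p ^ (k div 2)" "0 \<le> 4 * p" using p_ge_0 by auto
    ultimately show ?thesis unfolding overlap_bound_def by linarith
  qed
  have "(\<Sum>P\<in>F. \<Sum>Q\<in>?D P. p ^ k * p ^ k) = (\<Sum>P\<in>F. p ^ k * (real (card (?D P)) * p ^ k))"
    by (simp add: mult_ac)
  also have "\<dots> \<le> (\<Sum>P\<in>F. p ^ k * overlap_bound n k p)"
    using D p_ge_0 by (intro sum_mono mult_left_mono) auto
  finally show "\<bar>prob {T. \<forall>Q\<in>F. \<not> ?A Q \<subseteq> T} - (1 - p ^ k) ^ card F\<bar>
        \<le> 2 * (real (card F) * p ^ k * overlap_bound n k p)"
    using prob_avoid_all_approx[of F ?A k, OF fin sub card] S by (simp add: sum.distrib)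
qed

section \<open>From longest lengths to families of sets\<close>

definition aps :: "nat \<Rightarrow> nat \<Rightarrow> (nat \<times> nat) set" where
  "aps n k = {(a, s). a \<in> {1..n} \<and> s \<in> {1..n} \<and> a + (k - 1) * s \<le> n}"

text \<open>The number \<open>n div gcd s n\<close> is the additive order of s modulo n, so the
  condition says that the k terms are distinct residues.\<close>

definition aps_mod :: "nat \<Rightarrow> nat \<Rightarrow> (nat \<times> nat) set" where
  "aps_mod n k = {(a, s). a \<in> {1..n} \<and> s \<in> {1..n} \<and> k \<le> n div gcd s n}"

text \<open>The maximum ranges over a set closed under passing to smaller m >= 1; \<open>R 0\<close>
  and \<open>1 \<le> B\<close> keep it nonempty, so that \<open>Max\<close> is meaningful.\<close>

lemma le_Max_initial_segment_iff:
  fixes B k :: nat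
  assumes "R 0" "1 \<le> B" "1 \<le> k"
  shows "k \<le> Max {m. 1 \<le> m \<and> m \<le> B \<and> (\<forall>j<m. R j)} \<longleftrightarrow> k \<le> B \<and> (\<forall>j<k. R j)"
proof -
  have "finite {m. 1 \<le> m \<and> m \<le> B \<and> (\<forall>j<m. R j)}" by (rule finite_subset[of _ "{..B}"]) auto
  moreover have "1 \<in> {m. 1 \<le> m \<and> m \<le> B \<and> (\<forall>j<m. R j)}" using assms by auto
  ultimately show ?thesis using assms(3) by (subst Max_ge_iff) (auto intro: less_le_trans)
qed

lemma le_ap_length_iff:
  assumes "x a \<in> {0, 1}" "1 \<le> k"
  shows "k \<le> ap_length n x a s \<longleftrightarrow> k \<le> 1 + (n - a) div s \<and> (\<forall>j<k. x (a + j * s) = 1)"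
proof (cases "x a = 0")
  case True
  then show ?thesis using assms by (auto simp: ap_length_def intro!: exI[of _ 0])
next
  case False
  then show ?thesis
    using assms unfolding ap_length_def by (subst if_not_P, simp, subst le_Max_initial_segment_iff) auto
qed

lemma le_ap_length_mod_iff:
  assumes "x a \<in> {0, 1}" "1 \<le> k" "a \<in> {1..n}" "s \<in> {1..n}"
  shows "k \<le> ap_length_mod n x a s \<longleftrightarrow> k \<le> n div gcd s n \<and> (\<forall>j<k. x (residue n (a + j * s)) = 1)"
proof (cases "x a = 0")
  case True
  then show ?thesis using assms residue_id[of a n] by (auto simp: ap_length_mod_def intro!: exI[of _ 0])
next
  case False
  have "1 \<le> n div gcd s n" using assms by (simp add: Suc_le_eq div_greater_zero_iff gcd_le2_nat)
  then show ?thesis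
    using assms False residue_id[of a n] unfolding ap_length_mod_def
    by (subst if_not_P, simp, subst le_Max_initial_segment_iff) auto
qed

lemma ap_set_aps:
  assumes "(a, s) \<in> aps n k"
  shows "ap_set n k (a, s) = (\<lambda>j. a + j * s) ` {..<k}"
proof -
  have "residue n (a + j * s) = a + j * s" if "j < k" for j
  proof (rule residue_id)
    have "j * s \<le> (k - 1) * s" using that by (intro mult_right_mono) auto
    moreover have "1 \<le> a" "a + (k - 1) * s \<le> n" using assms by (auto simp: aps_def)
    ultimately show "a + j * s \<in> {1..n}" unfolding atLeastAtMost_iff by linarith
  qed
  then show ?thesis by (auto simp: ap_set_def)
qed

text \<open>The tail event of the statistic becomes the event that the set of ones contains a member
  of a fixed family, the form treated by the avoidance bounds.\<close>

lemma le_longest_ap_iff: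
  assumes "\<And>i. i \<in> {1..n} \<Longrightarrow> x i \<in> {0, 1}" "1 \<le> k" "1 \<le> n"
  shows "k \<le> longest_ap n x \<longleftrightarrow> (\<exists>Q\<in>aps n k. ap_set n k Q \<subseteq> {i\<in>{1..n}. x i = 1})"
proof -
  let ?L = "{ap_length n x a s | a s. a \<in> {1..n} \<and> s \<in> {1..n}}"
  have L: "?L = (\<lambda>(a, s). ap_length n x a s) ` ({1..n} \<times> {1..n})" by auto blast
  have "finite ?L" "?L \<noteq> {}" unfolding L using assms(3) by auto
  then have "k \<le> longest_ap n x \<longleftrightarrow> (\<exists>a\<in>{1..n}. \<exists>s\<in>{1..n}. k \<le> ap_length n x a s)"
    unfolding longest_ap_def by (subst Max_ge_iff) blast+
  also have "\<dots> \<longleftrightarrow> (\<exists>a s. (a, s) \<in> aps n k \<and> ap_set n k (a, s) \<subseteq> {i\<in>{1..n}. x i = 1})"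
  proof -
    have "k \<le> ap_length n x a s \<longleftrightarrow> (a, s) \<in> aps n k \<and> ap_set n k (a, s) \<subseteq> {i\<in>{1..n}. x i = 1}"
      if as: "a \<in> {1..n}" "s \<in> {1..n}" for a s
    proof -
      have "k \<le> 1 + (n - a) div s \<longleftrightarrow> k - 1 \<le> (n - a) div s" using assms(2) by auto
      also have "\<dots> \<longleftrightarrow> (k - 1) * s \<le> n - a" using as by (simp add: less_eq_div_iff_mult_less_eq)
      also have "\<dots> \<longleftrightarrow> (a, s) \<in> aps n k" using as by (auto simp: aps_def)
      finally have *: "k \<le> 1 + (n - a) div s \<longleftrightarrow> (a, s) \<in> aps n k" .
      have "ap_set n k (a, s) \<subseteq> {i\<in>{1..n}. x i = 1} \<longleftrightarrow> (\<forall>j<k. x (a + j * s) = 1)"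
        if "(a, s) \<in> aps n k"
        using ap_set_subset[OF assms(3), of k "(a, s)"] unfolding ap_set_aps[OF that] by blast
      then show ?thesis using le_ap_length_iff[of x a k n s] assms as * by auto
    qed
    moreover have "aps n k \<subseteq> {1..n} \<times> {1..n}" by (auto simp: aps_def)
    ultimately show ?thesis by blast
  qed
  finally show ?thesis by (simp only: Bex_def split_paired_Ex)
qed

lemma le_longest_ap_mod_iff:
  assumes "\<And>i. i \<in> {1..n} \<Longrightarrow> x i \<in> {0, 1}" "1 \<le> k" "1 \<le> n"
  shows "k \<le> longest_ap_mod n x \<longleftrightarrow> (\<exists>Q\<in>aps_mod n k. ap_set n k Q \<subseteq> {i\<in>{1..n}. x i = 1})"
proof -
  let ?L = "{ap_length_mod n x a s | a s. a \<in> {1..n} \<and> s \<in> {1..n}}"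
  have L: "?L = (\<lambda>(a, s). ap_length_mod n x a s) ` ({1..n} \<times> {1..n})" by auto blast
  have "finite ?L" "?L \<noteq> {}" unfolding L using assms(3) by auto
  then have "k \<le> longest_ap_mod n x \<longleftrightarrow> (\<exists>a\<in>{1..n}. \<exists>s\<in>{1..n}. k \<le> ap_length_mod n x a s)"
    unfolding longest_ap_mod_def by (subst Max_ge_iff) blast+
  also have "\<dots> \<longleftrightarrow> (\<exists>a s. (a, s) \<in> aps_mod n k \<and> ap_set n k (a, s) \<subseteq> {i\<in>{1..n}. x i = 1})"
  proof -
    have "k \<le> ap_length_mod n x a s \<longleftrightarrow> (a, s) \<in> aps_mod n k \<and> ap_set n k (a, s) \<subseteq> {i\<in>{1..n}. x i = 1}"
      if as: "a \<in> {1..n}" "s \<in> {1..n}" for a s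
    proof -
      have "ap_set n k (a, s) \<subseteq> {i\<in>{1..n}. x i = 1} \<longleftrightarrow> (\<forall>j<k. x (residue n (a + j * s)) = 1)"
        using ap_set_subset[OF assms(3), of k "(a, s)"] unfolding ap_set_def by auto
      then show ?thesis using le_ap_length_mod_iff[of x a k n s] assms as by (auto simp: aps_mod_def)
    qed
    moreover have "aps_mod n k \<subseteq> {1..n} \<times> {1..n}" by (auto simp: aps_mod_def)
    ultimately show ?thesis by blast
  qed
  finally show ?thesis by (simp only: Bex_def split_paired_Ex)
qed

lemma card_ap_set_aps:
  assumes "Q \<in> aps n k"
  shows "card (ap_set n k Q) = k"
proof -
  obtain a s where Q: "Q = (a, s)" by (cases Q)
  then have "s \<noteq> 0" using assms by (auto simp: aps_def)
  then have "inj_on (\<lambda>j. a + j * s) {..<k}" by (auto simp: inj_on_def)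
  then show ?thesis using ap_set_aps assms Q by (simp add: card_image)
qed

text \<open>If positions i <= j give equal residues, n divides (j - i) s. After division by the gcd
  the additive order is coprime to the reduced s, so it divides j - i < k and j = i.\<close>

lemma card_ap_set_aps_mod:
  assumes "Q \<in> aps_mod n k"
  shows "card (ap_set n k Q) = k"
proof -
  obtain a s where Q: "Q = (a, s)" by (cases Q)
  have n: "1 \<le> n" and k: "k \<le> n div gcd s n" using assms Q by (auto simp: aps_mod_def)
  have *: "i = j" if "i \<le> j" "j < k" "residue n (a + i * s) = residue n (a + j * s)" for i j
  proof -
    have "[a + j * s = a + i * s] (mod n)" using that by (simp add: residue_eq_iff cong_sym)
    then have "n dvd (a + j * s) - (a + i * s)" using that by (simp add: cong_altdef_nat)
    then have "n dvd (j - i) * s" by (simp add: diff_mult_distrib)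
    moreover have "n = n div gcd s n * gcd s n" "(j - i) * s = (j - i) * (s div gcd s n) * gcd s n"
      by (simp_all add: mult.assoc)
    ultimately have "n div gcd s n * gcd s n dvd (j - i) * (s div gcd s n) * gcd s n" by metis
    then have "n div gcd s n dvd (j - i) * (s div gcd s n)"
      by (rule iffD1[OF dvd_times_right_cancel_iff, rotated]) (use n in auto)
    moreover have "coprime (n div gcd s n) (s div gcd s n)"
      using div_gcd_coprime[of s n] n by (simp add: coprime_commute)
    ultimately have "n div gcd s n dvd j - i" by (simp add: coprime_dvd_mult_left_iff)
    then show ?thesis using that k by (auto dest: dvd_imp_le)
  qed
  have "inj_on (\<lambda>j. residue n (a + j * s)) {..<k}"
  proof (rule linorder_inj_onI)
    fix i j assume "i < j" "i \<in> {..<k}" "j \<in> {..<k}"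
    then show "residue n (a + i * s) \<noteq> residue n (a + j * s)" using *[of i j] by auto
  qed auto
  then show ?thesis unfolding Q ap_set_def by (simp add: card_image)
qed

text \<open>Pairs whose difference has additive order at most k^2. There are at most n k^4 of them,
  negligible against n^2, so a union bound disposes of them.\<close>

definition short_aps :: "nat \<Rightarrow> nat \<Rightarrow> (nat \<times> nat) set" where
  "short_aps n k = {(a, s). a \<in> {1..n} \<and> s \<in> {1..n} \<and> (\<exists>m\<in>{1..k\<^sup>2}. n dvd m * s)}"

lemma card_short_aps:
  assumes "1 \<le> n"
  shows "card (short_aps n k) \<le> n * k ^ 4"
proof -
  have "short_aps n k = {1..n} \<times> {s\<in>{1..n}. \<exists>m\<in>{1..k\<^sup>2}. n dvd m * s}"
    by (auto simp: short_aps_def)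
  then show ?thesis using card_short_order[OF assms, of k] by (simp add: card_cartesian_product)
qed

lemma finite_aps: "finite (aps n k)" "finite (aps_mod n k)" "finite (short_aps n k)"
  by (rule finite_subset[of _ "{1..n} \<times> {1..n}"]; auto simp: aps_def aps_mod_def short_aps_def)+

text \<open>The additive order of s is itself a multiplier that annihilates s, so for a good pair it
  exceeds k^2 >= k.\<close>

lemma good_aps_subset_mod:
  assumes "1 \<le> k"
  shows "good_aps n k \<subseteq> aps_mod n k"
proof clarify
  fix a s assume good: "(a, s) \<in> good_aps n k"
  let ?r = "n div gcd s n"
  have n: "1 \<le> n" using good_apsD[OF good] by simp
  have "1 \<le> ?r" using n by (simp add: Suc_le_eq div_greater_zero_iff gcd_le2_nat)
  moreover have "n dvd ?r * s"
  proof -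
    have "?r * s = n * (s div gcd s n)" by (simp add: dvd_div_mult div_mult_swap)
    then show ?thesis by simp
  qed
  ultimately have "\<not> ?r \<le> k\<^sup>2" using good by (auto simp: good_aps_def)
  moreover have "k \<le> k\<^sup>2" by (simp add: power2_eq_square)
  ultimately show "(a, s) \<in> aps_mod n k" using good_apsD[OF good] by (auto simp: aps_mod_def)
qed

text \<open>A progression inside {1..n} has (k - 1) s < n, which gives the orientation 2 s < n once
  k >= 3. For k = 2 the difference may exceed n / 2.\<close>

lemma aps_subset_good:
  assumes "3 \<le> k"
  shows "aps n k \<subseteq> (good_aps n k \<inter> aps n k) \<union> short_aps n k"
proof
  fix Q assume Q: "Q \<in> aps n k"
  obtain a s where as: "Q = (a, s)" by (cases Q)
  have "2 * s \<le> (k - 1) * s" using assms by (intro mult_right_mono) auto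
  moreover have "1 \<le> a" "a + (k - 1) * s \<le> n" using Q as by (auto simp: aps_def)
  ultimately have "2 * s < n" by linarith
  then show "Q \<in> (good_aps n k \<inter> aps n k) \<union> short_aps n k"
    using Q as by (auto simp: good_aps_def aps_def short_aps_def)
qed

text \<open>Read backwards, the progression starts at its last term and has difference - s,
  represented by n - s.\<close>

lemma ap_set_reverse:
  assumes "1 \<le> n" "s \<le> n"
  shows "ap_set n k (residue n (a + (k - 1) * s), n - s) = ap_set n k (a, s)"
proof -
  have *: "residue n (residue n (a + (k - 1) * s) + j * (n - s)) = residue n (a + (k - 1 - j) * s)"
    if "j < k" for j
  proof -
    have "[int (residue n (a + (k - 1) * s)) = int (a + (k - 1) * s)] (mod int n)"
      using cong_residue by (simp only: cong_int_iff)
    then have "[int (residue n (a + (k - 1) * s)) + int j * (int n - int s)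
        = int (a + (k - 1) * s) + int j * (int n - int s)] (mod int n)"
      by (rule cong_add) simp
    also have "int (a + (k - 1) * s) + int j * (int n - int s)
        = int (a + (k - 1 - j) * s) + int j * int n"
    proof -
      have "int (k - 1 - j) = int (k - 1) - int j" using that by simp
      then have "int (a + (k - 1 - j) * s) = int a + (int (k - 1) - int j) * int s"
        by (simp only: of_nat_add of_nat_mult)
      then show ?thesis by (simp only: of_nat_add of_nat_mult) (simp only: algebra_simps)
    qed
    also have "[\<dots> = int (a + (k - 1 - j) * s)] (mod int n)"
      by (simp add: cong_iff_dvd_diff)
    finally show ?thesis using assms by (simp add: residue_eq_iff_int of_nat_diff)
  qed
  have rev: "{..<k} = (\<lambda>j. k - 1 - j) ` {..<k}"
  proof
    show "{..<k} \<subseteq> (\<lambda>j. k - 1 - j) ` {..<k}"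
    proof
      fix j assume "j \<in> {..<k}"
      then show "j \<in> (\<lambda>j. k - 1 - j) ` {..<k}" by (intro image_eqI[of _ _ "k - 1 - j"]) auto
    qed
  qed auto
  have "ap_set n k (a, s) = (\<lambda>j. residue n (a + (k - 1 - j) * s)) ` {..<k}"
    unfolding ap_set_def prod.case by (subst rev) (simp add: image_image)
  also have "\<dots> = ap_set n k (residue n (a + (k - 1) * s), n - s)"
    unfolding ap_set_def prod.case by (intro image_cong refl) (simp only: lessThan_iff *)
  finally show ?thesis by simp
qed

text \<open>Outside the exceptional pairs, a difference above n / 2 is replaced by n - s through
  reversal. This keeps the set and the order condition.\<close>

lemma exists_aps_mod_imp_good:
  assumes "2 \<le> k" "Q \<in> aps_mod n k" "ap_set n k Q \<subseteq> T"
  shows "\<exists>Q\<in>good_aps n k \<union> (short_aps n k \<inter> aps_mod n k). ap_set n k Q \<subseteq> T"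
proof (cases "Q \<in> good_aps n k \<union> short_aps n k")
  case False
  obtain a s where Q: "Q = (a, s)" by (cases Q)
  have as: "a \<in> {1..n}" "s \<in> {1..n}" using assms Q by (auto simp: aps_mod_def)
  have short: "\<not> n dvd m * s" if "m \<in> {1..k\<^sup>2}" for m
    using False as that Q by (auto simp: short_aps_def)
  \<comment> \<open>The differences n and n / 2 have order 1 and 2, so they count as exceptional
    because k^2 >= 2.\<close>
  have k2: "4 \<le> k\<^sup>2" using power_mono[OF assms(1), of 2] by simp
  have "s \<noteq> n" using short[of 1] k2 by auto
  moreover have "2 * s \<noteq> n" using short[of 2] k2 by auto
  moreover have "\<not> 2 * s < n" using False as short Q by (auto simp: good_aps_def)
  ultimately have s: "s < n" "n < 2 * s" using as by auto
  let ?Q = "(residue n (a + (k - 1) * s), n - s)"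
  have "\<not> n dvd m * (n - s)" if "m \<in> {1..k\<^sup>2}" for m
  proof
    assume "n dvd m * (n - s)"
    moreover have "m * (n - s) + m * s = m * n" using s by (simp flip: distrib_left)
    ultimately have "n dvd m * s" by (metis dvd_add_right_iff dvd_triv_right)
    then show False using short that by blast
  qed
  then have "?Q \<in> good_aps n k"
    using s residue_in[of n] by (auto simp: good_aps_def)
  moreover have "ap_set n k ?Q \<subseteq> T"
    using ap_set_reverse[of n s k a] s assms Q by simp
  ultimately show ?thesis by blast
qed (use assms in blast)

section \<open>Counting progressions\<close>

lemma card_aps:
  assumes "2 \<le> k"
  shows "card (aps n k) = (\<Sum>s\<in>{1..(n - 1) div (k - 1)}. n - (k - 1) * s)"
proof -
  have bij: "aps n k = prod.swap ` (SIGMA s:{1..(n - 1) div (k - 1)}. {1..n - (k - 1) * s})"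
  proof (rule set_eqI)
    fix Q :: "nat \<times> nat"
    obtain a s where Q: "Q = (a, s)" by (cases Q)
    have "1 * s \<le> (k - 1) * s" using assms by (intro mult_right_mono) auto
    then have "s \<le> n" if "(k - 1) * s \<le> n - 1" using that by linarith
    moreover have "s \<le> (n - 1) div (k - 1) \<longleftrightarrow> (k - 1) * s \<le> n - 1"
      using assms by (simp add: less_eq_div_iff_mult_less_eq mult.commute)
    ultimately show "Q \<in> aps n k \<longleftrightarrow> Q \<in> prod.swap ` (SIGMA s:{1..(n - 1) div (k - 1)}. {1..n - (k - 1) * s})"
      unfolding Q by (auto simp: aps_def image_iff)
  qed
  show ?thesis unfolding bij by (subst card_image) (auto simp: inj_on_def)
qed

lemma real_card_aps:
  fixes n k :: nat
  assumes "2 \<le> k"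
  defines "m \<equiv> (n - 1) div (k - 1)"
  shows "real (card (aps n k)) = real n * real m - real (k - 1) * (real m * (real m + 1) / 2)"
proof -
  \<comment> \<open>This makes the truncated subtraction in \<open>card_aps\<close> exact, so that
    the sum can be evaluated over the reals.\<close>
  have "(k - 1) * s \<le> n" if "s \<in> {1..m}" for s
  proof -
    have "(k - 1) * s \<le> (k - 1) * m" using that by simp
    also have "\<dots> \<le> n - 1" by (simp add: m_def)
    finally show ?thesis by simp
  qed
  then have "real (card (aps n k)) = (\<Sum>s\<in>{1..m}. real n - real (k - 1) * real s)"
    unfolding card_aps[OF assms(1)] m_def[symmetric] of_nat_sum
    by (intro sum.cong refl) (simp only: of_nat_diff of_nat_mult)
  also have "\<dots> = real n * real m - real (k - 1) * (\<Sum>s\<in>{1..m}. real s)"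
    by (simp add: sum_subtractf sum_distrib_left)
  also have "(\<Sum>s\<in>{1..m}. real s) = real m * (real m + 1) / 2"
    by (induction m) (auto simp: field_simps)
  finally show ?thesis .
qed

text \<open>Twice the true order is good enough here; the gain of 1 / (k - 1) over n^2 is what the
  centering with ln ln n relies on.\<close>

lemma card_aps_le:
  assumes "2 \<le> k"
  shows "real (card (aps n k)) \<le> (real n)\<^sup>2 / real (k - 1)"
proof -
  have "card (aps n k) \<le> (\<Sum>s\<in>{1..(n - 1) div (k - 1)}. n)"
    unfolding card_aps[OF assms] by (intro sum_mono) simp
  then have "(k - 1) * card (aps n k) \<le> (k - 1) * ((n - 1) div (k - 1)) * n"
    by (simp add: mult.assoc)
  also have "\<dots> \<le> n * n" by (intro mult_right_mono) (auto intro: order_trans[OF times_div_less_eq_dividend])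
  finally have "real (k - 1) * real (card (aps n k)) \<le> real n * real n"
    by (simp only: of_nat_le_iff flip: of_nat_mult)
  then show ?thesis using assms by (simp add: field_simps power2_eq_square)
qed

lemma card_aps_mod_le: "card (aps_mod n k) \<le> n\<^sup>2"
proof -
  have "card (aps_mod n k) \<le> card ({1..n} \<times> {1..n})" by (rule card_mono) (auto simp: aps_mod_def)
  then show ?thesis by (simp add: power2_eq_square)
qed

lemma card_interval_minus_short:
  assumes "1 \<le> n" "m \<le> n"
  shows "m - k ^ 4 \<le> card ({1..m} - {s\<in>{1..n}. \<exists>m\<in>{1..k\<^sup>2}. n dvd m * s})"
proof -
  have "card {1..m} - card {s\<in>{1..n}. \<exists>m\<in>{1..k\<^sup>2}. n dvd m * s}
      \<le> card ({1..m} - {s\<in>{1..n}. \<exists>m\<in>{1..k\<^sup>2}. n dvd m * s})"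
    by (rule diff_card_le_card_Diff) simp
  then show ?thesis using card_short_order[OF assms(1), of k] by simp
qed

lemma card_good_aps_ge:
  assumes "1 \<le> n"
  shows "n * ((n - 1) div 2 - k ^ 4) \<le> card (good_aps n k)"
proof -
  let ?S = "{s\<in>{1..n}. \<exists>m\<in>{1..k\<^sup>2}. n dvd m * s}"
  have "{1..n} \<times> ({1..(n - 1) div 2} - ?S) \<subseteq> good_aps n k"
    by (auto simp: good_aps_def)
  then have "card ({1..n} \<times> ({1..(n - 1) div 2} - ?S)) \<le> card (good_aps n k)"
    by (rule card_mono[OF finite_good_aps])
  moreover have "n * ((n - 1) div 2 - k ^ 4) \<le> n * card ({1..(n - 1) div 2} - ?S)"
    using assms by (intro mult_left_mono card_interval_minus_short) auto
  ultimately show ?thesis by (simp only: card_cartesian_product card_atLeastAtMost diff_Suc_1)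
qed

lemma card_good_aps_le: "card (good_aps n k) \<le> n * ((n - 1) div 2)"
proof -
  have "card (good_aps n k) \<le> card ({1..n} \<times> {1..(n - 1) div 2})"
    by (rule card_mono) (auto simp: good_aps_def)
  then show ?thesis by (simp add: card_cartesian_product)
qed

text \<open>Starts in the first half and differences up to n / (2 k) leave room for all k terms.
  Unlike the fixed-k asymptotics this also serves k = 2 and growing k.\<close>

lemma card_good_aps_inter_ge:
  assumes "1 \<le> n" "2 \<le> k"
  shows "(n div 2) * (n div (2 * k) - k ^ 4) \<le> card (good_aps n k \<inter> aps n k)"
proof -
  let ?S = "{s\<in>{1..n}. \<exists>m\<in>{1..k\<^sup>2}. n dvd m * s}"
  have "{1..n div 2} \<times> ({1..n div (2 * k)} - ?S) \<subseteq> good_aps n k \<inter> aps n k"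
  proof
    fix Q assume Q: "Q \<in> {1..n div 2} \<times> ({1..n div (2 * k)} - ?S)"
    obtain a s where as: "Q = (a, s)" by (cases Q)
    have a: "1 \<le> a" "2 * a \<le> n" and s: "1 \<le> s" "s \<le> n div (2 * k)" "s \<notin> ?S" using Q as by auto
    have ks: "2 * (k * s) \<le> n"
    proof -
      have "2 * k * s \<le> 2 * k * (n div (2 * k))" using s by simp
      also have "\<dots> \<le> n" by simp
      finally show ?thesis by (simp add: mult.assoc)
    qed
    have "2 * s \<le> k * s" "(k - 1) * s \<le> k * s" using assms by (auto intro: mult_right_mono)
    then have "2 * s < n" "s \<le> n" "a \<le> n" "a + (k - 1) * s \<le> n" using a s(1) ks by linarith+
    then show "Q \<in> good_aps n k \<inter> aps n k"
      using a(1) s(1,3) as by (auto simp: good_aps_def aps_def)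
  qed
  then have "card ({1..n div 2} \<times> ({1..n div (2 * k)} - ?S)) \<le> card (good_aps n k \<inter> aps n k)"
    by (rule card_mono[rotated]) (simp add: finite_good_aps)
  moreover have "n div 2 * (n div (2 * k) - k ^ 4) \<le> n div 2 * card ({1..n div (2 * k)} - ?S)"
    using assms by (intro mult_left_mono card_interval_minus_short) auto
  ultimately show ?thesis by (simp only: card_cartesian_product card_atLeastAtMost diff_Suc_1)
qed

lemma card_good_aps_inter_approx:
  assumes "1 \<le> n" "3 \<le> k"
  shows "card (aps n k) \<le> card (good_aps n k \<inter> aps n k) + n * k ^ 4"
proof -
  have "card (aps n k) \<le> card ((good_aps n k \<inter> aps n k) \<union> short_aps n k)"
    using aps_subset_good[OF assms(2)] by (intro card_mono) (auto simp: finite_aps finite_good_aps)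
  also have "\<dots> \<le> card (good_aps n k \<inter> aps n k) + card (short_aps n k)" by (rule card_Un_le)
  finally show ?thesis using card_short_aps[OF assms(1), of k] by simp
qed

section \<open>Bernoulli sequences of fixed length\<close>

text \<open>\<open>E\<close> collects all progressions of length \<open>k\<close>, \<open>F\<close> the good ones among them,
  and \<open>B\<close> the few exceptional ones.\<close>

lemma prob_hit_bounds:
  fixes p :: real and E :: "(nat \<times> nat) set"
  assumes R: "random_subset M {1..n} p" and n: "1 \<le> n" and p: "0 < p" "p \<le> 1 / 2" and k: "2 \<le> k"
    and F: "F \<subseteq> good_aps n k" "F \<subseteq> E"
    and B: "finite B" "card B \<le> n * k ^ 4" "\<And>Q. Q \<in> B \<Longrightarrow> card (ap_set n k Q) = k"
    and E: "\<And>Q T. Q \<in> E \<Longrightarrow> ap_set n k Q \<subseteq> T \<Longrightarrow> \<exists>Q\<in>F \<union> B. ap_set n k Q \<subseteq> T"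
  defines "h \<equiv> measure M {T. \<exists>Q\<in>E. ap_set n k Q \<subseteq> T}"
  shows "F \<noteq> {} \<Longrightarrow> 1 - h \<le> (1 + overlap_bound n k p) / (real (card F) * p ^ k)"
    and "\<bar>1 - h - (1 - p ^ k) ^ card F\<bar>
      \<le> 2 * (real (card F) * p ^ k * overlap_bound n k p) + real (n * k ^ 4) * p ^ k"
proof -
  interpret random_subset M "{1..n}" p by (rule R)
  define q where "q = prob {T. \<forall>Q\<in>F. \<not> ap_set n k Q \<subseteq> T}"
  have finF: "finite F" using F(1) finite_good_aps by (rule finite_subset)
  have "prob {T. \<forall>Q\<in>E. \<not> ap_set n k Q \<subseteq> T} \<le> q"
    unfolding q_def using F(2) by (intro finite_measure_mono) auto
  then have up: "1 - h \<le> q" using prob_not[of "\<lambda>T. \<exists>Q\<in>E. ap_set n k Q \<subseteq> T"] by (simp add: h_def)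
  have "h \<le> prob ({T. \<exists>Q\<in>F. ap_set n k Q \<subseteq> T} \<union> {T. \<exists>Q\<in>B. ap_set n k Q \<subseteq> T})"
    unfolding h_def using E by (intro finite_measure_mono) (auto, blast)
  also have "\<dots> \<le> prob {T. \<exists>Q\<in>F. ap_set n k Q \<subseteq> T} + prob {T. \<exists>Q\<in>B. ap_set n k Q \<subseteq> T}"
    by (rule measure_Un_le) auto
  also have "prob {T. \<exists>Q\<in>F. ap_set n k Q \<subseteq> T} = 1 - q"
    using prob_not[of "\<lambda>T. \<exists>Q\<in>F. ap_set n k Q \<subseteq> T"] by (simp add: q_def)
  also have "prob {T. \<exists>Q\<in>B. ap_set n k Q \<subseteq> T} \<le> real (card B) * p ^ k"
    using B ap_set_subset[OF n] by (intro prob_exists_superset_le) auto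
  also have "\<dots> \<le> real (n * k ^ 4) * p ^ k"
    using B p by (intro mult_right_mono) (simp_all only: of_nat_le_iff, auto)
  finally have lo: "q - real (n * k ^ 4) * p ^ k \<le> 1 - h" by simp
  have nn: "0 \<le> real (n * k ^ 4) * p ^ k" using p by simp
  show "\<bar>1 - h - (1 - p ^ k) ^ card F\<bar>
      \<le> 2 * (real (card F) * p ^ k * overlap_bound n k p) + real (n * k ^ 4) * p ^ k"
    using prob_avoid_aps_approx[OF R n p(2) k F(1)] lo up nn unfolding q_def by linarith
  assume "F \<noteq> {}"
  define \<mu> where "\<mu> = real (card F) * p ^ k"
  have "0 < \<mu>" using finF p \<open>F \<noteq> {}\<close> by (auto simp: card_gt_0_iff \<mu>_def)
  moreover have "\<mu> * (q * \<mu>) \<le> \<mu> * (1 + overlap_bound n k p)"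
    using prob_avoid_aps_le[OF R n p(2) k F(1)] by (simp add: q_def \<mu>_def power2_eq_square mult_ac)
  ultimately have "q * \<mu> \<le> 1 + overlap_bound n k p" by (simp only: mult_le_cancel_left_pos)
  then have "q \<le> (1 + overlap_bound n k p) / (real (card F) * p ^ k)"
    using \<open>0 < \<mu>\<close> by (simp add: \<mu>_def pos_le_divide_eq)
  then show "1 - h \<le> (1 + overlap_bound n k p) / (real (card F) * p ^ k)" using up by simp
qed

locale bernoulli_sequence = prob_space M for M :: "'a measure" +
  fixes n :: nat and \<xi> :: "nat \<Rightarrow> 'a \<Rightarrow> nat" and p :: real
  assumes n: "1 \<le> n" and p: "0 < p" "p < 1"
    and indep_\<xi>: "indep_vars (\<lambda>_. count_space {0, 1}) \<xi> {1..n}"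
    and prob_\<xi>: "\<And>i. i \<in> {1..n} \<Longrightarrow> prob {\<omega>\<in>space M. \<xi> i \<omega> = 1} = p"
begin

definition ones :: "'a \<Rightarrow> nat set" where
  "ones \<omega> = {i\<in>{1..n}. \<xi> i \<omega> = 1}"

text \<open>On the discrete space of sets every event is measurable, as \<open>random_subset\<close>
  demands.\<close>

definition law :: "nat set measure" where
  "law = distr M (count_space UNIV) ones"

lemma measurable_\<xi>: "i \<in> {1..n} \<Longrightarrow> \<xi> i \<in> measurable M (count_space {0, 1})"
  using indep_\<xi> by (auto simp: indep_vars_def)

lemma \<xi>_values: "i \<in> {1..n} \<Longrightarrow> \<omega> \<in> space M \<Longrightarrow> \<xi> i \<omega> \<in> {0, 1}"
  using measurable_space[OF measurable_\<xi>, of i \<omega>] by simp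

text \<open>The set of ones factors through the finite product of two-point spaces, which is
  discrete.\<close>

lemma measurable_ones: "ones \<in> measurable M (count_space UNIV)"
proof -
  have "(\<lambda>\<omega>. restrict (\<lambda>i. \<xi> i \<omega>) {1..n}) \<in> measurable M (PiM {1..n} (\<lambda>_. count_space {0, 1}))"
    by (rule measurable_restrict) (rule measurable_\<xi>)
  moreover have "(\<lambda>f. {i\<in>{1..n}. f i = 1}) \<in> measurable (PiM {1..n} (\<lambda>_. count_space {0, 1 :: nat})) (count_space UNIV)"
    by (subst count_space_PiM_finite) auto
  ultimately have "(\<lambda>\<omega>. {i\<in>{1..n}. restrict (\<lambda>i. \<xi> i \<omega>) {1..n} i = 1}) \<in> measurable M (count_space UNIV)"
    by (rule measurable_compose)
  moreover have "(\<lambda>\<omega>. {i\<in>{1..n}. restrict (\<lambda>i. \<xi> i \<omega>) {1..n} i = 1}) = ones"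
    by (rule ext) (auto simp: ones_def)
  ultimately show ?thesis by simp
qed

lemma measure_law: "measure law {T. R T} = prob {\<omega>\<in>space M. R (ones \<omega>)}"
  unfolding law_def
  by (subst measure_distr[OF measurable_ones]) (auto intro!: arg_cong[where f = prob])

lemma prob_all_ones:
  assumes "A \<subseteq> {1..n}"
  shows "prob {\<omega>\<in>space M. A \<subseteq> ones \<omega>} = p ^ card A"
\<comment> \<open>Independence speaks about nonempty index sets, and an empty intersection would not
  be the sample space.\<close>
proof (cases "A = {}")
  case True
  then show ?thesis using prob_space by simp
next
  case False
  have "prob (\<Inter>i\<in>A. \<xi> i -` {1} \<inter> space M) = (\<Prod>i\<in>A. prob (\<xi> i -` {1} \<inter> space M))"
    using assms False by (intro indep_varsD[OF indep_\<xi>]) (auto intro: finite_subset)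
  also have "(\<Inter>i\<in>A. \<xi> i -` {1} \<inter> space M) = {\<omega>\<in>space M. A \<subseteq> ones \<omega>}"
    using assms False by (auto simp: ones_def)
  also have "(\<Prod>i\<in>A. prob (\<xi> i -` {1} \<inter> space M)) = (\<Prod>i\<in>A. p)"
  proof (rule prod.cong)
    fix i assume "i \<in> A"
    then have "prob {\<omega>\<in>space M. \<xi> i \<omega> = 1} = p" using assms by (intro prob_\<xi>) auto
    moreover have "\<xi> i -` {1} \<inter> space M = {\<omega>\<in>space M. \<xi> i \<omega> = 1}" by auto
    ultimately show "prob (\<xi> i -` {1} \<inter> space M) = p" by simp
  qed simp
  finally show ?thesis by simp
qed

text \<open>Containing A depends on the coordinates in A only, the remainder T - A on those in
  {1..n} - A only. Restrictions to disjoint index sets are independent.\<close>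

lemma random_subset_law: "random_subset law {1..n} p"
proof -
  interpret L: prob_space law
    unfolding law_def by (rule prob_space_distr) (rule measurable_ones)
  show ?thesis
  proof
    show "sets law = UNIV" by (simp add: law_def)
    show "finite {1..n}" "0 \<le> p" "p \<le> 1" using p by auto
    fix A :: "nat set" and G assume A: "A \<subseteq> {1..n}"
    define B where "B = {1..n} - A"
    let ?N = "\<lambda>_ :: nat. count_space {0, 1 :: nat}"
    have fin: "finite A" "finite B" using A finite_subset by (auto simp: B_def)
    let ?X = "\<lambda>\<omega>. restrict (\<lambda>i. \<xi> i \<omega>) A" and ?Y = "\<lambda>\<omega>. restrict (\<lambda>i. \<xi> i \<omega>) B"
    have "indep_var (PiM A ?N) ?X (PiM B ?N) ?Y"
      using A by (intro indep_var_restrict[OF indep_\<xi>]) (auto simp: B_def)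
    moreover define SX where "SX = {f \<in> space (PiM A ?N). \<forall>i\<in>A. f i = 1}"
    moreover have "SX \<in> sets (PiM A ?N)"
      unfolding SX_def using fin by (auto simp: count_space_PiM_finite)
    moreover define SY where "SY = {f \<in> space (PiM B ?N). {i\<in>B. f i = 1} \<in> G}"
    moreover have "SY \<in> sets (PiM B ?N)"
      unfolding SY_def using fin by (auto simp: count_space_PiM_finite)
    ultimately have indep_XY: "prob ((\<lambda>\<omega>. (?X \<omega>, ?Y \<omega>)) -` (SX \<times> SY) \<inter> space M)
        = prob (?X -` SX \<inter> space M) * prob (?Y -` SY \<inter> space M)"
      by (intro indep_varD) auto
    have vals: "\<xi> i \<omega> \<in> {0, 1}" if "i \<in> A \<union> B" "\<omega> \<in> space M" for i \<omega>
      using \<xi>_values that A unfolding B_def by blast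
    have spX: "?X \<omega> \<in> space (PiM A ?N)" and spY: "?Y \<omega> \<in> space (PiM B ?N)" if "\<omega> \<in> space M" for \<omega>
      using vals[OF _ that] by (simp_all add: space_PiM)
    have iffX: "?X \<omega> \<in> SX \<longleftrightarrow> A \<subseteq> ones \<omega>" if "\<omega> \<in> space M" for \<omega>
      using spX[OF that] A by (auto simp: SX_def ones_def)
    have iffY: "?Y \<omega> \<in> SY \<longleftrightarrow> ones \<omega> - A \<in> G" if "\<omega> \<in> space M" for \<omega>
    proof -
      have "{i\<in>B. ?Y \<omega> i = 1} = ones \<omega> - A" by (auto simp: ones_def B_def)
      then show ?thesis using spY[OF that] by (simp add: SY_def)
    qed
    have "?X -` SX \<inter> space M = {\<omega>\<in>space M. A \<subseteq> ones \<omega>}"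
      "?Y -` SY \<inter> space M = {\<omega>\<in>space M. ones \<omega> - A \<in> G}"
      "(\<lambda>\<omega>. (?X \<omega>, ?Y \<omega>)) -` (SX \<times> SY) \<inter> space M = {\<omega>\<in>space M. A \<subseteq> ones \<omega> \<and> ones \<omega> - A \<in> G}"
      using iffX iffY by auto
    then show "L.prob {T. A \<subseteq> T \<and> T - A \<in> G} = p ^ card A * L.prob {T. T - A \<in> G}"
      using prob_all_ones[OF A] indep_XY by (simp add: measure_law)
  qed
qed

definition prob_ge :: "nat \<Rightarrow> real" where
  "prob_ge k = prob {\<omega>\<in>space M. k \<le> longest_ap n (\<lambda>i. \<xi> i \<omega>)}"

definition prob_ge_mod :: "nat \<Rightarrow> real" where
  "prob_ge_mod k = prob {\<omega>\<in>space M. k \<le> longest_ap_mod n (\<lambda>i. \<xi> i \<omega>)}"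

lemma event_ge:
  assumes "1 \<le> k"
  shows "{\<omega>\<in>space M. k \<le> longest_ap n (\<lambda>i. \<xi> i \<omega>)} = {\<omega>\<in>space M. \<exists>Q\<in>aps n k. ap_set n k Q \<subseteq> ones \<omega>}"
    "{\<omega>\<in>space M. k \<le> longest_ap_mod n (\<lambda>i. \<xi> i \<omega>)} = {\<omega>\<in>space M. \<exists>Q\<in>aps_mod n k. ap_set n k Q \<subseteq> ones \<omega>}"
proof -
  have "k \<le> longest_ap n (\<lambda>i. \<xi> i \<omega>) \<longleftrightarrow> (\<exists>Q\<in>aps n k. ap_set n k Q \<subseteq> ones \<omega>)"
    "k \<le> longest_ap_mod n (\<lambda>i. \<xi> i \<omega>) \<longleftrightarrow> (\<exists>Q\<in>aps_mod n k. ap_set n k Q \<subseteq> ones \<omega>)"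
    if "\<omega> \<in> space M" for \<omega>
    unfolding ones_def using \<xi>_values[OF _ that] assms n
    by (intro le_longest_ap_iff le_longest_ap_mod_iff; blast)+
  then show "{\<omega>\<in>space M. k \<le> longest_ap n (\<lambda>i. \<xi> i \<omega>)} = {\<omega>\<in>space M. \<exists>Q\<in>aps n k. ap_set n k Q \<subseteq> ones \<omega>}"
    "{\<omega>\<in>space M. k \<le> longest_ap_mod n (\<lambda>i. \<xi> i \<omega>)} = {\<omega>\<in>space M. \<exists>Q\<in>aps_mod n k. ap_set n k Q \<subseteq> ones \<omega>}"
    by (simp_all cong: conj_cong)
qed

lemma events_ge:
  assumes "1 \<le> k"
  shows
  "{\<omega>\<in>space M. k \<le> longest_ap n (\<lambda>i. \<xi> i \<omega>)} \<in> events"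
  "{\<omega>\<in>space M. k \<le> longest_ap_mod n (\<lambda>i. \<xi> i \<omega>)} \<in> events"
proof -
  have *: "{\<omega>\<in>space M. R (ones \<omega>)} \<in> events" for R
    using measurable_sets[OF measurable_ones, of "{T. R T}"] by (auto simp: vimage_def Int_def conj_commute)
  show "{\<omega>\<in>space M. k \<le> longest_ap n (\<lambda>i. \<xi> i \<omega>)} \<in> events"
    "{\<omega>\<in>space M. k \<le> longest_ap_mod n (\<lambda>i. \<xi> i \<omega>)} \<in> events"
    unfolding event_ge[OF assms] by (rule *)+
qed

lemma prob_ge_eq:
  assumes "1 \<le> k"
  shows "prob_ge k = measure law {T. \<exists>Q\<in>aps n k. ap_set n k Q \<subseteq> T}"
    "prob_ge_mod k = measure law {T. \<exists>Q\<in>aps_mod n k. ap_set n k Q \<subseteq> T}"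
  unfolding prob_ge_def prob_ge_mod_def event_ge[OF assms] measure_law by simp_all

lemma prob_ge_le:
  assumes "2 \<le> k"
  shows "prob_ge k \<le> (real n)\<^sup>2 * p ^ k / real (k - 1)"
proof -
  interpret R: random_subset law "{1..n}" p by (rule random_subset_law)
  have "prob_ge k \<le> real (card (aps n k)) * p ^ k"
    unfolding prob_ge_eq(1)[OF order_trans[OF one_le_numeral assms]]
    by (rule R.prob_exists_superset_le) (simp_all only: finite_aps ap_set_subset[OF n] card_ap_set_aps)
  also have "\<dots> \<le> ((real n)\<^sup>2 / real (k - 1)) * p ^ k"
    using card_aps_le[OF assms, of n] p by (intro mult_right_mono) auto
  finally show ?thesis by simp
qed

lemma prob_ge_mod_le:
  assumes "1 \<le> k"
  shows "prob_ge_mod k \<le> (real n)\<^sup>2 * p ^ k"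
proof -
  interpret R: random_subset law "{1..n}" p by (rule random_subset_law)
  have "prob_ge_mod k \<le> real (card (aps_mod n k)) * p ^ k"
    unfolding prob_ge_eq(2)[OF assms]
    by (rule R.prob_exists_superset_le) (simp_all only: finite_aps ap_set_subset[OF n] card_ap_set_aps_mod)
  also have "\<dots> \<le> (real n)\<^sup>2 * p ^ k"
    using card_aps_mod_le[of n k] p by (intro mult_right_mono) (simp_all flip: of_nat_power)
  finally show ?thesis .
qed

text \<open>A lower bound on the hitting probability may discard all but the good progressions, so
  \<open>F\<close> itself plays the whole family with no exceptions. The two-sided estimate must
  account for every progression, which brings in \<open>aps_subset_good\<close> and k >= 3.\<close>

lemma prob_ge_bounds:
  fixes k :: nat
  assumes "2 \<le> k" "p \<le> 1 / 2"
  defines "F \<equiv> good_aps n k \<inter> aps n k"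
  shows "F \<noteq> {} \<Longrightarrow> 1 - prob_ge k \<le> (1 + overlap_bound n k p) / (real (card F) * p ^ k)"
    and "3 \<le> k \<Longrightarrow> \<bar>1 - prob_ge k - (1 - p ^ k) ^ card F\<bar>
      \<le> 2 * (real (card F) * p ^ k * overlap_bound n k p) + real (n * k ^ 4) * p ^ k"
proof -
  interpret R: random_subset law "{1..n}" p by (rule random_subset_law)
  have k: "1 \<le> k" using assms by simp
  show "1 - prob_ge k \<le> (1 + overlap_bound n k p) / (real (card F) * p ^ k)" if "F \<noteq> {}"
  proof -
    have "1 - measure law {T. \<exists>Q\<in>F. ap_set n k Q \<subseteq> T} \<le> (1 + overlap_bound n k p) / (real (card F) * p ^ k)"
      by (rule prob_hit_bounds(1)[OF random_subset_law n p(1) assms(2,1), of F F "{}"])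
         (use that in \<open>auto simp: F_def\<close>)
    moreover have "measure law {T. \<exists>Q\<in>F. ap_set n k Q \<subseteq> T} \<le> prob_ge k"
      unfolding prob_ge_eq(1)[OF k] F_def by (intro R.finite_measure_mono) auto
    ultimately show ?thesis by simp
  qed
  show "\<bar>1 - prob_ge k - (1 - p ^ k) ^ card F\<bar>
      \<le> 2 * (real (card F) * p ^ k * overlap_bound n k p) + real (n * k ^ 4) * p ^ k" if "3 \<le> k"
    unfolding prob_ge_eq(1)[OF k]
  proof (rule prob_hit_bounds(2)[OF random_subset_law n p(1) assms(2,1), of F _ "short_aps n k \<inter> aps n k"])
    have "card (short_aps n k \<inter> aps n k) \<le> card (short_aps n k)"
      by (intro card_mono) (auto simp: finite_aps)
    then show "card (short_aps n k \<inter> aps n k) \<le> n * k ^ 4" using card_short_aps[OF n, of k] by simp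
    show "\<exists>Q\<in>F \<union> short_aps n k \<inter> aps n k. ap_set n k Q \<subseteq> T"
      if "Q \<in> aps n k" "ap_set n k Q \<subseteq> T" for Q T
      using that aps_subset_good[OF \<open>3 \<le> k\<close>, of n] by (auto simp: F_def)
  qed (auto simp: F_def finite_aps card_ap_set_aps)
qed

text \<open>Here reversal makes every non-exceptional progression good already for k = 2.\<close>

lemma prob_ge_mod_bounds:
  assumes "2 \<le> k" "p \<le> 1 / 2"
  shows "good_aps n k \<noteq> {} \<Longrightarrow>
      1 - prob_ge_mod k \<le> (1 + overlap_bound n k p) / (real (card (good_aps n k)) * p ^ k)"
    and "\<bar>1 - prob_ge_mod k - (1 - p ^ k) ^ card (good_aps n k)\<bar>
      \<le> 2 * (real (card (good_aps n k)) * p ^ k * overlap_bound n k p) + real (n * k ^ 4) * p ^ k"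
proof -
  have k: "1 \<le> k" using assms by simp
  note bounds = prob_hit_bounds[OF random_subset_law n p(1) assms(2,1) order_refl good_aps_subset_mod[OF k],
      of "short_aps n k \<inter> aps_mod n k"]
  have "card (short_aps n k \<inter> aps_mod n k) \<le> card (short_aps n k)"
    by (intro card_mono) (auto simp: finite_aps)
  then have B: "finite (short_aps n k \<inter> aps_mod n k)" "card (short_aps n k \<inter> aps_mod n k) \<le> n * k ^ 4"
    "\<And>Q. Q \<in> short_aps n k \<inter> aps_mod n k \<Longrightarrow> card (ap_set n k Q) = k"
    using card_short_aps[OF n, of k] by (auto simp: finite_aps card_ap_set_aps_mod)
  show "good_aps n k \<noteq> {} \<Longrightarrow>
      1 - prob_ge_mod k \<le> (1 + overlap_bound n k p) / (real (card (good_aps n k)) * p ^ k)"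
    unfolding prob_ge_eq(2)[OF k] by (rule bounds(1)[OF B exists_aps_mod_imp_good[OF assms(1)]])
  show "\<bar>1 - prob_ge_mod k - (1 - p ^ k) ^ card (good_aps n k)\<bar>
      \<le> 2 * (real (card (good_aps n k)) * p ^ k * overlap_bound n k p) + real (n * k ^ 4) * p ^ k"
    unfolding prob_ge_eq(2)[OF k] by (rule bounds(2)[OF B exists_aps_mod_imp_good[OF assms(1)]])
qed

end

section \<open>Asymptotics\<close>

text \<open>Keeps the middle term of \<open>overlap_bound\<close> bounded uniformly in k once p <=
  1/4.\<close>

lemma power5_quarter_bounded: "\<exists>C\<ge>0. \<forall>k. real (k ^ 5) * (1 / 4) ^ (k div 2) \<le> C"
proof -
  have "(\<lambda>k. 2 * (real k ^ 5 * (1 / 2) ^ k)) \<longlonglongrightarrow> 0" by real_asymp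
  then have "Bseq (\<lambda>k. 2 * (real k ^ 5 * (1 / 2) ^ k))" by (rule convergent_imp_Bseq[OF convergentI])
  then obtain C where C: "0 < C" "\<And>k. norm (2 * (real k ^ 5 * (1 / 2 :: real) ^ k)) \<le> C"
    unfolding Bseq_def by blast
  have "real (k ^ 5) * (1 / 4) ^ (k div 2) \<le> C" for k
  proof -
    have "(1 / 4 :: real) ^ (k div 2) = (1 / 2) ^ (2 * (k div 2))" by (simp add: power_mult power2_eq_square)
    also have "\<dots> = 2 * (1 / 2) ^ (Suc (2 * (k div 2)))" by simp
    also have "\<dots> \<le> 2 * (1 / 2) ^ k" by (intro mult_left_mono power_decreasing) auto
    finally have "real (k ^ 5) * (1 / 4) ^ (k div 2) \<le> real (k ^ 5) * (2 * (1 / 2) ^ k)"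
      by (intro mult_left_mono) auto
    also have "\<dots> \<le> C" using C(2)[of k] by (simp add: mult_ac)
    finally show ?thesis .
  qed
  then show ?thesis using C(1) by (intro exI[of _ C]) auto
qed

text \<open>The logarithm is the product of N x, tending to l, and ln (1 - x) / x, tending to
  -1.\<close>

lemma power_one_minus_tendsto_exp:
  fixes x :: "nat \<Rightarrow> real" and N :: "nat \<Rightarrow> nat"
  assumes x: "x \<longlonglongrightarrow> 0" "\<forall>\<^sub>F n in sequentially. 0 < x n"
    and Nx: "(\<lambda>n. real (N n) * x n) \<longlonglongrightarrow> l"
  shows "(\<lambda>n. (1 - x n) ^ N n) \<longlonglongrightarrow> exp (- l)"
proof -
  have "filterlim x (at_right 0) sequentially"
    using x by (auto simp: filterlim_at elim: eventually_mono)
  moreover have "((\<lambda>y. ln (1 - y) / y) \<longlongrightarrow> - 1) (at_right (0 :: real))" by real_asymp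
  ultimately have "(\<lambda>n. ln (1 - x n) / x n) \<longlonglongrightarrow> - 1" by (rule filterlim_compose[rotated])
  then have lim: "(\<lambda>n. exp ((real (N n) * x n) * (ln (1 - x n) / x n))) \<longlonglongrightarrow> exp (l * (- 1))"
    using Nx by (intro tendsto_intros)
  have "\<forall>\<^sub>F n in sequentially. exp ((real (N n) * x n) * (ln (1 - x n) / x n)) = (1 - x n) ^ N n"
    using x(2) order_tendstoD(2)[OF x(1) zero_less_one]
  proof eventually_elim
    case (elim n)
    then show ?case by (simp add: exp_of_nat_mult)
  qed
  then show ?thesis using Lim_transform_eventually[OF lim] by simp
qed

text \<open>The facts that both statistics share: \<open>H n k\<close> stands for the probability of
  a length at least k, \<open>N n k\<close> for the number of good progressions used. The lower
  bound on \<open>N\<close> is the one valid for the smaller of the two families.\<close>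

locale ap_tails =
  fixes p :: "nat \<Rightarrow> real" and H :: "nat \<Rightarrow> nat \<Rightarrow> real" and N :: "nat \<Rightarrow> nat \<Rightarrow> nat"
  assumes p_pos: "\<And>n. 1 \<le> n \<Longrightarrow> 0 < p n" and p_less_1: "\<And>n. 1 \<le> n \<Longrightarrow> p n < 1"
    and p_lim: "p \<longlonglongrightarrow> 0"
    and np_lim: "filterlim (\<lambda>n. real n * p n) at_top sequentially"
    and H_nonneg: "\<And>n k. 1 \<le> n \<Longrightarrow> 0 \<le> H n k"
    and H_le_1: "\<And>n k. 1 \<le> n \<Longrightarrow> H n k \<le> 1"
    and H_le: "\<And>n k. 1 \<le> n \<Longrightarrow> 2 \<le> k \<Longrightarrow> H n k \<le> (real n)\<^sup>2 * p n ^ k"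
    and H_ge: "\<And>n k. 1 \<le> n \<Longrightarrow> 2 \<le> k \<Longrightarrow> p n \<le> 1 / 2 \<Longrightarrow> 0 < N n k \<Longrightarrow>
      1 - H n k \<le> (1 + overlap_bound n k (p n)) / (real (N n k) * p n ^ k)"
    and H_approx: "\<And>n k. 1 \<le> n \<Longrightarrow> 3 \<le> k \<Longrightarrow> p n \<le> 1 / 2 \<Longrightarrow>
      \<bar>1 - H n k - (1 - p n ^ k) ^ N n k\<bar>
        \<le> 2 * (real (N n k) * p n ^ k * overlap_bound n k (p n)) + real (n * k ^ 4) * p n ^ k"
    and N_ge: "\<And>n k. 1 \<le> n \<Longrightarrow> 2 \<le> k \<Longrightarrow> 8 * k ^ 5 \<le> n \<Longrightarrow> (real n)\<^sup>2 / (16 * real k) \<le> real (N n k)"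
begin

lemma ev_ge_1: "\<forall>\<^sub>F n in sequentially. 1 \<le> (n :: nat)"
  by (rule eventually_ge_at_top)

lemma ev_p_le: "0 < c \<Longrightarrow> \<forall>\<^sub>F n in sequentially. p n \<le> c"
  using order_tendstoD(2)[OF p_lim, of c] by (auto elim: eventually_mono)

lemma ln_p_lim: "filterlim (\<lambda>n. - ln (p n)) at_top sequentially"
proof -
  have "filterlim p (at_right 0) sequentially"
  proof -
    have "\<forall>\<^sub>F n in sequentially. p n \<in> {0<..} \<and> p n \<noteq> 0"
      using ev_ge_1 by eventually_elim (use p_pos in force)
    then show ?thesis using p_lim by (simp add: filterlim_at)
  qed
  then have "filterlim (\<lambda>n. ln (p n)) at_bot sequentially" by (rule filterlim_compose[OF ln_at_0])
  then show ?thesis by (rule filterlim_uminus_at_top_at_bot[THEN filterlim_compose, rotated])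
qed

text \<open>For p <= 1/4 the terms 1, 4 p and k^5 p^(k div 2) fit into a constant. The term k^2 n
  p^(k - 1) divided by the mean is at most 16 k^3 / (n p), by \<open>N_ge\<close>.\<close>

lemma H_ge_explicit:
  "\<exists>C. \<forall>n k. 1 \<le> n \<longrightarrow> 2 \<le> k \<longrightarrow> p n \<le> 1 / 4 \<longrightarrow> 8 * k ^ 5 \<le> n \<longrightarrow>
    1 - H n k \<le> C / (real (N n k) * p n ^ k) + 16 * real k ^ 3 / (real n * p n)"
proof -
  obtain C where C: "\<And>k. real (k ^ 5) * (1 / 4) ^ (k div 2) \<le> C"
    using power5_quarter_bounded by blast
  have "1 - H n k \<le> (C + 2) / (real (N n k) * p n ^ k) + 16 * real k ^ 3 / (real n * p n)"
    if n: "1 \<le> n" and k: "2 \<le> k" and pn: "p n \<le> 1 / 4" and nk: "8 * k ^ 5 \<le> n" for n k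
  proof -
    let ?N = "real (N n k)"
    note pos = p_pos[OF n]
    have N: "(real n)\<^sup>2 / (16 * real k) \<le> ?N" by (rule N_ge[OF n k nk])
    have "0 < (real n)\<^sup>2 / (16 * real k)" using n k by simp
    then have N0: "0 < ?N" using N by linarith
    have "real (k ^ 5) * p n ^ (k div 2) \<le> real (k ^ 5) * (1 / 4) ^ (k div 2)"
      using pn pos by (intro mult_left_mono power_mono) auto
    also have "\<dots> \<le> C" by (rule C)
    finally have "1 + overlap_bound n k (p n) \<le> (C + 2) + real (k\<^sup>2 * n) * p n ^ (k - 1)"
      using pn by (simp add: overlap_bound_def)
    then have "1 - H n k \<le> ((C + 2) + real (k\<^sup>2 * n) * p n ^ (k - 1)) / (?N * p n ^ k)"
      using pn N0 pos by (intro order_trans[OF H_ge[OF n k]] divide_right_mono) auto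
    also have "\<dots> = (C + 2) / (?N * p n ^ k) + real (k\<^sup>2 * n) * p n ^ (k - 1) / (?N * p n ^ k)"
      by (rule add_divide_distrib)
    also have "p n ^ k = p n * p n ^ (k - 1)" using k by (simp flip: power_Suc)
    then have "real (k\<^sup>2 * n) * p n ^ (k - 1) / (?N * p n ^ k) = real k ^ 2 * real n / (?N * p n)"
      using pos by simp
    also have "\<dots> \<le> real k ^ 2 * real n / ((real n)\<^sup>2 / (16 * real k) * p n)"
      using N pos n k by (intro divide_left_mono mult_right_mono mult_pos_pos divide_pos_pos N0) auto
    also have "\<dots> = 16 * real k ^ 3 / (real n * p n)"
      using n k pos by (simp add: field_simps power2_eq_square power3_eq_cube)
    finally show ?thesis by simp
  qed
  then show ?thesis by blast
qed

text \<open>The sixth power lets one hypothesis do two jobs: it sends k^3 / (n p) to 0 and, as n p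
  <= n, guarantees 8 k^5 <= n eventually.\<close>

lemma H_tendsto_1:
  assumes \<kappa>: "\<forall>\<^sub>F n in sequentially. 2 \<le> \<kappa> n"
    and small: "(\<lambda>n. real (\<kappa> n) ^ 6 / (real n * p n)) \<longlonglongrightarrow> 0"
    and large: "filterlim (\<lambda>n. real (N n (\<kappa> n)) * p n ^ \<kappa> n) at_top sequentially"
  shows "(\<lambda>n. H n (\<kappa> n)) \<longlonglongrightarrow> 1"
proof -
  obtain C where C: "\<And>n k. 1 \<le> n \<Longrightarrow> 2 \<le> k \<Longrightarrow> p n \<le> 1 / 4 \<Longrightarrow> 8 * k ^ 5 \<le> n \<Longrightarrow>
    1 - H n k \<le> C / (real (N n k) * p n ^ k) + 16 * real k ^ 3 / (real n * p n)"
    using H_ge_explicit by blast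
  let ?e = "\<lambda>n. C / (real (N n (\<kappa> n)) * p n ^ \<kappa> n) + 16 * (real (\<kappa> n) ^ 6 / (real n * p n))"
  have "(\<lambda>n. C / (real (N n (\<kappa> n)) * p n ^ \<kappa> n)) \<longlonglongrightarrow> 0"
    by (rule tendsto_divide_0[OF tendsto_const filterlim_at_top_imp_at_infinity[OF large]])
  then have e: "?e \<longlonglongrightarrow> 0" using tendsto_add[OF _ tendsto_mult_left[OF small, of 16]] by force
  have "\<forall>\<^sub>F n in sequentially. 1 - H n (\<kappa> n) \<le> ?e n"
    using \<kappa> ev_ge_1 ev_p_le[of "1/4", simplified] order_tendstoD(2)[OF small, of "1/8", simplified]
  proof eventually_elim
    case (elim n)
    note pos = p_pos[OF elim(2)]
    have n: "0 < real n" using elim(2) by simp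
    have "8 * real (\<kappa> n) ^ 6 < real n * p n" using elim(4) pos n by (simp add: field_simps)
    also have "\<dots> \<le> real n" using p_less_1[OF elim(2)] n by simp
    finally have "real (8 * \<kappa> n ^ 6) < real n" by simp
    then have "8 * \<kappa> n ^ 6 \<le> n" by (simp only: of_nat_less_iff less_imp_le)
    moreover have "\<kappa> n ^ 5 \<le> \<kappa> n ^ 6" using elim(1) by (intro power_increasing) auto
    ultimately have "8 * \<kappa> n ^ 5 \<le> n" by linarith
    then have "1 - H n (\<kappa> n) \<le> C / (real (N n (\<kappa> n)) * p n ^ \<kappa> n) + 16 * real (\<kappa> n) ^ 3 / (real n * p n)"
      using elim by (intro C) auto
    also have "16 * real (\<kappa> n) ^ 3 / (real n * p n) \<le> 16 * real (\<kappa> n) ^ 6 / (real n * p n)"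
      using pos n elim(1) by (intro divide_right_mono mult_left_mono power_increasing) auto
    finally show ?case by simp
  qed
  then have lo: "\<forall>\<^sub>F n in sequentially. 1 - ?e n \<le> H n (\<kappa> n)" by eventually_elim linarith
  have hi: "\<forall>\<^sub>F n in sequentially. H n (\<kappa> n) \<le> 1" using ev_ge_1 by eventually_elim (rule H_le_1)
  have lim: "(\<lambda>n. 1 - ?e n) \<longlonglongrightarrow> 1" using tendsto_diff[OF tendsto_const e, of 1] by simp
  show ?thesis by (rule tendsto_sandwich[OF lo hi lim tendsto_const])
qed

lemma H_fixed_tendsto_1:
  assumes k: "2 \<le> k" and large: "filterlim (\<lambda>n. (real n)\<^sup>2 * p n ^ k) at_top sequentially"
  shows "(\<lambda>n. H n k) \<longlonglongrightarrow> 1"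
proof (rule H_tendsto_1[where \<kappa> = "\<lambda>_. k"])
  show "(\<lambda>n. real k ^ 6 / (real n * p n)) \<longlonglongrightarrow> 0"
    by (rule tendsto_divide_0[OF tendsto_const filterlim_at_top_imp_at_infinity[OF np_lim]])
  have "filterlim (\<lambda>n. 1 / (16 * real k) * ((real n)\<^sup>2 * p n ^ k)) at_top sequentially"
    using k by (intro filterlim_tendsto_pos_mult_at_top[OF tendsto_const _ large]) auto
  then show "filterlim (\<lambda>n. real (N n k) * p n ^ k) at_top sequentially"
  proof (rule filterlim_at_top_mono)
    show "\<forall>\<^sub>F n in sequentially. 1 / (16 * real k) * ((real n)\<^sup>2 * p n ^ k) \<le> real (N n k) * p n ^ k"
      using ev_ge_1 eventually_ge_at_top[of "8 * k ^ 5"]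
    proof eventually_elim
      case (elim n)
      have "(real n)\<^sup>2 / (16 * real k) * p n ^ k \<le> real (N n k) * p n ^ k"
        using N_ge[OF elim(1) k elim(2)] p_pos[OF elim(1)] by (intro mult_right_mono) auto
      then show ?case by simp
    qed
  qed
qed (use k in auto)

lemma H_fixed_tendsto_0:
  assumes k: "2 \<le> k" and "(\<lambda>n. (real n)\<^sup>2 * p n ^ k) \<longlonglongrightarrow> 0"
  shows "(\<lambda>n. H n k) \<longlonglongrightarrow> 0"
proof (rule tendsto_sandwich[OF _ _ tendsto_const assms(2)])
  show "\<forall>\<^sub>F n in sequentially. 0 \<le> H n k" using ev_ge_1 by eventually_elim (rule H_nonneg)
  show "\<forall>\<^sub>F n in sequentially. H n k \<le> (real n)\<^sup>2 * p n ^ k"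
    using ev_ge_1 by eventually_elim (rule H_le[OF _ k])
qed

text \<open>The mean tends to c u, while the overlaps and the exceptional progressions contribute
  errors that vanish for fixed k because n^2 p^k stays bounded.\<close>

lemma H_fixed_Poisson:
  assumes k: "3 \<le> k" and u: "(\<lambda>n. (real n)\<^sup>2 * p n ^ k) \<longlonglongrightarrow> u"
    and c: "(\<lambda>n. real (N n k) / (real n)\<^sup>2) \<longlonglongrightarrow> c"
  shows "(\<lambda>n. H n k) \<longlonglongrightarrow> 1 - exp (- (c * u))"
proof -
  have inv_np: "(\<lambda>n. 1 / (real n * p n)) \<longlonglongrightarrow> 0"
    by (rule tendsto_divide_0[OF tendsto_const filterlim_at_top_imp_at_infinity[OF np_lim]])
  have p_pow: "(\<lambda>n. p n ^ j) \<longlonglongrightarrow> 0" if "0 < j" for j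
    using tendsto_power[OF p_lim, of j] that by (simp add: zero_power)
  have Np: "(\<lambda>n. real (N n k) * p n ^ k) \<longlonglongrightarrow> c * u"
  proof (rule Lim_transform_eventually[OF tendsto_mult[OF c u]])
    show "\<forall>\<^sub>F n in sequentially. real (N n k) / (real n)\<^sup>2 * ((real n)\<^sup>2 * p n ^ k) = real (N n k) * p n ^ k"
      using ev_ge_1 by eventually_elim simp
  qed
  have "(\<lambda>n. (1 - p n ^ k) ^ N n k) \<longlonglongrightarrow> exp (- (c * u))"
    using p_pow[of k] k p_pos by (intro power_one_minus_tendsto_exp Np) (auto intro: eventually_mono[OF ev_ge_1])
  moreover have "(\<lambda>n. 1 - H n k - (1 - p n ^ k) ^ N n k) \<longlonglongrightarrow> 0"
  proof (rule Lim_null_comparison)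
    let ?e = "\<lambda>n. 2 * (real (N n k) * p n ^ k * overlap_bound n k (p n)) + real (n * k ^ 4) * p n ^ k"
    show "\<forall>\<^sub>F n in sequentially. norm (1 - H n k - (1 - p n ^ k) ^ N n k) \<le> ?e n"
      using ev_ge_1 ev_p_le[of "1/2", simplified]
      by eventually_elim (simp only: real_norm_def, rule H_approx[OF _ k], auto)
    \<comment> \<open>Here n p^(k - 1) is written as n^2 p^k / (n p), a convergent factor times a
      null one.\<close>
    have lim: "(\<lambda>n. real k ^ 2 * (((real n)\<^sup>2 * p n ^ k) * (1 / (real n * p n))) + real (k ^ 5) * p n ^ (k div 2) + 4 * p n) \<longlonglongrightarrow>
      real k ^ 2 * (u * 0) + real (k ^ 5) * 0 + 4 * 0"
      using k by (intro tendsto_intros u inv_np p_pow p_lim) auto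
    have "\<forall>\<^sub>F n in sequentially. real k ^ 2 * (((real n)\<^sup>2 * p n ^ k) * (1 / (real n * p n))) + real (k ^ 5) * p n ^ (k div 2) + 4 * p n
        = overlap_bound n k (p n)"
      using ev_ge_1
    proof eventually_elim
      case (elim n)
      have "p n ^ k = p n * p n ^ (k - 1)" using k by (simp flip: power_Suc)
      then have "((real n)\<^sup>2 * p n ^ k) * (1 / (real n * p n)) = real n * p n ^ (k - 1)"
        using p_pos[OF elim] elim by (simp add: power2_eq_square)
      then show ?case by (simp add: overlap_bound_def)
    qed
    from Lim_transform_eventually[OF lim this] have ob: "(\<lambda>n. overlap_bound n k (p n)) \<longlonglongrightarrow> 0"
      by simp
    have lim: "(\<lambda>n. real k ^ 4 * (((real n)\<^sup>2 * p n ^ k) * (1 / real n))) \<longlonglongrightarrow> real k ^ 4 * (u * 0)"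
      by (intro tendsto_intros u lim_1_over_n)
    have "\<forall>\<^sub>F n in sequentially. real k ^ 4 * (((real n)\<^sup>2 * p n ^ k) * (1 / real n)) = real (n * k ^ 4) * p n ^ k"
      using ev_ge_1 by eventually_elim (simp add: power2_eq_square)
    from Lim_transform_eventually[OF lim this]
    have "(\<lambda>n. real (n * k ^ 4) * p n ^ k) \<longlonglongrightarrow> 0" by simp
    from tendsto_add[OF tendsto_mult_left[OF tendsto_mult[OF Np ob], of 2] this]
    show "?e \<longlonglongrightarrow> 0" by simp
  qed
  ultimately have "(\<lambda>n. 1 - ((1 - H n k - (1 - p n ^ k) ^ N n k) + (1 - p n ^ k) ^ N n k)) \<longlonglongrightarrow> 1 - (0 + exp (- (c * u)))"
    by (intro tendsto_intros)
  then show ?thesis by simp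
qed

text \<open>The exponent r is real because the centerings of the case b = \<infinity> are not
  integers.\<close>

lemma n2pk_eq:
  assumes "1 \<le> n"
  shows "(real n)\<^sup>2 * p n powr r = exp (- ln (p n) * (2 * ln (real n) / - ln (p n) - r))"
proof -
  have "ln (p n) < 0" using p_pos[OF assms] p_less_1[OF assms] by simp
  then have "- ln (p n) * (2 * ln (real n) / - ln (p n) - r) = 2 * ln (real n) + r * ln (p n)"
    by (simp add: field_simps)
  moreover have "exp (2 * ln (real n)) = (real n)\<^sup>2"
    using assms by (simp add: exp_of_nat_mult[of 2, simplified])
  moreover have "exp (r * ln (p n)) = p n powr r" using p_pos[OF assms] by (simp add: powr_def)
  ultimately show ?thesis by (simp add: exp_add)
qed

lemma n2pk_eq_nat:
  assumes "1 \<le> n"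
  shows "(real n)\<^sup>2 * p n ^ k = exp (- ln (p n) * (2 * ln (real n) / - ln (p n) - real k))"
  using n2pk_eq[OF assms, of "real k"] p_pos[OF assms] by (simp add: powr_realpow)

lemma n2pk_at_top:
  assumes b: "(\<lambda>n. 2 * ln (real n) / - ln (p n)) \<longlonglongrightarrow> \<beta>" and "real k < \<beta>"
  shows "filterlim (\<lambda>n. (real n)\<^sup>2 * p n ^ k) at_top sequentially"
proof -
  have "(\<lambda>n. 2 * ln (real n) / - ln (p n) - real k) \<longlonglongrightarrow> \<beta> - real k"
    by (intro tendsto_intros b)
  then have "filterlim (\<lambda>n. exp (- ln (p n) * (2 * ln (real n) / - ln (p n) - real k))) at_top sequentially"
    using assms(2) by (intro filterlim_compose[OF exp_at_top] filterlim_at_top_mult_tendsto_pos[OF _ _ ln_p_lim]) auto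
  then show ?thesis
    by (rule filterlim_mono_eventually[OF _ order_refl order_refl])
       (use ev_ge_1 in \<open>eventually_elim, simp only: n2pk_eq_nat\<close>)
qed

lemma n2pk_at_0:
  assumes b: "(\<lambda>n. 2 * ln (real n) / - ln (p n)) \<longlonglongrightarrow> \<beta>" and "\<beta> < real k"
  shows "(\<lambda>n. (real n)\<^sup>2 * p n ^ k) \<longlonglongrightarrow> 0"
proof -
  have "(\<lambda>n. - (2 * ln (real n) / - ln (p n) - real k)) \<longlonglongrightarrow> - (\<beta> - real k)"
    by (intro tendsto_intros b)
  then have "filterlim (\<lambda>n. - ln (p n) * - (2 * ln (real n) / - ln (p n) - real k)) at_top sequentially"
    using assms(2) by (intro filterlim_at_top_mult_tendsto_pos[OF _ _ ln_p_lim]) auto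
  then have "filterlim (\<lambda>n. - (- ln (p n) * - (2 * ln (real n) / - ln (p n) - real k))) at_bot sequentially"
    by (simp only: filterlim_uminus_at_bot minus_minus)
  then have "(\<lambda>n. exp (- (- ln (p n) * - (2 * ln (real n) / - ln (p n) - real k)))) \<longlonglongrightarrow> 0"
    by (rule filterlim_compose[OF exp_at_bot])
  then show ?thesis
    by (rule Lim_transform_eventually) (use ev_ge_1 in \<open>eventually_elim, simp only: n2pk_eq_nat mult_minus_right minus_minus\<close>)
qed

text \<open>For b = 2 the length k = b is critical and the limit b alone does not decide the mean;
  n^2 p^2 = (n p)^2 does.\<close>

lemma n2p2_at_top: "filterlim (\<lambda>n. (real n)\<^sup>2 * p n ^ 2) at_top sequentially"
  using filterlim_at_top_mult_at_top[OF np_lim np_lim] by (simp add: power2_eq_square mult_ac)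

text \<open>Once 2 ln n / (- ln p) exceeds 4, p exceeds n^(-1/2), so n p >= sqrt n. Once - ln p >=
  1, the length is at most 2 ln n. Powers of ln n lose against sqrt n.\<close>

lemma H_tendsto_1_infinite:
  assumes b: "filterlim (\<lambda>n. 2 * ln (real n) / - ln (p n)) at_top sequentially"
    and \<kappa>: "\<forall>\<^sub>F n in sequentially. 2 \<le> \<kappa> n"
      "\<forall>\<^sub>F n in sequentially. real (\<kappa> n) \<le> 2 * ln (real n) / - ln (p n)"
    and large: "filterlim (\<lambda>n. real (N n (\<kappa> n)) * p n ^ \<kappa> n) at_top sequentially"
  shows "(\<lambda>n. H n (\<kappa> n)) \<longlonglongrightarrow> 1"
proof (rule H_tendsto_1[OF \<kappa>(1) _ large], rule Lim_null_comparison)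
  show "\<forall>\<^sub>F n in sequentially. norm (real (\<kappa> n) ^ 6 / (real n * p n)) \<le> (2 * ln (real n)) ^ 6 / sqrt (real n)"
    using ev_ge_1 \<kappa>(2) filterlim_at_top_dense[THEN iffD1, OF b, rule_format, of 4]
      filterlim_at_top_dense[THEN iffD1, OF ln_p_lim, rule_format, of 1]
  proof eventually_elim
    case (elim n)
    note pos = p_pos[OF elim(1)]
    have n: "1 \<le> real n" using elim(1) by simp
    have "2 * ln (real n) / - ln (p n) \<le> 2 * ln (real n) / 1"
      using elim(4) n by (intro divide_left_mono) auto
    then have \<kappa>: "real (\<kappa> n) \<le> 2 * ln (real n)" using elim(2) by simp
    have "- 4 * ln (p n) < 2 * ln (real n)" using elim(3,4) by (simp add: field_simps)
    then have "ln (sqrt (real n)) \<le> ln (real n * p n)"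
      using n pos by (simp add: ln_mult ln_sqrt)
    then have "sqrt (real n) \<le> real n * p n" using n pos by (subst (asm) ln_le_cancel_iff) auto
    then have "real (\<kappa> n) ^ 6 / (real n * p n) \<le> (2 * ln (real n)) ^ 6 / sqrt (real n)"
      using \<kappa> n pos by (intro frac_le power_mono) auto
    then show ?case using pos n by simp
  qed
  show "(\<lambda>n. (2 * ln (real n)) ^ 6 / sqrt (real n)) \<longlonglongrightarrow> 0" by real_asymp
qed

end

section \<open>Sizes of the good families relative to n^2\<close>

lemma card_good_aps_inter_ge_real:
  assumes "1 \<le> n" "2 \<le> k" "8 * k ^ 5 \<le> n"
  shows "(real n)\<^sup>2 / (16 * real k) \<le> real (card (good_aps n k \<inter> aps n k))"
proof -
  have "real (8 * k ^ 5) \<le> real n" using assms(3) by (simp only: of_nat_le_iff)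
  then have k: "2 \<le> real k" and nk: "8 * real k ^ 5 \<le> real n" using assms(2) by simp_all
  have "2 ^ 5 \<le> real k ^ 5" using k by (intro power_mono) auto
  then have n: "256 \<le> real n" using nk by simp
  have "n \<le> 2 * (n div 2) + 1" by linarith
  then have "real n \<le> real (2 * (n div 2) + 1)" by (simp only: of_nat_le_iff)
  then have d2: "real n / 4 \<le> real (n div 2)" using n by simp
  have "n < 2 * k * (n div (2 * k)) + 2 * k"
    using mult_div_mod_eq[of "2 * k" n] mod_less_divisor[of "2 * k" n] assms(2) by linarith
  then have "real n < real (2 * k * (n div (2 * k)) + 2 * k)" by (simp only: of_nat_less_iff)
  then have "real n < 2 * real k * real (n div (2 * k)) + 2 * real k" by (simp add: algebra_simps)
  then have dk: "real n / (2 * real k) - 1 \<le> real (n div (2 * k))" using k by (simp add: field_simps)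
  have "real k * 1 \<le> real k * real k ^ 4" using k by (intro mult_left_mono one_le_power) auto
  moreover have "real k ^ 5 = real k * real k ^ 4" by (simp add: eval_nat_numeral)
  ultimately have "4 * real k * (1 + real k ^ 4) \<le> 8 * real k ^ 5" by (simp add: algebra_simps)
  then have "1 + real k ^ 4 \<le> real n / (4 * real k)" using nk k by (simp add: field_simps)
  \<comment> \<open>The floor and the k^4 exceptional differences use up at most half of n / (2 k),
    since 4 k (1 + k^4) <= 8 k^5 <= n. With n div 2 >= n / 4 this produces the constant 16.\<close>
  then have "real n / (4 * real k) \<le> real n / (2 * real k) - 1 - real k ^ 4" using k by (simp add: field_simps)
  also have "\<dots> \<le> real (n div (2 * k)) - real (k ^ 4)" using dk by simp
  also have "\<dots> \<le> real (n div (2 * k) - k ^ 4)" by linarith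
  finally have "real n / 4 * (real n / (4 * real k)) \<le> real (n div 2) * real (n div (2 * k) - k ^ 4)"
    using d2 k n by (intro mult_mono) auto
  also have "\<dots> \<le> real (card (good_aps n k \<inter> aps n k))"
    using card_good_aps_inter_ge[OF assms(1,2)] by (simp only: of_nat_le_iff flip: of_nat_mult)
  finally show ?thesis by (simp add: power2_eq_square mult_ac)
qed

lemma half_pred_div:
  fixes n k :: nat
  shows "real n / 2 - 1 - real k ^ 4 \<le> real ((n - 1) div 2 - k ^ 4)"
proof -
  have "n \<le> 2 * ((n - 1) div 2) + 2" by linarith
  then have "real n \<le> real (2 * ((n - 1) div 2) + 2)" by (simp only: of_nat_le_iff)
  then have "real n / 2 - 1 \<le> real ((n - 1) div 2)" by simp
  moreover have "real ((n - 1) div 2) - real (k ^ 4) \<le> real ((n - 1) div 2 - k ^ 4)" by linarith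
  ultimately show ?thesis by simp
qed

lemma card_good_aps_ge_real:
  assumes "1 \<le> n"
  shows "real n * (real n / 2 - 1 - real k ^ 4) \<le> real (card (good_aps n k))"
proof -
  have "real n * (real n / 2 - 1 - real k ^ 4) \<le> real n * real ((n - 1) div 2 - k ^ 4)"
    by (intro mult_left_mono half_pred_div) auto
  also have "\<dots> \<le> real (card (good_aps n k))"
    using card_good_aps_ge[OF assms, of k] by (simp only: of_nat_le_iff flip: of_nat_mult)
  finally show ?thesis .
qed

text \<open>Modulo n no factor 1 / k is lost, which is why the centering for
  \<open>longest_ap_mod\<close> needs no ln ln n term.\<close>

lemma card_good_aps_ge_quarter:
  assumes "1 \<le> n" "2 \<le> k" "8 * k ^ 5 \<le> n"
  shows "(real n)\<^sup>2 / 4 \<le> real (card (good_aps n k))"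
proof -
  have "real (8 * k ^ 5) \<le> real n" using assms(3) by (simp only: of_nat_le_iff)
  then have k: "2 \<le> real k" and nk: "8 * real k ^ 5 \<le> real n" using assms(2) by simp_all
  have "1 \<le> real k ^ 4" using k by (intro one_le_power) auto
  moreover have "2 * real k ^ 4 \<le> real k ^ 5" using k by (simp add: eval_nat_numeral mult_right_mono)
  ultimately have "1 + real k ^ 4 \<le> real n / 4" using nk by simp
  then have "real n * (real n / 4) \<le> real n * (real n / 2 - 1 - real k ^ 4)" by (intro mult_left_mono) auto
  then show ?thesis using card_good_aps_ge_real[OF assms(1), of k] by (simp add: power2_eq_square)
qed

lemma card_good_aps_ratio: "(\<lambda>n. real (card (good_aps n k)) / (real n)\<^sup>2) \<longlonglongrightarrow> 1 / 2"
proof (rule tendsto_sandwich[OF _ _ _ tendsto_const])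
  show "\<forall>\<^sub>F n in sequentially. 1 / 2 - (1 + real k ^ 4) / real n \<le> real (card (good_aps n k)) / (real n)\<^sup>2"
    using eventually_ge_at_top[of 1]
  proof eventually_elim
    case (elim n)
    then have "1 / 2 - (1 + real k ^ 4) / real n = real n * (real n / 2 - 1 - real k ^ 4) / (real n)\<^sup>2"
      by (simp add: field_simps power2_eq_square)
    also have "\<dots> \<le> real (card (good_aps n k)) / (real n)\<^sup>2"
      by (intro divide_right_mono card_good_aps_ge_real elim) auto
    finally show ?case .
  qed
  show "\<forall>\<^sub>F n in sequentially. real (card (good_aps n k)) / (real n)\<^sup>2 \<le> 1 / 2"
    using eventually_ge_at_top[of 1]
  proof eventually_elim
    case (elim n)
    have "2 * card (good_aps n k) \<le> n * (2 * ((n - 1) div 2))" using card_good_aps_le[of n k] by simp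
    also have "\<dots> \<le> n * n" by (intro mult_left_mono) auto
    finally have "real (2 * card (good_aps n k)) \<le> real (n * n)" by (simp only: of_nat_le_iff)
    then show ?case using elim by (simp add: field_simps power2_eq_square)
  qed
  show "(\<lambda>n. 1 / 2 - (1 + real k ^ 4) / real n) \<longlonglongrightarrow> 1 / 2"
    using tendsto_diff[OF tendsto_const lim_const_over_n[of "1 + real k ^ 4"], of "1 / 2"] by simp
qed

lemma div_ratio:
  assumes "1 \<le> d"
  shows "(\<lambda>n. real ((n - 1) div d) / real n) \<longlonglongrightarrow> 1 / real d"
proof (rule tendsto_sandwich[OF _ _ _ tendsto_const])
  show "\<forall>\<^sub>F n in sequentially. 1 / real d - 1 / real n \<le> real ((n - 1) div d) / real n"
    using eventually_ge_at_top[of 1]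
  proof eventually_elim
    case (elim n)
    have "n - 1 < d * ((n - 1) div d) + d"
      using mult_div_mod_eq[of d "n - 1"] mod_less_divisor[of d "n - 1"] assms by linarith
    then have "n \<le> d * ((n - 1) div d) + d" by linarith
    then have "real n \<le> real (d * ((n - 1) div d) + d)" by (simp only: of_nat_le_iff)
    then have "real n / real d - 1 \<le> real ((n - 1) div d)" using assms by (simp add: field_simps)
    then have "(real n / real d - 1) / real n \<le> real ((n - 1) div d) / real n"
      by (rule divide_right_mono) simp
    then show ?case using elim by (simp add: diff_divide_distrib)
  qed
  show "\<forall>\<^sub>F n in sequentially. real ((n - 1) div d) / real n \<le> 1 / real d"
    using eventually_ge_at_top[of 1]
  proof eventually_elim
    case (elim n)
    have "d * ((n - 1) div d) \<le> n" by (rule order_trans[OF times_div_less_eq_dividend]) simp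
    then have "real (d * ((n - 1) div d)) \<le> real n" by (simp only: of_nat_le_iff)
    then show ?case using assms elim by (simp add: field_simps)
  qed
  show "(\<lambda>n. 1 / real d - 1 / real n) \<longlonglongrightarrow> 1 / real d"
    using tendsto_diff[OF tendsto_const lim_1_over_n, of "1 / real d"] by simp
qed

text \<open>With m close to n / (k - 1), the arithmetic series n m - (k - 1) m (m + 1) / 2 is about
  half of n^2 / (k - 1).\<close>

lemma card_aps_ratio:
  assumes "2 \<le> k"
  shows "(\<lambda>n. real (card (aps n k)) / (real n)\<^sup>2) \<longlonglongrightarrow> 1 / (2 * real (k - 1))"
proof -
  let ?m = "\<lambda>n. real ((n - 1) div (k - 1)) / real n"
  have m: "?m \<longlonglongrightarrow> 1 / real (k - 1)" using assms by (intro div_ratio) auto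
  have lim: "(\<lambda>n. ?m n - real (k - 1) * (?m n * (?m n + 1 / real n) / 2))
      \<longlonglongrightarrow> 1 / real (k - 1) - real (k - 1) * (1 / real (k - 1) * (1 / real (k - 1) + 0) / 2)"
    by (intro tendsto_intros m lim_1_over_n) auto
  have "\<forall>\<^sub>F n in sequentially. ?m n - real (k - 1) * (?m n * (?m n + 1 / real n) / 2)
      = real (card (aps n k)) / (real n)\<^sup>2"
    using eventually_ge_at_top[of 1]
  proof eventually_elim
    case (elim n)
    then show ?case unfolding real_card_aps[OF assms] by (simp add: field_simps power2_eq_square)
  qed
  moreover have "1 / d - d * (1 / d * (1 / d + 0) / 2) = 1 / (2 * d)" if "d \<noteq> 0" for d :: real
    using that by (simp add: field_simps)
  from this[of "real (k - 1)"]
  have "1 / real (k - 1) - real (k - 1) * (1 / real (k - 1) * (1 / real (k - 1) + 0) / 2) = 1 / (2 * real (k - 1))"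
    using assms by simp
  ultimately show ?thesis using Lim_transform_eventually[OF lim] by (simp only:)
qed

lemma card_good_aps_inter_ratio:
  assumes "3 \<le> k"
  shows "(\<lambda>n. real (card (good_aps n k \<inter> aps n k)) / (real n)\<^sup>2) \<longlonglongrightarrow> 1 / (2 * real (k - 1))"
proof (rule tendsto_sandwich)
  have k: "2 \<le> k" using assms by simp
  show "\<forall>\<^sub>F n in sequentially. real (card (aps n k)) / (real n)\<^sup>2 - real k ^ 4 / real n
      \<le> real (card (good_aps n k \<inter> aps n k)) / (real n)\<^sup>2"
    using eventually_ge_at_top[of 1]
  proof eventually_elim
    case (elim n)
    have "real (card (aps n k)) \<le> real (card (good_aps n k \<inter> aps n k) + n * k ^ 4)"
      using card_good_aps_inter_approx[OF elim assms] by (simp only: of_nat_le_iff)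
    then have "(real (card (aps n k)) - real n * real k ^ 4) / (real n)\<^sup>2
        \<le> real (card (good_aps n k \<inter> aps n k)) / (real n)\<^sup>2"
      by (intro divide_right_mono) auto
    then show ?case using elim by (simp add: diff_divide_distrib power2_eq_square)
  qed
  show "\<forall>\<^sub>F n in sequentially. real (card (good_aps n k \<inter> aps n k)) / (real n)\<^sup>2
      \<le> real (card (aps n k)) / (real n)\<^sup>2"
    by (intro always_eventually allI divide_right_mono) (auto intro!: card_mono finite_aps)
  show "(\<lambda>n. real (card (aps n k)) / (real n)\<^sup>2) \<longlonglongrightarrow> 1 / (2 * real (k - 1))"
    by (rule card_aps_ratio[OF k])
  have "(\<lambda>n. real (card (aps n k)) / (real n)\<^sup>2 - real k ^ 4 * (1 / real n)) \<longlonglongrightarrow> 1 / (2 * real (k - 1)) - real k ^ 4 * 0"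
    by (intro tendsto_intros card_aps_ratio[OF k] lim_1_over_n)
  then show "(\<lambda>n. real (card (aps n k)) / (real n)\<^sup>2 - real k ^ 4 / real n) \<longlonglongrightarrow> 1 / (2 * real (k - 1))"
    by simp
qed

section \<open>Limit laws for a statistic with these tails\<close>

lemma (in prob_space) prob_between:
  fixes L :: "'a \<Rightarrow> nat"
  assumes "{\<omega>\<in>space M. a \<le> L \<omega>} \<in> events" "{\<omega>\<in>space M. b \<le> L \<omega>} \<in> events" "a \<le> b"
  shows "prob {\<omega>\<in>space M. a \<le> L \<omega> \<and> L \<omega> < b} = prob {\<omega>\<in>space M. a \<le> L \<omega>} - prob {\<omega>\<in>space M. b \<le> L \<omega>}"
proof -
  have "{\<omega>\<in>space M. a \<le> L \<omega> \<and> L \<omega> < b} = {\<omega>\<in>space M. a \<le> L \<omega>} - {\<omega>\<in>space M. b \<le> L \<omega>}"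
    by auto
  also have "prob \<dots> = prob {\<omega>\<in>space M. a \<le> L \<omega>} - prob {\<omega>\<in>space M. b \<le> L \<omega>}"
    using assms by (intro finite_measure_Diff) auto
  finally show ?thesis .
qed

text \<open>The assumption \<open>between\<close> replaces measurability of \<open>L\<close>. It is
  restricted to n >= 1 because nothing is known about the space with index 0, and to a >= 1 to match
  the tail events.\<close>

locale ap_statistic =
  fixes M :: "nat \<Rightarrow> 'a measure" and p :: "nat \<Rightarrow> real" and N :: "nat \<Rightarrow> nat \<Rightarrow> nat"
    and L :: "nat \<Rightarrow> 'a \<Rightarrow> nat"
  assumes tails: "ap_tails p (\<lambda>n k. measure (M n) {\<omega>\<in>space (M n). k \<le> L n \<omega>}) N"
    and between: "\<And>n a b. 1 \<le> n \<Longrightarrow> 1 \<le> a \<Longrightarrow> a \<le> b \<Longrightarrow>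
      measure (M n) {\<omega>\<in>space (M n). a \<le> L n \<omega> \<and> L n \<omega> < b}
        = measure (M n) {\<omega>\<in>space (M n). a \<le> L n \<omega>} - measure (M n) {\<omega>\<in>space (M n). b \<le> L n \<omega>}"
begin

definition H :: "nat \<Rightarrow> nat \<Rightarrow> real" where
  "H n k = measure (M n) {\<omega>\<in>space (M n). k \<le> L n \<omega>}"

sublocale ap_tails p H N
  using tails by (simp add: H_def[abs_def])

text \<open>The event has to agree with the window only eventually: integer windows given by floors
  become natural-number windows for large n.\<close>

lemma prob_window:
  assumes a: "\<forall>\<^sub>F n in sequentially. 1 \<le> a n"
    and lim: "(\<lambda>n. H n (a n)) \<longlonglongrightarrow> x" "(\<lambda>n. H n (a n + d)) \<longlonglongrightarrow> y"
    and R: "\<forall>\<^sub>F n in sequentially. \<forall>\<omega>. R n \<omega> \<longleftrightarrow> a n \<le> L n \<omega> \<and> L n \<omega> < a n + d"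
  shows "(\<lambda>n. \<P>(\<omega> in M n. R n \<omega>)) \<longlonglongrightarrow> x - y"
proof (rule Lim_transform_eventually[OF tendsto_diff[OF lim]])
  show "\<forall>\<^sub>F n in sequentially. H n (a n) - H n (a n + d) = \<P>(\<omega> in M n. R n \<omega>)"
    using ev_ge_1 a R
  proof eventually_elim
    case (elim n)
    then show ?case using between[of n "a n" "a n + d"] by (simp add: H_def)
  qed
qed

lemma prob_eq_fixed:
  assumes "1 \<le> k" "(\<lambda>n. H n k) \<longlonglongrightarrow> x" "(\<lambda>n. H n (k + 1)) \<longlonglongrightarrow> y"
  shows "(\<lambda>n. \<P>(\<omega> in M n. L n \<omega> = k)) \<longlonglongrightarrow> x - y"
  using assms by (intro prob_window[where a = "\<lambda>_. k" and d = 1] always_eventually allI) auto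

context
  fixes \<beta> :: real
  assumes b: "(\<lambda>n. 2 * ln (real n) / - ln (p n)) \<longlonglongrightarrow> \<beta>"
begin

text \<open>With k the floor of \<beta>, length k + 1 lies beyond \<beta> and has vanishing mean.
  Length k lies strictly below \<beta>, except for \<beta> = 2, where n p -> \<infinity> makes the
  mean diverge.\<close>

lemma concentration_nonint:
  assumes "\<beta> = 2 \<or> 2 < \<beta> \<and> \<beta> \<notin> \<int>"
  shows "(\<lambda>n. \<P>(\<omega> in M n. int (L n \<omega>) = \<lfloor>\<beta>\<rfloor>)) \<longlonglongrightarrow> 1"
proof -
  define k where "k = nat \<lfloor>\<beta>\<rfloor>"
  have fl: "\<lfloor>\<beta>\<rfloor> = int k" "2 \<le> k" using assms by (auto simp: k_def le_nat_iff le_floor_iff)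
  have "\<beta> < real (k + 1)" using floor_correct[of \<beta>] fl by simp
  then have "(\<lambda>n. H n (k + 1)) \<longlonglongrightarrow> 0"
    using fl by (intro H_fixed_tendsto_0 n2pk_at_0[OF b]) auto
  moreover have "(\<lambda>n. H n k) \<longlonglongrightarrow> 1"
  proof (cases "\<beta> = 2")
    case True
    then have "k = 2" by (simp add: k_def)
    then show ?thesis using H_fixed_tendsto_1[OF _ n2p2_at_top] by simp
  next
    case False
    then have "real k \<noteq> \<beta>" using assms by (metis Ints_of_nat)
    then have "real k < \<beta>" using of_int_floor_le[of \<beta>] fl by simp
    then show ?thesis using fl by (intro H_fixed_tendsto_1 n2pk_at_top[OF b]) auto
  qed
  ultimately have "(\<lambda>n. \<P>(\<omega> in M n. L n \<omega> = k)) \<longlonglongrightarrow> 1 - 0"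
    using fl by (intro prob_eq_fixed) auto
  then show ?thesis using fl by simp
qed

context
  fixes k :: nat
  assumes \<beta>: "\<beta> = real k" and k: "3 \<le> k"
begin

lemma H_pred_tendsto_1: "(\<lambda>n. H n (k - 1)) \<longlonglongrightarrow> 1"
  using k \<beta> by (intro H_fixed_tendsto_1 n2pk_at_top[OF b]) auto

lemma H_Suc_tendsto_0: "(\<lambda>n. H n (k + 1)) \<longlonglongrightarrow> 0"
  using k \<beta> by (intro H_fixed_tendsto_0 n2pk_at_0[OF b]) auto

lemma concentration_int: "(\<lambda>n. \<P>(\<omega> in M n. L n \<omega> \<in> {k, k - 1})) \<longlonglongrightarrow> 1"
proof -
  have "k - 1 + 2 = k + 1" using k by simp
  then have "(\<lambda>n. \<P>(\<omega> in M n. L n \<omega> \<in> {k, k - 1})) \<longlonglongrightarrow> 1 - 0"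
    using k H_pred_tendsto_1 H_Suc_tendsto_0
    by (intro prob_window[where a = "\<lambda>_. k - 1" and d = 2] always_eventually allI) auto
  then show ?thesis by simp
qed

text \<open>Lengths k - 1 and k + 1 are decided, so the limit of \<open>H n k\<close> alone splits
  the mass. It is 1 - exp (- u / d) for finite u, where 1 / d is the density of the family, and 1
  for u = \<infinity>.\<close>

lemma two_point_limit:
  assumes u: "(\<lambda>n. ereal ((real n)\<^sup>2 * p n ^ k)) \<longlonglongrightarrow> u"
    and d: "0 < d" "(\<lambda>n. real (N n k) / (real n)\<^sup>2) \<longlonglongrightarrow> 1 / d"
  shows "(\<lambda>n. ereal \<P>(\<omega> in M n. L n \<omega> = k - 1)) \<longlonglongrightarrow> exp_ereal (- (u / ereal d))"
    and "(\<lambda>n. ereal \<P>(\<omega> in M n. L n \<omega> = k)) \<longlonglongrightarrow> 1 - exp_ereal (- (u / ereal d))"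
proof -
  have "\<forall>\<^sub>F n in sequentially. 0 \<le> ereal ((real n)\<^sup>2 * p n ^ k)"
    using ev_ge_1 by eventually_elim (use p_pos in \<open>auto intro: less_imp_le\<close>)
  then have u0: "0 \<le> u" using u by (intro tendsto_lowerbound) auto
  have "\<exists>q. exp_ereal (- (u / ereal d)) = ereal q \<and> (\<lambda>n. H n k) \<longlonglongrightarrow> 1 - q"
  proof (cases u)
    case (real r)
    have "(\<lambda>n. H n k) \<longlonglongrightarrow> 1 - exp (- (1 / d * r))"
      using u real by (intro H_fixed_Poisson k d(2)) auto
    then show ?thesis using real d(1) by (intro exI[of _ "exp (- (r / d))"]) (simp add: exp_ereal_def)
  next
    case PInf
    have "(\<lambda>n. H n k) \<longlonglongrightarrow> 1"
      using u PInf k by (intro H_fixed_tendsto_1) (auto simp: tendsto_PInfty_eq_at_top)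
    \<comment> \<open>The quotient is again \<infinity>, and \<open>exp_ereal\<close> maps its
      negative to 0.\<close>
    moreover have "exp_ereal (- (u / ereal d)) = ereal 0"
      using PInf d(1) by (simp add: exp_ereal_def flip: MInfty_eq_minfinity)
    ultimately show ?thesis by auto
  next
    case MInf
    then show ?thesis using u0 by simp
  qed
  then obtain q where q: "exp_ereal (- (u / ereal d)) = ereal q" "(\<lambda>n. H n k) \<longlonglongrightarrow> 1 - q" by blast
  have "(\<lambda>n. \<P>(\<omega> in M n. L n \<omega> = k - 1)) \<longlonglongrightarrow> 1 - (1 - q)"
    using k H_pred_tendsto_1 q(2) by (intro prob_eq_fixed) auto
  then show "(\<lambda>n. ereal \<P>(\<omega> in M n. L n \<omega> = k - 1)) \<longlonglongrightarrow> exp_ereal (- (u / ereal d))"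
    unfolding q(1) by simp
  have "(\<lambda>n. \<P>(\<omega> in M n. L n \<omega> = k)) \<longlonglongrightarrow> 1 - q - 0"
    using k H_Suc_tendsto_0 q(2) by (intro prob_eq_fixed) auto
  then show "(\<lambda>n. ereal \<P>(\<omega> in M n. L n \<omega> = k)) \<longlonglongrightarrow> 1 - exp_ereal (- (u / ereal d))"
    unfolding q(1) one_ereal_def by simp
qed

end

end

context
  assumes b: "filterlim (\<lambda>n. 2 * ln (real n) / - ln (p n)) at_top sequentially"
begin

lemma ev_b_ge: "\<forall>\<^sub>F n in sequentially. c \<le> 2 * ln (real n) / - ln (p n)"
  using b by (simp add: filterlim_at_top)

lemma ev_ln_p_ge: "\<forall>\<^sub>F n in sequentially. c \<le> - ln (p n)"
  using ln_p_lim by (simp only: filterlim_at_top)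

text \<open>Growing lengths are at most 2 ln n eventually, so they stay within the range where the
  counting bounds hold.\<close>

lemma ev_small_power:
  assumes "\<forall>\<^sub>F n in sequentially. real (\<kappa> n) \<le> 2 * ln (real n) / - ln (p n)"
  shows "\<forall>\<^sub>F n in sequentially. 8 * \<kappa> n ^ 5 \<le> n"
proof -
  have "\<forall>\<^sub>F n in sequentially. 8 * (2 * ln (real n)) ^ 5 \<le> real n" by real_asymp
  with ev_ge_1 ev_ln_p_ge[of 1] assms show ?thesis
  proof eventually_elim
    case (elim n)
    have "2 * ln (real n) / - ln (p n) \<le> 2 * ln (real n) / 1"
      using elim by (intro divide_left_mono) auto
    then have "real (\<kappa> n) \<le> 2 * ln (real n)" using elim(3) by simp
    then have "8 * real (\<kappa> n) ^ 5 \<le> 8 * (2 * ln (real n)) ^ 5" by (intro mult_left_mono power_mono) auto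
    then have "real (8 * \<kappa> n ^ 5) \<le> real n" using elim(4) by simp
    then show ?case by (simp only: of_nat_le_iff)
  qed
qed

text \<open>The term \<open>ln (ln n) / ln p\<close> in the centering absorbs the factor of order \<open>1 / k\<close>
  that the number of progressions inside the interval loses against \<open>n ^ 2\<close>.\<close>

lemma concentration_infinite_shifted:
  assumes sharp: "\<And>n k. 1 \<le> n \<Longrightarrow> 2 \<le> k \<Longrightarrow> H n k \<le> (real n)\<^sup>2 * p n ^ k / real (k - 1)"
  defines "x \<equiv> \<lambda>n. 2 * ln (real n) / - ln (p n) + ln (ln (real n)) / ln (p n)"
  shows "(\<lambda>n. \<P>(\<omega> in M n. int (L n \<omega>) \<in> {\<lfloor>x n\<rfloor>, \<lfloor>x n\<rfloor> + 1})) \<longlonglongrightarrow> 1"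
proof -
  define \<kappa> where "\<kappa> n = nat \<lfloor>x n\<rfloor>" for n
  have ev: "\<forall>\<^sub>F n in sequentially. 1 \<le> n \<and> 1 \<le> - ln (p n) \<and> 1 \<le> ln (real n)
      \<and> ln (real n) / - ln (p n) \<le> x n \<and> x n \<le> 2 * ln (real n) / - ln (p n) \<and> 4 \<le> x n
      \<and> (real n)\<^sup>2 * p n powr (x n) = ln (real n)
      \<and> (real n)\<^sup>2 * p n powr (x n + 1) = ln (real n) * exp (ln (p n))"
  proof -
    have "\<forall>\<^sub>F n in sequentially. 1 \<le> ln (real n)" by real_asymp
    \<comment> \<open>The center \<open>x n\<close> is at least half of 2 ln n / (- ln p), because
      ln ln n <= ln n; hence 8 leads to 4 <= \<open>x n\<close>.\<close>
    with ev_ge_1 ev_ln_p_ge[of 1] ev_b_ge[of 8] show ?thesis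
    proof eventually_elim
      case (elim n)
      let ?l = "- ln (p n)"
      have l: "0 < ?l" "1 \<le> ?l" using elim(2) by auto
      have lnn: "1 \<le> ln (real n)" using elim(4) .
      have ll: "0 \<le> ln (ln (real n))" "ln (ln (real n)) \<le> ln (real n)"
        using lnn ln_le_minus_one[of "ln (real n)"] by auto
      have x: "x n = (2 * ln (real n) - ln (ln (real n))) / ?l"
        using l by (simp add: x_def field_simps)
      have x1: "ln (real n) / ?l \<le> x n" unfolding x using l ll by (intro divide_right_mono) auto
      have x2: "x n \<le> 2 * ln (real n) / ?l" unfolding x using l ll by (intro divide_right_mono) auto
      have x4: "4 \<le> x n" using x1 elim(3) by simp
      \<comment> \<open>The shift is chosen so that n^2 p^x equals ln n exactly.\<close>
      have e: "?l * (2 * ln (real n) / ?l - x n) = ln (ln (real n))"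
        unfolding x using l by (simp add: field_simps)
      have p1: "(real n)\<^sup>2 * p n powr (x n) = ln (real n)"
        unfolding n2pk_eq[OF elim(1)] e using lnn by simp
      have "?l * (2 * ln (real n) / ?l - (x n + 1)) = ln (ln (real n)) + ln (p n)"
        using e by (simp add: algebra_simps)
      then have p2: "(real n)\<^sup>2 * p n powr (x n + 1) = ln (real n) * exp (ln (p n))"
        unfolding n2pk_eq[OF elim(1)] using lnn by (simp add: exp_add)
      show ?case using elim(1) l lnn x1 x2 x4 p1 p2 by blast
    qed
  qed
  have \<kappa>: "\<forall>\<^sub>F n in sequentially. 1 \<le> n \<and> 4 \<le> \<kappa> n \<and> \<lfloor>x n\<rfloor> = int (\<kappa> n) \<and> real (\<kappa> n) \<le> x n \<and> x n < real (\<kappa> n) + 1"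
    using ev
  proof eventually_elim
    case (elim n)
    have "4 \<le> \<lfloor>x n\<rfloor>" using elim by (simp add: le_floor_iff)
    moreover from this have "\<lfloor>x n\<rfloor> = int (\<kappa> n)" by (simp add: \<kappa>_def)
    ultimately show ?case using elim floor_correct[of "x n"] by simp
  qed
  have \<kappa>2: "\<forall>\<^sub>F n in sequentially. real (\<kappa> n) \<le> 2 * ln (real n) / - ln (p n)"
    using ev \<kappa> by eventually_elim linarith
  have lim1: "(\<lambda>n. H n (\<kappa> n)) \<longlonglongrightarrow> 1"
  proof (rule H_tendsto_1_infinite[OF b _ \<kappa>2])
    show "\<forall>\<^sub>F n in sequentially. 2 \<le> \<kappa> n" using \<kappa> by eventually_elim simp
    have "filterlim (\<lambda>n. 1 / 32 * - ln (p n)) at_top sequentially"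
      by (rule filterlim_tendsto_pos_mult_at_top[OF tendsto_const _ ln_p_lim]) simp
    then show "filterlim (\<lambda>n. real (N n (\<kappa> n)) * p n ^ \<kappa> n) at_top sequentially"
    proof (rule filterlim_at_top_mono)
      show "\<forall>\<^sub>F n in sequentially. 1 / 32 * - ln (p n) \<le> real (N n (\<kappa> n)) * p n ^ \<kappa> n"
        using ev \<kappa> \<kappa>2 ev_small_power[OF \<kappa>2]
      proof eventually_elim
        case (elim n)
        have pos: "0 < p n" "p n < 1" using p_pos p_less_1 elim by auto
        have l: "0 < - ln (p n)" using elim by simp
        have k: "0 < real (\<kappa> n)" using elim by simp
        \<comment> \<open>The mean is at least ln n / (16 \<kappa>), and \<kappa> <= 2 ln n / (- ln
          p) turns this into - ln p / 32, which diverges.\<close>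
        have "real (\<kappa> n) * - ln (p n) \<le> 2 * ln (real n)" by (rule iffD1[OF pos_le_divide_eq[OF l] elim(3)])
        then have "1 / 32 * - ln (p n) \<le> ln (real n) / (16 * real (\<kappa> n))"
          using k by (simp add: field_simps)
        also have "ln (real n) = (real n)\<^sup>2 * p n powr (x n)" using elim by simp
        also have "(real n)\<^sup>2 * p n powr (x n) / (16 * real (\<kappa> n)) \<le> (real n)\<^sup>2 * p n powr (real (\<kappa> n)) / (16 * real (\<kappa> n))"
          using elim pos k by (intro divide_right_mono mult_left_mono powr_mono') auto
        also have "\<dots> = (real n)\<^sup>2 / (16 * real (\<kappa> n)) * p n ^ \<kappa> n" using pos by (simp add: powr_realpow)
        also have "\<dots> \<le> real (N n (\<kappa> n)) * p n ^ \<kappa> n"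
          using elim pos by (intro mult_right_mono N_ge) auto
        finally show ?case .
      qed
    qed
  qed
  have lim0: "(\<lambda>n. H n (\<kappa> n + 2)) \<longlonglongrightarrow> 0"
  proof (rule Lim_null_comparison)
    show "\<forall>\<^sub>F n in sequentially. norm (H n (\<kappa> n + 2)) \<le> - ln (p n) * exp (- (- ln (p n)))"
      using ev \<kappa>
    proof eventually_elim
      case (elim n)
      have pos: "0 < p n" "p n < 1" using p_pos p_less_1 elim by auto
      have l: "0 < - ln (p n)" using elim by simp
      \<comment> \<open>As \<kappa> + 2 exceeds x + 1 and \<kappa> + 1 exceeds x, the bound is at
        most p ln n / x. With x >= ln n / (- ln p) it shrinks to p (- ln p), which vanishes.\<close>
      have "H n (\<kappa> n + 2) \<le> (real n)\<^sup>2 * p n ^ (\<kappa> n + 2) / real (\<kappa> n + 2 - 1)"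
        using elim by (intro sharp) auto
      also have "p n ^ (\<kappa> n + 2) = p n powr real (\<kappa> n + 2)" using pos by (simp only: powr_realpow)
      also have "(real n)\<^sup>2 * p n powr real (\<kappa> n + 2) / real (\<kappa> n + 2 - 1) \<le> (real n)\<^sup>2 * p n powr (x n + 1) / x n"
        using elim pos by (intro frac_le mult_left_mono powr_mono') auto
      also have "\<dots> = ln (real n) * exp (ln (p n)) / x n" using elim by simp
      also have "\<dots> \<le> ln (real n) * exp (ln (p n)) / (ln (real n) / - ln (p n))"
      proof (rule divide_left_mono)
        have lnn: "0 < ln (real n)" using elim by linarith
        show "ln (real n) / - ln (p n) \<le> x n" using elim by blast
        show "0 \<le> ln (real n) * exp (ln (p n))" using lnn by simp
        have "0 < x n" using elim by linarith
        then show "0 < x n * (ln (real n) / - ln (p n))" by (intro mult_pos_pos divide_pos_pos lnn l)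
      qed
      also have "\<dots> = - ln (p n) * exp (- (- ln (p n)))"
      proof -
        have "a * e / (a / c) = c * e" if "0 < a" for a c e :: real using that by simp
        moreover have "0 < ln (real n)" using elim by linarith
        ultimately show ?thesis unfolding minus_minus by blast
      qed
      finally show ?case using H_nonneg elim by simp
    qed
    have "((\<lambda>l :: real. l * exp (- l)) \<longlongrightarrow> 0) at_top" by real_asymp
    then show "(\<lambda>n. - ln (p n) * exp (- (- ln (p n)))) \<longlonglongrightarrow> 0" by (rule filterlim_compose[OF _ ln_p_lim])
  qed
  have "(\<lambda>n. \<P>(\<omega> in M n. int (L n \<omega>) \<in> {\<lfloor>x n\<rfloor>, \<lfloor>x n\<rfloor> + 1})) \<longlonglongrightarrow> 1 - 0"
  proof (rule prob_window[OF _ lim1 lim0])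
    show "\<forall>\<^sub>F n in sequentially. 1 \<le> \<kappa> n" using \<kappa> by eventually_elim simp
    show "\<forall>\<^sub>F n in sequentially. \<forall>\<omega>. (int (L n \<omega>) \<in> {\<lfloor>x n\<rfloor>, \<lfloor>x n\<rfloor> + 1}) = (\<kappa> n \<le> L n \<omega> \<and> L n \<omega> < \<kappa> n + 2)"
      using \<kappa> by eventually_elim auto
  qed
  then show ?thesis by simp
qed

text \<open>Here n^2 p^x = 1. One less than the floor of x is at most x - 1 and has mean at least 1
  / (4 p); two more than the floor exceeds x + 1 and has probability at most p. The means in between
  are not controlled, so three values remain.\<close>

lemma concentration_infinite_plain:
  assumes many: "\<And>n k. 1 \<le> n \<Longrightarrow> 2 \<le> k \<Longrightarrow> 8 * k ^ 5 \<le> n \<Longrightarrow> (real n)\<^sup>2 / 4 \<le> real (N n k)"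
  defines "x \<equiv> \<lambda>n. 2 * ln (real n) / - ln (p n)"
  shows "(\<lambda>n. \<P>(\<omega> in M n. int (L n \<omega>) \<in> {\<lfloor>x n\<rfloor> - 1, \<lfloor>x n\<rfloor>, \<lfloor>x n\<rfloor> + 1})) \<longlonglongrightarrow> 1"
proof -
  define \<kappa> where "\<kappa> n = nat (\<lfloor>x n\<rfloor> - 1)" for n
  have \<kappa>: "\<forall>\<^sub>F n in sequentially. 1 \<le> n \<and> 3 \<le> \<kappa> n \<and> \<lfloor>x n\<rfloor> = int (\<kappa> n) + 1
      \<and> real (\<kappa> n) \<le> x n - 1 \<and> x n < real (\<kappa> n) + 2"
    using ev_ge_1 ev_b_ge[of 4]
  proof eventually_elim
    case (elim n)
    have "4 \<le> \<lfloor>x n\<rfloor>" using elim(2) by (simp add: le_floor_iff x_def)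
    moreover from this have "\<lfloor>x n\<rfloor> = int (\<kappa> n) + 1" by (simp add: \<kappa>_def)
    ultimately show ?case using elim(1) floor_correct[of "x n"] by simp
  qed
  have \<kappa>2: "\<forall>\<^sub>F n in sequentially. real (\<kappa> n) \<le> 2 * ln (real n) / - ln (p n)"
    using \<kappa> by eventually_elim (simp add: x_def)
  have powr_x: "(real n)\<^sup>2 * p n powr (x n + r) = exp (ln (p n) * r)" if "1 \<le> n" for n r
    using n2pk_eq[OF that, of "x n + r"] by (simp add: x_def)
  have lim1: "(\<lambda>n. H n (\<kappa> n)) \<longlonglongrightarrow> 1"
  proof (rule H_tendsto_1_infinite[OF b _ \<kappa>2])
    show "\<forall>\<^sub>F n in sequentially. 2 \<le> \<kappa> n" using \<kappa> by eventually_elim simp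
    have "filterlim (\<lambda>l :: real. 1 / 4 * exp l) at_top at_top" by real_asymp
    then have "filterlim (\<lambda>n. 1 / 4 * exp (- ln (p n))) at_top sequentially"
      by (rule filterlim_compose[OF _ ln_p_lim])
    then show "filterlim (\<lambda>n. real (N n (\<kappa> n)) * p n ^ \<kappa> n) at_top sequentially"
    proof (rule filterlim_at_top_mono)
      show "\<forall>\<^sub>F n in sequentially. 1 / 4 * exp (- ln (p n)) \<le> real (N n (\<kappa> n)) * p n ^ \<kappa> n"
        using \<kappa> ev_small_power[OF \<kappa>2]
      proof eventually_elim
        case (elim n)
        have pos: "0 < p n" "p n < 1" using p_pos p_less_1 elim by auto
        have "1 / 4 * exp (- ln (p n)) = 1 / 4 * ((real n)\<^sup>2 * p n powr (x n + - 1))"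
          using elim by (subst powr_x) auto
        also have "\<dots> \<le> 1 / 4 * ((real n)\<^sup>2 * p n powr (real (\<kappa> n)))"
          using elim pos by (intro mult_left_mono powr_mono') auto
        also have "\<dots> = (real n)\<^sup>2 / 4 * p n ^ \<kappa> n" using pos by (simp add: powr_realpow)
        also have "\<dots> \<le> real (N n (\<kappa> n)) * p n ^ \<kappa> n"
          using elim pos by (intro mult_right_mono many) auto
        finally show ?case .
      qed
    qed
  qed
  have lim0: "(\<lambda>n. H n (\<kappa> n + 3)) \<longlonglongrightarrow> 0"
  proof (rule Lim_null_comparison)
    show "\<forall>\<^sub>F n in sequentially. norm (H n (\<kappa> n + 3)) \<le> p n"
      using \<kappa>
    proof eventually_elim
      case (elim n)
      have pos: "0 < p n" "p n < 1" using p_pos p_less_1 elim by auto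
      have "H n (\<kappa> n + 3) \<le> (real n)\<^sup>2 * p n ^ (\<kappa> n + 3)" using elim by (intro H_le) auto
      also have "p n ^ (\<kappa> n + 3) = p n powr real (\<kappa> n + 3)" using pos by (simp only: powr_realpow)
      also have "(real n)\<^sup>2 * p n powr real (\<kappa> n + 3) \<le> (real n)\<^sup>2 * p n powr (x n + 1)"
        using elim pos by (intro mult_left_mono powr_mono') auto
      also have "\<dots> = p n" using elim pos by (subst powr_x) auto
      finally show ?case using H_nonneg elim by simp
    qed
  qed (rule p_lim)
  have "(\<lambda>n. \<P>(\<omega> in M n. int (L n \<omega>) \<in> {\<lfloor>x n\<rfloor> - 1, \<lfloor>x n\<rfloor>, \<lfloor>x n\<rfloor> + 1})) \<longlonglongrightarrow> 1 - 0"
  proof (rule prob_window[OF _ lim1 lim0])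
    show "\<forall>\<^sub>F n in sequentially. 1 \<le> \<kappa> n" using \<kappa> by eventually_elim simp
    show "\<forall>\<^sub>F n in sequentially. \<forall>\<omega>. (int (L n \<omega>) \<in> {\<lfloor>x n\<rfloor> - 1, \<lfloor>x n\<rfloor>, \<lfloor>x n\<rfloor> + 1}) = (\<kappa> n \<le> L n \<omega> \<and> L n \<omega> < \<kappa> n + 3)"
      using \<kappa> by eventually_elim auto
  qed
  then show ?thesis by simp
qed

end

end

theorem theorem1p3:
  fixes M :: "nat \<Rightarrow> 'a measure"
    and \<xi> :: "nat \<Rightarrow> nat \<Rightarrow> 'a \<Rightarrow> nat"
    and p :: "nat \<Rightarrow> real"
    and b :: ereal
  assumes p: "\<And>n. 1 \<le> n \<Longrightarrow> 0 < p n \<and> p n < 1"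
    and prob_space: "\<And>n. 1 \<le> n \<Longrightarrow> prob_space (M n)"
    and indep: "\<And>n. 1 \<le> n \<Longrightarrow>
          prob_space.indep_vars (M n) (\<lambda>_. count_space {0, 1}) (\<xi> n) {1..n}"
    and distr: "\<And>n i. 1 \<le> n \<Longrightarrow> i \<in> {1..n} \<Longrightarrow>
          \<P>(\<omega> in M n. \<xi> n i \<omega> = 1) = p n \<and> \<P>(\<omega> in M n. \<xi> n i \<omega> = 0) = 1 - p n"
    and p_lim: "p \<longlonglongrightarrow> 0"
    and np_lim: "filterlim (\<lambda>n. real n * p n) at_top sequentially"
    and b_lim: "(\<lambda>n. ereal (2 * ln (real n) / - ln (p n))) \<longlonglongrightarrow> b"
  shows
    "(b = \<infinity> \<longrightarrow>
        (\<lambda>n. \<P>(\<omega> in M n. int (longest_ap n (\<lambda>i. \<xi> n i \<omega>)) \<in>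
            {\<lfloor>2 * ln (real n) / - ln (p n) + ln (ln (real n)) / ln (p n)\<rfloor>,
             \<lfloor>2 * ln (real n) / - ln (p n) + ln (ln (real n)) / ln (p n)\<rfloor> + 1})) \<longlonglongrightarrow> 1
      \<and> (\<lambda>n. \<P>(\<omega> in M n. int (longest_ap_mod n (\<lambda>i. \<xi> n i \<omega>)) \<in>
            {\<lfloor>2 * ln (real n) / - ln (p n)\<rfloor> - 1,
             \<lfloor>2 * ln (real n) / - ln (p n)\<rfloor>,
             \<lfloor>2 * ln (real n) / - ln (p n)\<rfloor> + 1})) \<longlonglongrightarrow> 1)
   \<and> (\<forall>\<beta>::real. b = ereal \<beta> \<and> (\<beta> = 2 \<or> 2 < \<beta> \<and> \<beta> \<notin> \<int>) \<longrightarrow>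
        (\<lambda>n. \<P>(\<omega> in M n. int (longest_ap_mod n (\<lambda>i. \<xi> n i \<omega>)) = \<lfloor>\<beta>\<rfloor>)) \<longlonglongrightarrow> 1
      \<and> (\<lambda>n. \<P>(\<omega> in M n. int (longest_ap n (\<lambda>i. \<xi> n i \<omega>)) = \<lfloor>\<beta>\<rfloor>)) \<longlonglongrightarrow> 1)
   \<and> (\<forall>k::nat. b = ereal (real k) \<and> 3 \<le> k \<longrightarrow>
        (\<lambda>n. \<P>(\<omega> in M n. longest_ap_mod n (\<lambda>i. \<xi> n i \<omega>) \<in> {k, k - 1})) \<longlonglongrightarrow> 1
      \<and> (\<lambda>n. \<P>(\<omega> in M n. longest_ap n (\<lambda>i. \<xi> n i \<omega>) \<in> {k, k - 1})) \<longlonglongrightarrow> 1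
      \<and> (\<forall>u::ereal. (\<lambda>n. ereal ((real n)\<^sup>2 * p n ^ k)) \<longlonglongrightarrow> u \<longrightarrow>
            (\<lambda>n. ereal \<P>(\<omega> in M n. longest_ap n (\<lambda>i. \<xi> n i \<omega>) = k - 1))
              \<longlonglongrightarrow> exp_ereal (- (u / ereal (2 * (real k - 1))))
          \<and> (\<lambda>n. ereal \<P>(\<omega> in M n. longest_ap n (\<lambda>i. \<xi> n i \<omega>) = k))
              \<longlonglongrightarrow> 1 - exp_ereal (- (u / ereal (2 * (real k - 1))))
          \<and> (\<lambda>n. ereal \<P>(\<omega> in M n. longest_ap_mod n (\<lambda>i. \<xi> n i \<omega>) = k - 1))
              \<longlonglongrightarrow> exp_ereal (- (u / 2))
          \<and> (\<lambda>n. ereal \<P>(\<omega> in M n. longest_ap_mod n (\<lambda>i. \<xi> n i \<omega>) = k))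
              \<longlonglongrightarrow> 1 - exp_ereal (- (u / 2))))"
proof -
  let ?U = "\<lambda>n \<omega>. longest_ap n (\<lambda>i. \<xi> n i \<omega>)"
  let ?W = "\<lambda>n \<omega>. longest_ap_mod n (\<lambda>i. \<xi> n i \<omega>)"
  have seq: "bernoulli_sequence (M n) n (\<xi> n) (p n)" if "1 \<le> n" for n
    unfolding bernoulli_sequence_def bernoulli_sequence_axioms_def
    using p[OF that] prob_space[OF that] indep[OF that] distr[OF that] that by blast
  have pow_nonneg: "0 \<le> (real n)\<^sup>2 * p n ^ k" if "1 \<le> n" for n k
    using p[OF that] by simp
  have sharp_U: "measure (M n) {\<omega>\<in>space (M n). k \<le> ?U n \<omega>} \<le> (real n)\<^sup>2 * p n ^ k / real (k - 1)"
    if "1 \<le> n" "2 \<le> k" for n k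
    using bernoulli_sequence.prob_ge_le[OF seq[OF that(1)] that(2)]
    by (simp only: bernoulli_sequence.prob_ge_def[OF seq[OF that(1)]])
  \<comment> \<open>The interval statistic is driven by the good progressions inside {1..n}, of
    density 1 / (2 (k - 1)); below, the modular one uses all good progressions, of density 1 /
    2.\<close>
  interpret U: ap_statistic M p "\<lambda>n k. card (good_aps n k \<inter> aps n k)" ?U
  proof
    fix n k :: nat assume n: "1 \<le> n"
    interpret B: bernoulli_sequence "M n" n "\<xi> n" "p n" by (rule seq[OF n])
    show "0 < p n" "p n < 1" using p[OF n] by auto
    show "0 \<le> measure (M n) {\<omega>\<in>space (M n). k \<le> ?U n \<omega>}" by simp
    show "measure (M n) {\<omega>\<in>space (M n). k \<le> ?U n \<omega>} \<le> 1" by simp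
    show "measure (M n) {\<omega>\<in>space (M n). k \<le> ?U n \<omega>} \<le> (real n)\<^sup>2 * p n ^ k" if "2 \<le> k"
    proof (rule order_trans[OF sharp_U[OF n that]])
      have "(real n)\<^sup>2 * p n ^ k / real (k - 1) \<le> (real n)\<^sup>2 * p n ^ k / 1"
        using that pow_nonneg[OF n, of k] by (intro divide_left_mono) auto
      then show "(real n)\<^sup>2 * p n ^ k / real (k - 1) \<le> (real n)\<^sup>2 * p n ^ k" by simp
    qed
    show "1 - measure (M n) {\<omega>\<in>space (M n). k \<le> ?U n \<omega>}
        \<le> (1 + overlap_bound n k (p n)) / (real (card (good_aps n k \<inter> aps n k)) * p n ^ k)"
      if "2 \<le> k" "p n \<le> 1 / 2" "0 < card (good_aps n k \<inter> aps n k)"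
      using B.prob_ge_bounds(1)[OF that(1,2)] that(3) unfolding B.prob_ge_def by fastforce
    show "\<bar>1 - measure (M n) {\<omega>\<in>space (M n). k \<le> ?U n \<omega>} - (1 - p n ^ k) ^ card (good_aps n k \<inter> aps n k)\<bar>
        \<le> 2 * (real (card (good_aps n k \<inter> aps n k)) * p n ^ k * overlap_bound n k (p n))
          + real (n * k ^ 4) * p n ^ k" if "3 \<le> k" "p n \<le> 1 / 2"
      using B.prob_ge_bounds(2)[OF _ that(2,1)] that(1) unfolding B.prob_ge_def by simp
    show "(real n)\<^sup>2 / (16 * real k) \<le> real (card (good_aps n k \<inter> aps n k))" if "2 \<le> k" "8 * k ^ 5 \<le> n"
      by (rule card_good_aps_inter_ge_real[OF n that])
  next
    fix n a b :: nat assume n: "1 \<le> n" and ab: "1 \<le> a" "a \<le> b"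
    interpret B: bernoulli_sequence "M n" n "\<xi> n" "p n" by (rule seq[OF n])
    show "measure (M n) {\<omega>\<in>space (M n). a \<le> ?U n \<omega> \<and> ?U n \<omega> < b}
        = measure (M n) {\<omega>\<in>space (M n). a \<le> ?U n \<omega>} - measure (M n) {\<omega>\<in>space (M n). b \<le> ?U n \<omega>}"
      using ab by (intro B.prob_between B.events_ge) auto
  qed (rule p_lim np_lim)+
  interpret W: ap_statistic M p "\<lambda>n k. card (good_aps n k)" ?W
  proof
    fix n k :: nat assume n: "1 \<le> n"
    interpret B: bernoulli_sequence "M n" n "\<xi> n" "p n" by (rule seq[OF n])
    show "0 < p n" "p n < 1" using p[OF n] by auto
    show "0 \<le> measure (M n) {\<omega>\<in>space (M n). k \<le> ?W n \<omega>}" by simp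
    show "measure (M n) {\<omega>\<in>space (M n). k \<le> ?W n \<omega>} \<le> 1" by simp
    show "measure (M n) {\<omega>\<in>space (M n). k \<le> ?W n \<omega>} \<le> (real n)\<^sup>2 * p n ^ k" if "2 \<le> k"
      using B.prob_ge_mod_le[of k] that unfolding B.prob_ge_mod_def by simp
    show "1 - measure (M n) {\<omega>\<in>space (M n). k \<le> ?W n \<omega>}
        \<le> (1 + overlap_bound n k (p n)) / (real (card (good_aps n k)) * p n ^ k)"
      if "2 \<le> k" "p n \<le> 1 / 2" "0 < card (good_aps n k)"
      using B.prob_ge_mod_bounds(1)[OF that(1,2)] that(3) unfolding B.prob_ge_mod_def by fastforce
    show "\<bar>1 - measure (M n) {\<omega>\<in>space (M n). k \<le> ?W n \<omega>} - (1 - p n ^ k) ^ card (good_aps n k)\<bar>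
        \<le> 2 * (real (card (good_aps n k)) * p n ^ k * overlap_bound n k (p n))
          + real (n * k ^ 4) * p n ^ k" if "3 \<le> k" "p n \<le> 1 / 2"
      using B.prob_ge_mod_bounds(2)[OF _ that(2)] that(1) unfolding B.prob_ge_mod_def by simp
    show "(real n)\<^sup>2 / (16 * real k) \<le> real (card (good_aps n k))" if "2 \<le> k" "8 * k ^ 5 \<le> n"
    proof (rule order_trans[OF card_good_aps_inter_ge_real[OF n that]])
      show "real (card (good_aps n k \<inter> aps n k)) \<le> real (card (good_aps n k))"
        by (simp add: card_mono finite_good_aps)
    qed
  next
    fix n a b :: nat assume n: "1 \<le> n" and ab: "1 \<le> a" "a \<le> b"
    interpret B: bernoulli_sequence "M n" n "\<xi> n" "p n" by (rule seq[OF n])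
    show "measure (M n) {\<omega>\<in>space (M n). a \<le> ?W n \<omega> \<and> ?W n \<omega> < b}
        = measure (M n) {\<omega>\<in>space (M n). a \<le> ?W n \<omega>} - measure (M n) {\<omega>\<in>space (M n). b \<le> ?W n \<omega>}"
      using ab by (intro B.prob_between B.events_ge) auto
  qed (rule p_lim np_lim)+
  have b_inf: "filterlim (\<lambda>n. 2 * ln (real n) / - ln (p n)) at_top sequentially" if "b = \<infinity>"
    using b_lim unfolding that tendsto_PInfty_eq_at_top .
  have b_fin: "(\<lambda>n. 2 * ln (real n) / - ln (p n)) \<longlonglongrightarrow> \<beta>" if "b = ereal \<beta>" for \<beta>
    using b_lim unfolding that lim_ereal .
  have U_inf: "(\<lambda>n. \<P>(\<omega> in M n. int (?U n \<omega>) \<in>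
            {\<lfloor>2 * ln (real n) / - ln (p n) + ln (ln (real n)) / ln (p n)\<rfloor>,
             \<lfloor>2 * ln (real n) / - ln (p n) + ln (ln (real n)) / ln (p n)\<rfloor> + 1})) \<longlonglongrightarrow> 1" if "b = \<infinity>"
    by (rule U.concentration_infinite_shifted[OF b_inf[OF that]]) (simp only: U.H_def sharp_U)
  have W_inf: "(\<lambda>n. \<P>(\<omega> in M n. int (?W n \<omega>) \<in>
            {\<lfloor>2 * ln (real n) / - ln (p n)\<rfloor> - 1, \<lfloor>2 * ln (real n) / - ln (p n)\<rfloor>,
             \<lfloor>2 * ln (real n) / - ln (p n)\<rfloor> + 1})) \<longlonglongrightarrow> 1" if "b = \<infinity>"
    by (rule W.concentration_infinite_plain[OF b_inf[OF that] card_good_aps_ge_quarter])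
  have lim: "(\<lambda>n. ereal \<P>(\<omega> in M n. ?U n \<omega> = k - 1)) \<longlonglongrightarrow> exp_ereal (- (u / ereal (2 * (real k - 1))))
      \<and> (\<lambda>n. ereal \<P>(\<omega> in M n. ?U n \<omega> = k)) \<longlonglongrightarrow> 1 - exp_ereal (- (u / ereal (2 * (real k - 1))))
      \<and> (\<lambda>n. ereal \<P>(\<omega> in M n. ?W n \<omega> = k - 1)) \<longlonglongrightarrow> exp_ereal (- (u / 2))
      \<and> (\<lambda>n. ereal \<P>(\<omega> in M n. ?W n \<omega> = k)) \<longlonglongrightarrow> 1 - exp_ereal (- (u / 2))"
    if bk: "b = ereal (real k)" "3 \<le> k" and u: "(\<lambda>n. ereal ((real n)\<^sup>2 * p n ^ k)) \<longlonglongrightarrow> u" for k u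
  proof -
    have d: "0 < 2 * (real k - 1)"
      "(\<lambda>n. real (card (good_aps n k \<inter> aps n k)) / (real n)\<^sup>2) \<longlonglongrightarrow> 1 / (2 * (real k - 1))"
      using card_good_aps_inter_ratio[OF bk(2)] bk(2) by (auto simp: of_nat_diff)
    have two: "(2 :: ereal) = ereal 2" by simp
    show ?thesis unfolding two
      by (intro conjI U.two_point_limit[OF b_fin[OF bk(1)] refl bk(2) u d]
          W.two_point_limit[OF b_fin[OF bk(1)] refl bk(2) u _ card_good_aps_ratio]) simp_all
  qed
  note nonint = W.concentration_nonint[OF b_fin] U.concentration_nonint[OF b_fin]
  note int = W.concentration_int[OF b_fin refl] U.concentration_int[OF b_fin refl]
  note lims = lim[THEN conjunct1] lim[THEN conjunct2, THEN conjunct1]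
    lim[THEN conjunct2, THEN conjunct2, THEN conjunct1] lim[THEN conjunct2, THEN conjunct2, THEN conjunct2]
  show ?thesis
    by (intro conjI allI impI; (elim conjE)?; rule U_inf W_inf nonint int lims; assumption)
qed

end
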